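(* Let $\Gamma$ be a Schottky group over $k$. Then there exist a basis $\beta=(\gamma_1,\dots,\gamma_g)$ of the free group $\Gamma$ and a Schottky figure $\mathcal{B}$ that is adapted to $\beta$.
   Context: $(k,|\cdot|)$ is a complete non-Archimedean valued field and $k^a$ an algebraic closure of $k$ (with the unique extension of $|\cdot|$). The Berkovich affine line $\mathbb{A}^{1,\mathrm{an}}_k$ is the set of multiplicative seminorms $|\cdot|_x$ on $k[T]$ inducing $|\cdot|$ on $k$; one writes $|P(x)|=|P|_x$, and the topology is the coarsest making all maps $x\mapsto |P(x)|$ ($P\in k[T]$) continuous. The Berkovich projective line $\mathbb{P}^{1,\mathrm{an}}_k$ is obtained by gluing two affine lines with coordinates $T,T'$ along the complements of $0$ via $T'=1/T$; $\mathrm{PGL}_2(k)$ acts on it by Möbius transformations. For $\alpha\in k$, $r>0$, $D^-(\alpha,r)=\{x : |(T-\alpha)(x)|<r\}$ (open disc) and $D^+(\alpha,r)=\{x: |(T-\alpha)(x)|\le r\}$ (closed disc). Open (resp. closed) discs of $\mathbb{P}^{1,\mathrm{an}}_k$ are the images of these by elements of $\mathrm{PGL}_2(k)$. A matrix in $\mathrm{GL}_2(k)$ is loxodromic if its eigenvalues in $k^a$ have distinct absolute values; an element of $\mathrm{PGL}_2(k)$ is loxodromic if some (equivalently every) representative is. A subgroup $\Gamma$ of $\mathrm{PGL}_2(k)$ is a Schottky group over $k$ if (i) it is free and finitely generated; (ii) all its non-trivial elements are loxodromic; (iii) there exists a non-empty $\Gamma$-invariant connected open subset of $\mathbb{P}^{1,\mathrm{an}}_k$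 on which the action of $\Gamma$ is free and proper (the action of the discrete group $\Gamma$ on a space $E$ is proper if the map $\Gamma\times E\to E\times E$, $(\gamma,x)\mapsto(x,\gamma x)$ is proper). Schottky figure: let $\gamma_1,\dots,\gamma_g\in\mathrm{PGL}_2(k)$, let $\mathcal{B}=(D^+(\gamma_i^{\varepsilon}),\,1\le i\le g,\ \varepsilon\in\{\pm1\})$ be a family of pairwise disjoint closed discs in $\mathbb{P}^{1,\mathrm{an}}_k$ and set $D^-(\gamma_i^{\varepsilon}):=\gamma_i^{\varepsilon}(\mathbb{P}^{1,\mathrm{an}}_k\setminus D^+(\gamma_i^{-\varepsilon}))$. Then $\mathcal{B}$ is a Schottky figure adapted to $(\gamma_1,\dots,\gamma_g)$ if, for all $i$ and $\varepsilon$, $D^-(\gamma_i^{\varepsilon})$ is a maximal open disc inside $D^+(\gamma_i^{\varepsilon})$. (If $\Gamma$ is trivial, the basis and the figure are empty.) *)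

theory Defs
  imports
    "HOL-Analysis.Analysis"
    "HOL-Algebra.Coset"
    "HOL-Algebra.Generated_Groups"
    "HOL-Algebra.Algebraic_Closure_Type"
    "HOL-Computational_Algebra.Polynomial"
begin

hide_const (open) UnivPoly.coeff Module.smult UnivPoly.monom Polynomials.degree

section \<open>Complete non-Archimedean fields\<close>

text \<open>The trivial absolute value is allowed.\<close>

locale nonarch_abs =
  fixes v :: "'a::field \<Rightarrow> real"
  assumes nonneg: "v a \<ge> 0"
    and eq_0_iff: "v a = 0 \<longleftrightarrow> a = 0"
    and mult: "v (a * b) = v a * v b"
    and ultrametric: "v (a + b) \<le> max (v a) (v b)"

locale complete_nonarch_field = nonarch_abs v for v :: "'a::field \<Rightarrow> real" +
  assumes complete: "Metric_space.mcomplete UNIV (\<lambda>a b. v (a - b))"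

definition extends_to_alg_closure :: "('a::field \<Rightarrow> real) \<Rightarrow> ('a alg_closure \<Rightarrow> real) \<Rightarrow> bool" where
  "extends_to_alg_closure v w \<longleftrightarrow> nonarch_abs w \<and> (\<forall>a. w (to_ac a) = v a)"


section \<open>The Berkovich affine and projective lines\<close>

definition berk_A1 :: "('a::field \<Rightarrow> real) \<Rightarrow> ('a poly \<Rightarrow> real) set" where
  "berk_A1 v = {x. (\<forall>P. x P \<ge> 0) \<and>
                   (\<forall>P Q. x (P + Q) \<le> x P + x Q) \<and>
                   (\<forall>P Q. x (P * Q) = x P * x Q) \<and>
                   (\<forall>a. x [:a:] = v a)}"

definition berk_A1_top :: "('a::field \<Rightarrow> real) \<Rightarrow> ('a poly \<Rightarrow> real) topology" where
  "berk_A1_top v = topology_generated_by {{x \<in> berk_A1 v. x P \<in> W} | P W. open W}"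

text \<open>For a point \<open>x\<close> with \<open>|B(x)| \<noteq> 0\<close>, the seminorm \<open>P \<mapsto> |P(A/B)|\<^sub>x\<close>, i.e. the point of the
  affine line whose coordinate is the value of \<open>A/B\<close> at \<open>x\<close>. The sum is
  \<open>B\<^sup>n \<cdot> P(A/B)\<close> with \<open>n = deg P\<close>.\<close>

definition frac_point :: "('a::field poly \<Rightarrow> real) \<Rightarrow> 'a poly \<Rightarrow> 'a poly \<Rightarrow> ('a poly \<Rightarrow> real)" where
  "frac_point x A B = (\<lambda>P. x (\<Sum>i\<le>degree P. smult (coeff P i) (A ^ i * B ^ (degree P - i)))
                           / x B ^ degree P)"

text \<open>The projective line is glued from two affine lines with coordinates \<open>T\<close> and \<open>T' = 1/T\<close>. The only
  point of the second line outside the first one is its origin \<open>T' = 0\<close>, which is called \<open>Infty\<close>;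
  every other glued point is named by its seminorm on the first line. The two charts are
  \<open>Aff\<close> and \<open>chart_infty\<close>, and the topology is the gluing (final) topology for them.\<close>

datatype 's glued_pt = Aff 's | Infty

type_synonym 'a berk_pt = "('a poly \<Rightarrow> real) glued_pt"

definition chart_infty :: "('a::field poly \<Rightarrow> real) \<Rightarrow> 'a berk_pt" where
  "chart_infty y = (if y [:0, 1:] = 0 then Infty else Aff (frac_point y 1 [:0, 1:]))"

definition berk_P1 :: "('a::field \<Rightarrow> real) \<Rightarrow> 'a berk_pt set" where
  "berk_P1 v = Aff ` berk_A1 v \<union> chart_infty ` berk_A1 v"

definition berk_P1_open :: "('a::field \<Rightarrow> real) \<Rightarrow> 'a berk_pt set \<Rightarrow> bool" where
  "berk_P1_open v U \<longleftrightarrow> U \<subseteq> berk_P1 v \<and>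
     openin (berk_A1_top v) {x \<in> berk_A1 v. Aff x \<in> U} \<and>
     openin (berk_A1_top v) {y \<in> berk_A1 v. chart_infty y \<in> U}"

definition berk_P1_top :: "('a::field \<Rightarrow> real) \<Rightarrow> 'a berk_pt topology" where
  "berk_P1_top v = topology (berk_P1_open v)"

lemma topspace_berk_A1_top [simp]: "topspace (berk_A1_top v) = berk_A1 v"
proof -
  have "berk_A1 v \<in> {{x \<in> berk_A1 v. x P \<in> W} | P W. open W}"
    by (rule CollectI, rule exI[of _ 0], rule exI[of _ UNIV]) auto
  then have "\<Union>{{x \<in> berk_A1 v. x P \<in> W} | P W. open W} = berk_A1 v"
    by blast
  then show ?thesis
    unfolding berk_A1_top_def topology_generated_by_topspace .
qed

lemma openin_berk_P1_top: "openin (berk_P1_top v) U \<longleftrightarrow> berk_P1_open v U"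
proof -
  have "istopology (berk_P1_open v)"
    unfolding istopology_def
  proof (intro conjI allI impI)
    fix S T assume "berk_P1_open v S" "berk_P1_open v T"
    moreover have "{x \<in> berk_A1 v. f x \<in> S \<inter> T} = {x \<in> berk_A1 v. f x \<in> S} \<inter> {x \<in> berk_A1 v. f x \<in> T}"
      for f :: "('a poly \<Rightarrow> real) \<Rightarrow> 'a berk_pt" by blast
    ultimately show "berk_P1_open v (S \<inter> T)"
      unfolding berk_P1_open_def by (simp add: openin_Int le_infI1)
  next
    fix \<K> assume K: "\<forall>K\<in>\<K>. berk_P1_open v K"
    have "{x \<in> berk_A1 v. f x \<in> \<Union>\<K>} = (\<Union>K\<in>\<K>. {x \<in> berk_A1 v. f x \<in> K})"
      for f :: "('a poly \<Rightarrow> real) \<Rightarrow> 'a berk_pt" by blast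
    with K show "berk_P1_open v (\<Union>\<K>)"
      unfolding berk_P1_open_def by (simp add: Sup_least openin_clauses(3))
  qed
  then show ?thesis
    unfolding berk_P1_top_def by simp
qed

lemma topspace_berk_P1_top [simp]: "topspace (berk_P1_top v) = berk_P1 v"
proof
  show "topspace (berk_P1_top v) \<subseteq> berk_P1 v"
    using openin_topspace[of "berk_P1_top v"] unfolding openin_berk_P1_top berk_P1_open_def by simp
  have "{x \<in> berk_A1 v. Aff x \<in> berk_P1 v} = berk_A1 v"
    "{x \<in> berk_A1 v. chart_infty x \<in> berk_P1 v} = berk_A1 v"
    by (auto simp: berk_P1_def)
  then have "openin (berk_P1_top v) (berk_P1 v)"
    unfolding openin_berk_P1_top berk_P1_open_def
    using openin_topspace[of "berk_A1_top v"] by simp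
  then show "berk_P1 v \<subseteq> topspace (berk_P1_top v)"
    by (rule openin_subset)
qed


section \<open>The group \<open>PGL\<^sub>2(k)\<close> and its action\<close>

definition GL2 :: "('a::field ^ 2 ^ 2) monoid" where
  "GL2 = \<lparr>carrier = {M. invertible M}, monoid.mult = (**), one = mat 1\<rparr>"

definition PGL2 :: "('a::field ^ 2 ^ 2) set monoid" where
  "PGL2 = GL2 Mod {mat c | c. c \<noteq> 0}"

text \<open>At \<open>Infty\<close>, the value is the point \<open>a/c\<close> of \<open>k\<close>, i.e. the seminorm \<open>P \<mapsto> |P(a/c)|\<close>.\<close>

fun moebius :: "('a::field \<Rightarrow> real) \<Rightarrow> 'a ^ 2 ^ 2 \<Rightarrow> 'a berk_pt \<Rightarrow> 'a berk_pt" where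
  "moebius v M (Aff x) =
     (let A = [:M $ 1 $ 2, M $ 1 $ 1:]; B = [:M $ 2 $ 2, M $ 2 $ 1:]
      in if x B = 0 then Infty else Aff (frac_point x A B))"
| "moebius v M Infty =
     (if M $ 2 $ 1 = 0 then Infty else Aff (\<lambda>P. v (poly P (M $ 1 $ 1 / M $ 2 $ 1))))"

text \<open>The choice of representative does not matter, see \<open>moebius_scale\<close> below.\<close>

definition pgl_act :: "('a::field \<Rightarrow> real) \<Rightarrow> ('a ^ 2 ^ 2) set \<Rightarrow> 'a berk_pt \<Rightarrow> 'a berk_pt" where
  "pgl_act v \<gamma> = moebius v (SOME M. M \<in> \<gamma>)"

lemma smult_sum_poly: "smult a (\<Sum>i\<in>S. f i) = (\<Sum>i\<in>S. smult a (f i))"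
  by (induction S rule: infinite_finite_induct) (simp_all add: smult_add_right)

lemma moebius_scale:
  fixes v :: "'a::field \<Rightarrow> real" and M M' :: "'a ^ 2 ^ 2"
  assumes v: "nonarch_abs v" and z: "z \<in> berk_P1 v" and c: "c \<noteq> 0"
    and M': "\<And>i j. M' $ i $ j = c * M $ i $ j"
  shows "moebius v M' z = moebius v M z"
proof (cases z)
  case Infty
  then show ?thesis using c by (simp add: M')
next
  case (Aff x)
  interpret nonarch_abs v by (rule v)
  have vc: "v c \<noteq> 0" using c eq_0_iff by simp
  have abs1: "v 1 = 1" using mult[of 1 1] eq_0_iff[of 1] by simp
  have smult_A1: "y (smult a Q) = v a * y Q" if "y \<in> berk_A1 v" for y a Q
  proof -
    have "y ([:a:] * Q) = y [:a:] * y Q" and "y [:a:] = v a"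
      using that unfolding berk_A1_def by blast+
    then show ?thesis by simp
  qed
  have x_smult: "x (smult a Q) = v a * x Q" for a Q
  proof -
    consider "x \<in> berk_A1 v" | y where "y \<in> berk_A1 v" "x = frac_point y 1 [:0, 1:]"
      using z Aff by (auto simp: berk_P1_def chart_infty_def split: if_splits)
    then show ?thesis
    proof cases
      case 1
      then show ?thesis by (rule smult_A1)
    next
      case 2
      note y = smult_A1[OF 2(1)]
      have y0: "y 0 = 0" and v0: "v 0 = 0"
        using y[of 0 0] eq_0_iff[of 0] by simp_all
      show ?thesis
      proof (cases "a = 0")
        case True
        then show ?thesis by (simp add: 2(2) frac_point_def y0 v0)
      next
        case False
        have "(\<Sum>i\<le>degree Q. smult (a * coeff Q i) (1 ^ i * [:0, 1:] ^ (degree Q - i)))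
            = smult a (\<Sum>i\<le>degree Q. smult (coeff Q i) (1 ^ i * [:0, 1:] ^ (degree Q - i)))"
          by (simp only: smult_sum_poly smult_smult)
        then show ?thesis
          using False by (simp only: 2(2) frac_point_def y coeff_smult degree_smult_eq if_False times_divide_eq_right)
      qed
    qed
  qed
  define A B where "A = [:M $ 1 $ 2, M $ 1 $ 1:]" and "B = [:M $ 2 $ 2, M $ 2 $ 1:]"
  have AB': "[:M' $ 1 $ 2, M' $ 1 $ 1:] = smult c A" "[:M' $ 2 $ 2, M' $ 2 $ 1:] = smult c B"
    by (simp_all add: A_def B_def M')
  have vpow: "v (c ^ n) = v c ^ n" for n
    by (induction n) (simp_all add: abs1 mult)
  have "frac_point x (smult c A) (smult c B) P = frac_point x A B P" for P
  proof -
    have "(\<Sum>i\<le>degree P. smult (coeff P i) (smult c A ^ i * smult c B ^ (degree P - i)))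
        = (\<Sum>i\<le>degree P. smult (c ^ degree P) (smult (coeff P i) (A ^ i * B ^ (degree P - i))))"
    proof (rule sum.cong[OF refl])
      fix i assume "i \<in> {..degree P}"
      then have "c ^ degree P = c ^ i * c ^ (degree P - i)"
        by (simp flip: power_add)
      then show "smult (coeff P i) (smult c A ^ i * smult c B ^ (degree P - i))
          = smult (c ^ degree P) (smult (coeff P i) (A ^ i * B ^ (degree P - i)))"
        by (simp add: smult_power mult_ac)
    qed
    also have "\<dots> = smult (c ^ degree P) (\<Sum>i\<le>degree P. smult (coeff P i) (A ^ i * B ^ (degree P - i)))"
      by (simp only: smult_sum_poly)
    finally show ?thesis
      using vc by (simp add: frac_point_def x_smult vpow power_mult_distrib)
  qed
  then have "frac_point x (smult c A) (smult c B) = frac_point x A B" by blast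
  then show ?thesis
    using vc by (simp add: Aff AB' x_smult flip: A_def B_def)
qed


section \<open>Loxodromic elements\<close>

definition eigenvalue_ac :: "'a::field ^ 2 ^ 2 \<Rightarrow> 'a alg_closure \<Rightarrow> bool" where
  "eigenvalue_ac M l \<longleftrightarrow> (\<exists>u. u \<noteq> 0 \<and> map_matrix to_ac M *v u = l *s u)"

definition loxodromic_matrix :: "('a::field alg_closure \<Rightarrow> real) \<Rightarrow> 'a ^ 2 ^ 2 \<Rightarrow> bool" where
  "loxodromic_matrix w M \<longleftrightarrow>
     (\<exists>l l'. eigenvalue_ac M l \<and> eigenvalue_ac M l' \<and> w l \<noteq> w l')"

definition loxodromic :: "('a::field alg_closure \<Rightarrow> real) \<Rightarrow> ('a ^ 2 ^ 2) set \<Rightarrow> bool" where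
  "loxodromic w \<gamma> \<longleftrightarrow> (\<exists>M\<in>\<gamma>. loxodromic_matrix w M)"


section \<open>Free groups\<close>

text \<open>A word is a list of letters \<open>(i, \<epsilon>)\<close> with \<open>\<epsilon> = \<plusminus>1\<close>, standing for \<open>\<gamma>\<^sub>i\<close> raised to the power \<open>\<epsilon>\<close>. A family
  is a basis if every group element is the value of exactly one reduced word.\<close>

definition reduced_words :: "'i set \<Rightarrow> ('i \<times> int) list set" where
  "reduced_words I = {ws. set ws \<subseteq> I \<times> {1, -1} \<and>
                          successively (\<lambda>(i, e) (j, d). \<not> (i = j \<and> d = - e)) ws}"

definition word_value :: "('g, 'x) monoid_scheme \<Rightarrow> ('i \<Rightarrow> 'g) \<Rightarrow> ('i \<times> int) list \<Rightarrow> 'g" where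
  "word_value G \<gamma> ws = foldr (\<lambda>(i, e) h. (\<gamma> i [^]\<^bsub>G\<^esub> e) \<otimes>\<^bsub>G\<^esub> h) ws \<one>\<^bsub>G\<^esub>"

definition free_basis :: "('g, 'x) monoid_scheme \<Rightarrow> 'i set \<Rightarrow> ('i \<Rightarrow> 'g) \<Rightarrow> bool" where
  "free_basis G I \<gamma> \<longleftrightarrow>
     \<gamma> ` I \<subseteq> carrier G \<and> bij_betw (word_value G \<gamma>) (reduced_words I) (carrier G)"

definition free_group :: "('g, 'x) monoid_scheme \<Rightarrow> bool" where
  "free_group G \<longleftrightarrow> group G \<and> (\<exists>S. free_basis G S (\<lambda>s. s))"

definition finitely_generated_group :: "('g, 'x) monoid_scheme \<Rightarrow> bool" where
  "finitely_generated_group G \<longleftrightarrow>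
     group G \<and> (\<exists>S. finite S \<and> S \<subseteq> carrier G \<and> generate G S = carrier G)"


section \<open>Schottky groups\<close>

definition free_action_on ::
    "('a::field \<Rightarrow> real) \<Rightarrow> ('a ^ 2 ^ 2) set set \<Rightarrow> 'a berk_pt set \<Rightarrow> bool" where
  "free_action_on v \<Gamma> U \<longleftrightarrow>
     (\<forall>\<gamma>\<in>\<Gamma>. \<forall>z\<in>U. pgl_act v \<gamma> z = z \<longrightarrow> \<gamma> = \<one>\<^bsub>PGL2\<^esub>)"

definition proper_action_on ::
    "('a::field \<Rightarrow> real) \<Rightarrow> ('a ^ 2 ^ 2) set set \<Rightarrow> 'a berk_pt set \<Rightarrow> bool" where
  "proper_action_on v \<Gamma> U \<longleftrightarrow>
     (let E = subtopology (berk_P1_top v) U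
      in proper_map (prod_topology (discrete_topology \<Gamma>) E) (prod_topology E E)
           (\<lambda>(\<gamma>, z). (z, pgl_act v \<gamma> z)))"

definition schottky_group ::
    "('a::field \<Rightarrow> real) \<Rightarrow> ('a alg_closure \<Rightarrow> real) \<Rightarrow> ('a ^ 2 ^ 2) set set \<Rightarrow> bool" where
  "schottky_group v w \<Gamma> \<longleftrightarrow>
     subgroup \<Gamma> PGL2 \<and>
     free_group (PGL2\<lparr>carrier := \<Gamma>\<rparr>) \<and> finitely_generated_group (PGL2\<lparr>carrier := \<Gamma>\<rparr>) \<and>
     (\<forall>\<gamma>\<in>\<Gamma>. \<gamma> \<noteq> \<one>\<^bsub>PGL2\<^esub> \<longrightarrow> loxodromic w \<gamma>) \<and>
     (\<exists>U. U \<noteq> {} \<and> (\<forall>\<gamma>\<in>\<Gamma>. pgl_act v \<gamma> ` U = U) \<and>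
          connectedin (berk_P1_top v) U \<and> openin (berk_P1_top v) U \<and>
          free_action_on v \<Gamma> U \<and> proper_action_on v \<Gamma> U)"


section \<open>Discs and Schottky figures\<close>

definition open_disc_A1 :: "('a::field \<Rightarrow> real) \<Rightarrow> 'a \<Rightarrow> real \<Rightarrow> 'a berk_pt set" where
  "open_disc_A1 v \<alpha> r = Aff ` {x \<in> berk_A1 v. x [:- \<alpha>, 1:] < r}"

definition closed_disc_A1 :: "('a::field \<Rightarrow> real) \<Rightarrow> 'a \<Rightarrow> real \<Rightarrow> 'a berk_pt set" where
  "closed_disc_A1 v \<alpha> r = Aff ` {x \<in> berk_A1 v. x [:- \<alpha>, 1:] \<le> r}"

definition open_disc :: "('a::field \<Rightarrow> real) \<Rightarrow> 'a berk_pt set \<Rightarrow> bool" where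
  "open_disc v D \<longleftrightarrow>
     (\<exists>\<gamma>\<in>carrier PGL2. \<exists>\<alpha> r. r > 0 \<and> D = pgl_act v \<gamma> ` open_disc_A1 v \<alpha> r)"

definition closed_disc :: "('a::field \<Rightarrow> real) \<Rightarrow> 'a berk_pt set \<Rightarrow> bool" where
  "closed_disc v D \<longleftrightarrow>
     (\<exists>\<gamma>\<in>carrier PGL2. \<exists>\<alpha> r. r > 0 \<and> D = pgl_act v \<gamma> ` closed_disc_A1 v \<alpha> r)"

definition maximal_open_disc_in ::
    "('a::field \<Rightarrow> real) \<Rightarrow> 'a berk_pt set \<Rightarrow> 'a berk_pt set \<Rightarrow> bool" where
  "maximal_open_disc_in v D D' \<longleftrightarrow>
     open_disc v D \<and> D \<subseteq> D' \<and> (\<forall>D''. open_disc v D'' \<and> D'' \<subseteq> D' \<and> D \<subseteq> D'' \<longrightarrow> D'' = D)"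

text \<open>\<open>D i \<epsilon>\<close> is the closed disc \<open>D\<^sup>+(\<gamma>\<^sub>i\<^sup>\<epsilon>)\<close>, and the figure is indexed by \<open>1 \<le> i \<le> g\<close>, \<open>\<epsilon> = \<plusminus>1\<close>.
  The set appearing in the last clause is \<open>D\<^sup>-(\<gamma>\<^sub>i\<^sup>\<epsilon>)\<close>.\<close>

definition schottky_figure_adapted ::
    "('a::field \<Rightarrow> real) \<Rightarrow> nat \<Rightarrow> (nat \<Rightarrow> ('a ^ 2 ^ 2) set) \<Rightarrow> (nat \<Rightarrow> int \<Rightarrow> 'a berk_pt set) \<Rightarrow> bool" where
  "schottky_figure_adapted v g \<gamma> D \<longleftrightarrow>
     (\<forall>i\<in>{1..g}. \<gamma> i \<in> carrier PGL2) \<and>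
     (\<forall>i\<in>{1..g}. \<forall>\<epsilon>\<in>{1, -1}. closed_disc v (D i \<epsilon>)) \<and>
     disjoint_family_on (\<lambda>(i, \<epsilon>). D i \<epsilon>) ({1..g} \<times> {1, -1}) \<and>
     (\<forall>i\<in>{1..g}. \<forall>\<epsilon>\<in>{1, -1}.
        maximal_open_disc_in v
          (pgl_act v (\<gamma> i [^]\<^bsub>PGL2\<^esub> \<epsilon>) ` (berk_P1 v - D i (- \<epsilon>))) (D i \<epsilon>))"

end

theory Submission
  imports Defs
begin

text \<open>
  Write \<open>\<eta>(a, r)\<close> for the point of the projective line given by the Gauss norm of the disc with centre
  \<open>a \<in> k\<close> and radius \<open>r > 0\<close>. These \<^emph>\<open>disc points\<close> form a tree: the distance of \<open>\<eta>(a, r)\<close> and \<open>\<eta>(b, s)\<close> is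
  \<open>2 log R - log r - log s\<close>, where \<open>R = max(r, s, |a - b|)\<close> is the radius of the smallest disc containing both
  discs. The group \<open>PGL\<^sub>2(k)\<close> acts on it by isometries, and removing a disc point \<open>q\<close> from the line
  leaves, besides pieces that contain no disc point, one open disc for each direction at \<open>q\<close> in the tree.
  So a Schottky figure is found by cutting a tree at suitable points: if \<open>m\<close> lies strictly between \<open>p\<close> and
  \<open>\<gamma>p\<close>, let \<open>D\<^sup>+(\<gamma>)\<close> be the complement of the open disc at \<open>m\<close> in the direction of \<open>p\<close>. It contains the open
  disc at \<open>m\<close> in the direction of \<open>\<gamma>p\<close>, which is maximal in it, and this open disc is the image
  under \<open>\<gamma>\<close> of the open disc at \<open>\<gamma>\<^sup>-\<^sup>1m\<close> in the direction of \<open>p\<close>, that is, of the complement of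
  \<open>D\<^sup>+(\<gamma>\<^sup>-\<^sup>1)\<close> if \<open>\<gamma>\<^sup>-\<^sup>1m\<close> is the point chosen for \<open>\<gamma>\<^sup>-\<^sup>1\<close>. Two of these closed discs are disjoint as soon as
  neither of the two points lies between \<open>p\<close> and the other.

  It remains to choose generators and cutting points. Let \<open>U\<close> be the invariant connected open set of the
  Schottky group \<open>\<Gamma>\<close>, which is assumed nontrivial. Since every disc point separates the line, the
  disc points in \<open>U\<close> form a subtree (\<open>connected_disc_convex\<close>). The subtree is not empty: otherwise all
  points of \<open>U\<close> would induce the same seminorm on the polynomials of degree at most one, and a loxodromic
  element, having two eigenvectors over \<open>k\<close> with eigenvalues of different size, cannot scale such a
  seminorm without fixing the point it comes from (\<open>connected_invariant_has_disc_pt\<close>). Segments of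
  the tree are compact, so properness says that a segment meets only finitely many translates of another.

  The combinatorial heart is \<open>separating_generators\<close>, on a finitely generated group that acts in this way,
  freely and isometrically, on a tree. The medians of triples of points in the orbit of a base point \<open>p\<close>
  are the vertices of a simplicial tree. As in the theorem of Serre on free actions, choose a maximal
  connected set \<open>Y\<close> of vertices that contains \<open>p\<close> and no two vertices of the same orbit; its translates
  partition the vertices. The elements \<open>\<gamma>\<close> for which an edge joins \<open>Y\<close> to \<open>\<gamma>Y\<close> generate the group, finitely
  many of them suffice, and the midpoint of that edge, which is unique, is the cutting point of \<open>\<gamma>\<close>.
  That they are a basis follows at the end from ping-pong on the discs (\<open>ping_pong_free_basis\<close>).
\<close>

section \<open>Metric trees\<close>

text \<open>The four-point condition says that among the three sums of opposite distances of four points the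
  two largest agree; together with the existence of geodesics it characterises real trees.\<close>
locale tree_metric =
  fixes M :: "'x set" and d :: "'x \<Rightarrow> 'x \<Rightarrow> real"
  assumes dist_eq_0: "\<lbrakk>x \<in> M; y \<in> M\<rbrakk> \<Longrightarrow> d x y = 0 \<longleftrightarrow> x = y"
    and dist_sym: "\<lbrakk>x \<in> M; y \<in> M\<rbrakk> \<Longrightarrow> d x y = d y x"
    and dist_triangle: "\<lbrakk>x \<in> M; y \<in> M; z \<in> M\<rbrakk> \<Longrightarrow> d x z \<le> d x y + d y z"
    and four_point: "\<lbrakk>x \<in> M; y \<in> M; z \<in> M; t \<in> M\<rbrakk> \<Longrightarrow>
      d x y + d z t \<le> max (d x z + d y t) (d x t + d y z)"
    and geodesic: "\<lbrakk>x \<in> M; y \<in> M; 0 \<le> r; r \<le> d x y\<rbrakk> \<Longrightarrow>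
      \<exists>z\<in>M. d x z = r \<and> d z y = d x y - r"
begin

definition seg :: "'x \<Rightarrow> 'x \<Rightarrow> 'x set" where
  "seg x y = {z \<in> M. d x z + d z y = d x y}"

lemma seg_in: "z \<in> seg x y \<Longrightarrow> z \<in> M"
  by (simp add: seg_def)

lemma dist_nonneg: "x \<in> M \<Longrightarrow> y \<in> M \<Longrightarrow> 0 \<le> d x y"
  using dist_triangle[of x y x] dist_eq_0[of x x] dist_sym[of x y] by auto

lemma seg_commute: "x \<in> M \<Longrightarrow> y \<in> M \<Longrightarrow> seg x y = seg y x"
  unfolding seg_def using dist_sym by fastforce

lemma seg_ends: "x \<in> M \<Longrightarrow> y \<in> M \<Longrightarrow> x \<in> seg x y" "x \<in> M \<Longrightarrow> y \<in> M \<Longrightarrow> y \<in> seg x y"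
  unfolding seg_def using dist_eq_0[of x x] dist_eq_0[of y y] by auto

lemma seg_self: "x \<in> M \<Longrightarrow> seg x x = {x}"
proof -
  assume x: "x \<in> M"
  have "z = x" if "z \<in> M" "d x z + d z x = d x x" for z
    using that x dist_eq_0[of x x] dist_eq_0[of x z] dist_sym[of x z] dist_nonneg[of x z] by auto
  then show ?thesis using seg_ends(1)[OF x x] unfolding seg_def by auto
qed

text \<open>Triangles are tripods: a point on one side lies on one of the two others. Almost everything below
  is derived from this and from the order on a segment.\<close>
lemma seg_split:
  assumes "x \<in> seg a c" "a \<in> M" "b \<in> M" "c \<in> M"
  shows "x \<in> seg a b \<or> x \<in> seg b c"
proof -
  have x: "x \<in> M" and eq: "d a x + d x c = d a c" using assms by (auto simp: seg_def)
  have "d a c + d x b \<le> max (d a x + d c b) (d a b + d c x)"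
    using four_point[of a c x b] x assms by simp
  moreover have "d a b \<le> d a x + d x b" "d b c \<le> d b x + d x c"
    using dist_triangle x assms by auto
  moreover have "d x b = d b x" "d c b = d b c" "d c x = d x c" using dist_sym x assms by auto
  ultimately show ?thesis
    using x eq unfolding seg_def by (auto simp: max_def split: if_splits)
qed

lemma seg_order:
  assumes "x \<in> seg a b" "y \<in> seg a x" "a \<in> M" "b \<in> M"
  shows "y \<in> seg a b" "x \<in> seg y b"
proof -
  have x: "x \<in> M" and y: "y \<in> M"
    and eq: "d a x + d x b = d a b" "d a y + d y x = d a x" using assms by (auto simp: seg_def)
  have "d a b \<le> d a y + d y b" "d y b \<le> d y x + d x b" using dist_triangle x y assms by auto
  then show "y \<in> seg a b" "x \<in> seg y b" using eq x y by (auto simp: seg_def)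
qed

lemma seg_antisym:
  assumes "x \<in> seg a y" "y \<in> seg a x" "a \<in> M"
  shows "x = y"
  using assms dist_nonneg[of x y] dist_eq_0[of x y] dist_sym[of x y] unfolding seg_def by auto

text \<open>Segments that overlap in more than a point concatenate, since a path in a tree cannot turn back.\<close>
lemma seg_concat:
  assumes "c \<in> seg y x" "x \<in> seg c l" "c \<noteq> x" "y \<in> M" "x \<in> M" "l \<in> M"
  shows "c \<in> seg y l"
proof -
  have c: "c \<in> M" using assms seg_in by auto
  from seg_split[OF assms(1) \<open>y \<in> M\<close> \<open>l \<in> M\<close> \<open>x \<in> M\<close>] show ?thesis
  proof
    assume "c \<in> seg l x"
    moreover have "x \<in> seg l c" using assms c seg_commute by auto
    ultimately show ?thesis using seg_antisym[of c l x] assms by auto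
  qed
qed

lemma seg_eqI:
  assumes "x \<in> seg a b" "y \<in> seg a b" "d a x = d a y" "a \<in> M" "b \<in> M"
  shows "x = y"
proof -
  have x: "x \<in> M" and y: "y \<in> M"
    and eq: "d a x + d x b = d a b" "d a y + d y b = d a b" using assms by (auto simp: seg_def)
  have "d a b + d x y \<le> max (d a x + d b y) (d a y + d b x)" using four_point[of a b x y] x y assms by simp
  moreover have "d b y = d y b" "d b x = d x b" using dist_sym x y assms by auto
  ultimately have "d x y \<le> 0" using eq assms by simp
  then show ?thesis using dist_nonneg[OF x y] dist_eq_0[OF x y] by auto
qed

text \<open>The median lies on the segment from \<open>a\<close> to \<open>b\<close> at the distance from \<open>a\<close> that is the Gromov product of
  \<open>b\<close> and \<open>c\<close> based at \<open>a\<close>.\<close>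
lemma median_exists:
  assumes "a \<in> M" "b \<in> M" "c \<in> M"
  obtains m where "m \<in> seg a b" "m \<in> seg b c" "m \<in> seg a c"
proof -
  define t where "t = (d a b + d a c - d b c) / 2"
  note s = dist_sym
  have "0 \<le> t" using dist_triangle[of b a c] s[of b a] assms unfolding t_def by simp
  moreover have "t \<le> d a b" using dist_triangle[of a b c] assms unfolding t_def by simp
  ultimately obtain m where m: "m \<in> M" "d a m = t" "d m b = d a b - t"
    using geodesic[of a b t] assms by blast
  have "d a b + d m c \<le> max (d a m + d b c) (d a c + d b m)"
    using four_point[of a b m c] m assms by simp
  moreover have "d b m = d m b" using s m assms by auto
  ultimately have "d m c \<le> (d a c + d b c - d a b) / 2"
    using m unfolding t_def by (simp add: field_simps)
  moreover have "d a c \<le> d a m + d m c" "d b c \<le> d b m + d m c"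
    using dist_triangle m assms by auto
  ultimately have "m \<in> seg a b" "m \<in> seg b c" "m \<in> seg a c"
    using m \<open>d b m = d m b\<close> unfolding seg_def t_def by (auto simp: field_simps)
  then show thesis by (rule that)
qed

lemma median_unique:
  assumes "x \<in> seg u w" "x \<in> seg u z" "x \<in> seg w z"
    and "y \<in> seg u w" "y \<in> seg u z" "y \<in> seg w z" and "u \<in> M" "w \<in> M" "z \<in> M"
  shows "x = y"
proof (rule seg_eqI[OF assms(1,4)])
  have "d t w = d w t" if "t \<in> M" for t using dist_sym that assms by auto
  moreover have "x \<in> M" "y \<in> M" using seg_in assms by auto
  ultimately show "d u x = d u y" using assms unfolding seg_def by force
qed (use assms in auto)

definition mid :: "'x \<Rightarrow> 'x \<Rightarrow> 'x" where
  "mid x y = (THE z. z \<in> seg x y \<and> d x z = d x y / 2)"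

lemma mid_eqI:
  assumes "z \<in> seg x y" "d x z = d x y / 2" "x \<in> M" "y \<in> M"
  shows "mid x y = z"
  unfolding mid_def using assms seg_eqI[of _ x y] by (intro the_equality) auto

lemma mid_props:
  assumes "x \<in> M" "y \<in> M"
  shows "mid x y \<in> seg x y" "d x (mid x y) = d x y / 2"
proof -
  obtain z where z: "z \<in> M" "d x z = d x y / 2" "d z y = d x y - d x y / 2"
    using geodesic[OF assms, of "d x y / 2"] dist_nonneg[OF assms] by auto
  then have "z \<in> seg x y" by (simp add: seg_def)
  with z mid_eqI[of z x y] assms show "mid x y \<in> seg x y" "d x (mid x y) = d x y / 2" by auto
qed

lemma mid_commute: "x \<in> M \<Longrightarrow> y \<in> M \<Longrightarrow> mid x y = mid y x"
proof -
  assume xy: "x \<in> M" "y \<in> M"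
  have m: "mid y x \<in> seg y x" "d y (mid y x) = d y x / 2" using mid_props[of y x] xy by auto
  then have "mid y x \<in> M" using seg_in by blast
  then show ?thesis using m seg_commute[OF xy] dist_sym[of y x] dist_sym[of "mid y x" y] dist_sym[of "mid y x" x] xy
    by (intro mid_eqI) (auto simp: seg_def)
qed

lemma mid_neq:
  assumes "x \<in> M" "y \<in> M" "x \<noteq> y"
  shows "mid x y \<noteq> x" "mid x y \<noteq> y"
proof -
  have pos: "d x y > 0" using dist_nonneg[of x y] dist_eq_0[of x y] assms by auto
  show "mid x y \<noteq> x" "mid x y \<noteq> y"
    using mid_props(2)[of x y] pos assms dist_eq_0[of x x] by auto
qed

end

section \<open>Free actions on metric trees\<close>

text \<open>The condition \<open>seg_proper\<close> replaces proper discontinuity: it is what properness of the action on the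
  projective line gives when segments are compact.\<close>
locale tree_action = group G + tree_metric M d
  for G :: "('g, 'm) monoid_scheme" (structure) and M :: "'x set" and d :: "'x \<Rightarrow> 'x \<Rightarrow> real" +
  fixes act :: "'g \<Rightarrow> 'x \<Rightarrow> 'x" and S :: "'g set" and p :: 'x
  assumes act_closed: "\<lbrakk>g \<in> carrier G; x \<in> M\<rbrakk> \<Longrightarrow> act g x \<in> M"
    and act_mult: "\<lbrakk>g \<in> carrier G; h \<in> carrier G; x \<in> M\<rbrakk> \<Longrightarrow> act (g \<otimes> h) x = act g (act h x)"
    and act_one: "x \<in> M \<Longrightarrow> act \<one> x = x"
    and act_isometry: "\<lbrakk>g \<in> carrier G; x \<in> M; y \<in> M\<rbrakk> \<Longrightarrow> d (act g x) (act g y) = d x y"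
    and act_free: "\<lbrakk>g \<in> carrier G; x \<in> M; act g x = x\<rbrakk> \<Longrightarrow> g = \<one>"
    and gen_finite: "finite S" and gen_closed: "S \<subseteq> carrier G" and gen: "generate G S = carrier G"
    and seg_proper: "\<lbrakk>a \<in> M; b \<in> M; c \<in> M; e \<in> M\<rbrakk> \<Longrightarrow>
      finite {g \<in> carrier G. act g ` seg a b \<inter> seg c e \<noteq> {}}"
    and base_in: "p \<in> M"
begin

lemma act_inv [simp]: "\<lbrakk>g \<in> carrier G; x \<in> M\<rbrakk> \<Longrightarrow> act (inv g) (act g x) = x"
  "\<lbrakk>g \<in> carrier G; x \<in> M\<rbrakk> \<Longrightarrow> act g (act (inv g) x) = x"
  by (simp_all add: act_one flip: act_mult)

lemma act_seg:
  "\<lbrakk>g \<in> carrier G; a \<in> M; b \<in> M; x \<in> seg a b\<rbrakk> \<Longrightarrow> act g x \<in> seg (act g a) (act g b)"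
  by (auto simp: seg_def act_closed act_isometry)

lemma act_mid:
  assumes "g \<in> carrier G" "a \<in> M" "b \<in> M"
  shows "act g (mid a b) = mid (act g a) (act g b)"
  using mid_props[of a b] assms seg_in
  by (intro mid_eqI[symmetric] act_seg) (auto simp: act_closed act_isometry)

lemma act_cancel: "\<lbrakk>g \<in> carrier G; x \<in> M; y \<in> M; act g x = act g y\<rbrakk> \<Longrightarrow> x = y"
  by (metis act_inv(1))

text \<open>Medians of triples of orbit points: the orbit itself and the branch points of the subtree that it spans.\<close>
definition vertices :: "'x set" where
  "vertices = {x \<in> M. \<exists>g\<in>carrier G. \<exists>h\<in>carrier G. \<exists>k\<in>carrier G.
     x \<in> seg (act g p) (act h p) \<and> x \<in> seg (act h p) (act k p) \<and> x \<in> seg (act g p) (act k p)}"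

lemma vertices_in: "x \<in> vertices \<Longrightarrow> x \<in> M"
  by (simp add: vertices_def)

lemma orbit_in_vertices: "g \<in> carrier G \<Longrightarrow> act g p \<in> vertices"
  unfolding vertices_def using seg_self[of "act g p"] act_closed[OF _ base_in] by auto

lemma base_in_vertices: "p \<in> vertices"
  using orbit_in_vertices[of \<one>] act_one base_in by simp

lemma act_vertices: assumes "g \<in> carrier G" "x \<in> vertices" shows "act g x \<in> vertices"
proof -
  obtain h1 h2 h3 where h: "h1 \<in> carrier G" "h2 \<in> carrier G" "h3 \<in> carrier G" "x \<in> M"
     "x \<in> seg (act h1 p) (act h2 p)" "x \<in> seg (act h2 p) (act h3 p)" "x \<in> seg (act h1 p) (act h3 p)"
    using assms unfolding vertices_def by blast
  note c = act_closed[OF _ base_in]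
  have "act g x \<in> seg (act (g \<otimes> h) p) (act (g \<otimes> k) p)"
    if "x \<in> seg (act h p) (act k p)" "h \<in> carrier G" "k \<in> carrier G" for h k
    using act_seg[OF assms(1) c[OF that(2)] c[OF that(3)] that(1)] act_mult base_in assms that by simp
  then show ?thesis unfolding vertices_def
    using h(1-3) h(5-7) act_closed[OF assms(1) h(4)] m_closed[OF assms(1)] by blast
qed

text \<open>Every vertex \<open>x\<close> lies between an arbitrary point and some point of the orbit, because it
  lies between two points of the orbit. This turns statements about vertices into statements about the orbit.\<close>
lemma vertices_orbit_beyond:
  assumes "x \<in> vertices" "c \<in> M"
  obtains g where "g \<in> carrier G" "x \<in> seg c (act g p)"
proof -
  obtain g h where gh: "g \<in> carrier G" "h \<in> carrier G" "x \<in> seg (act g p) (act h p)"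
    using assms(1) unfolding vertices_def by blast
  note c = act_closed[OF _ base_in]
  from seg_split[OF gh(3) c[OF gh(1)] assms(2) c[OF gh(2)]] show thesis
    using that gh seg_commute[OF assms(2) c[OF gh(1)]] by blast
qed

lemma vertices_median:
  assumes "x \<in> vertices" "y \<in> vertices" "z \<in> vertices" "c \<in> seg x y" "c \<in> seg y z" "c \<in> seg x z"
  shows "c \<in> vertices"
proof (cases "c = x \<or> c = y \<or> c = z")
  case True then show ?thesis using assms by blast
next
  case False
  have M: "x \<in> M" "y \<in> M" "z \<in> M" "c \<in> M" using assms vertices_in seg_in by auto
  note cl = act_closed[OF _ base_in]
  obtain g where g: "g \<in> carrier G" "x \<in> seg c (act g p)" using vertices_orbit_beyond assms M by blast
  obtain h where h: "h \<in> carrier G" "y \<in> seg c (act h p)" using vertices_orbit_beyond assms M by blast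
  obtain k where k: "k \<in> carrier G" "z \<in> seg c (act k p)" using vertices_orbit_beyond assms M by blast
  have key: "c \<in> seg (act g' p) (act h' p)"
    if "c \<in> seg x' y'" "x' \<in> seg c (act g' p)" "y' \<in> seg c (act h' p)" "c \<noteq> x'" "c \<noteq> y'"
      "g' \<in> carrier G" "h' \<in> carrier G" "x' \<in> M" "y' \<in> M" for x' y' g' h'
  proof -
    have "c \<in> seg x' (act h' p)" using seg_concat[of c x' y' "act h' p"] that cl by auto
    then have "c \<in> seg (act h' p) x'" using seg_commute cl that by auto
    then have "c \<in> seg (act h' p) (act g' p)"
      using seg_concat[of c "act h' p" x' "act g' p"] that cl by auto
    then show ?thesis using seg_commute cl that by auto
  qed
  show ?thesis unfolding vertices_def
    using key[OF assms(4) g(2) h(2)] key[OF assms(5) h(2) k(2)] key[OF assms(6) g(2) k(2)]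
      False M g(1) h(1) k(1) by blast
qed

text \<open>A vertex on the segment is the projection to it of an orbit point. Walk through the orbit from \<open>p\<close> by
  multiplying with generators: the projection only changes along a step whose segment meets the given
  segment, and there are finitely many of these. So the orbit has only finitely many projections.\<close>
lemma finite_vertices_seg:
  assumes u: "u \<in> M" and w: "w \<in> M"
  shows "finite (vertices \<inter> seg u w)"
proof -
  note cl = act_closed[OF _ base_in]
  define proj where "proj = (\<lambda>z. SOME x. x \<in> seg u w \<and> x \<in> seg u z \<and> x \<in> seg w z)"
  have proj: "proj z \<in> seg u w \<and> proj z \<in> seg u z \<and> proj z \<in> seg w z" if z: "z \<in> M" for z
  proof -
    obtain x where "x \<in> seg u w \<and> x \<in> seg u z \<and> x \<in> seg w z"
      using median_exists[OF u w z] by blast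
    then show ?thesis
      unfolding proj_def by (rule someI[where P = "\<lambda>x. x \<in> seg u w \<and> x \<in> seg u z \<and> x \<in> seg w z"])
  qed
  have proj_eq: "x = proj z" if "z \<in> M" "x \<in> seg u w" "x \<in> seg u z" "x \<in> seg w z" for x z
    using median_unique[of x u w z "proj z"] proj[OF that(1)] that u w by blast
  have crossing: "proj z \<in> seg z z'" if z: "z \<in> M" "z' \<in> M" "proj z \<noteq> proj z'" for z z'
  proof (rule ccontr)
    assume n: "\<not> ?thesis"
    then have n': "proj z \<notin> seg z' z" using seg_commute z by auto
    have "proj z \<in> seg u z'" using seg_split[of "proj z" u z z'] proj[OF z(1)] z u n' by blast
    moreover have "proj z \<in> seg w z'" using seg_split[of "proj z" w z z'] proj[OF z(1)] z w n' by blast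
    ultimately show False using proj_eq[OF z(2)] proj[OF z(1)] z(3) by blast
  qed
  define F where "F = {g \<in> carrier G. \<exists>s\<in>S. act g ` seg p (act s p) \<inter> seg u w \<noteq> {}}"
  have "F = (\<Union>s\<in>S. {g \<in> carrier G. act g ` seg p (act s p) \<inter> seg u w \<noteq> {}})"
    unfolding F_def by blast
  then have finF: "finite F"
    using seg_proper[OF base_in _ u w] gen_finite gen_closed cl by (auto intro!: finite_UN_I)
  \<comment> \<open>the projections reached when a step of the walk meets the segment, before and after it\<close>
  define A where "A = insert (proj p) ((\<lambda>g. proj (act g p)) ` F \<union>
      (\<lambda>(g, s). proj (act (g \<otimes> s) p)) ` (F \<times> S))"
  have step: "proj (act g p) = proj (act (g \<otimes> s) p) \<or> g \<in> F" if g: "g \<in> carrier G" and s: "s \<in> S" for g s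
  proof (rule disjCI)
    assume gF: "g \<notin> F"
    have sc: "s \<in> carrier G" using s gen_closed by auto
    show "proj (act g p) = proj (act (g \<otimes> s) p)"
    proof (rule ccontr)
      assume "\<not> ?thesis"
      moreover have eq: "act (g \<otimes> s) p = act g (act s p)" using act_mult g sc base_in by auto
      ultimately have x: "proj (act g p) \<in> seg (act g p) (act g (act s p))"
        using crossing[of "act g p" "act g (act s p)"] cl g sc act_closed by auto
      have xX: "proj (act g p) \<in> M" using x seg_in by auto
      have "act (inv g) (proj (act g p)) \<in> seg p (act s p)"
        using act_seg[of "inv g" "act g p" "act g (act s p)" "proj (act g p)"] x g sc cl act_closed base_in
        by auto
      then have "proj (act g p) \<in> act g ` seg p (act s p)"
        using act_inv(2)[OF g xX] by (metis imageI)
      then have "g \<in> F" unfolding F_def using proj[of "act g p"] cl g s by blast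
      then show False using gF by blast
    qed
  qed
  have "\<forall>g\<in>carrier G. proj (act g p) \<in> A \<longrightarrow> proj (act (g \<otimes> l) p) \<in> A" if "l \<in> generate G S" for l
    using that
  proof (induction rule: generate.induct)
    case one then show ?case by simp
  next
    case (incl s)
    show ?case using step[OF _ incl] incl unfolding A_def by force
  next
    case (inv s)
    show ?case
    proof (intro ballI impI)
      fix g assume g: "g \<in> carrier G" "proj (act g p) \<in> A"
      have sc: "s \<in> carrier G" using inv gen_closed by auto
      have "g \<otimes> inv s \<otimes> s = g" using g sc by (simp add: m_assoc)
      then show "proj (act (g \<otimes> inv s) p) \<in> A"
        using step[of "g \<otimes> inv s" s] g sc inv unfolding A_def by auto
    qed
  next
    case (eng h1 h2)
    have "h1 \<in> carrier G" "h2 \<in> carrier G" using eng gen by auto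
    then show ?case using eng by (simp flip: m_assoc)
  qed
  then have inA: "proj (act l p) \<in> A" if "l \<in> carrier G" for l
    using that gen act_one[OF base_in] by (metis A_def insertI1 l_one one_closed)
  have "vertices \<inter> seg u w \<subseteq> A"
  proof
    fix x assume x: "x \<in> vertices \<inter> seg u w"
    then obtain g h k where ghk: "g \<in> carrier G" "h \<in> carrier G" "k \<in> carrier G"
       "x \<in> seg (act g p) (act h p)" "x \<in> seg (act h p) (act k p)" "x \<in> seg (act g p) (act k p)"
      unfolding vertices_def by blast
    have two: "x \<in> seg t (act a p) \<or> x \<in> seg t (act b p)"
      if "x \<in> seg (act a p) (act b p)" "a \<in> carrier G" "b \<in> carrier G" "t \<in> M" for a b t
      using seg_split[OF that(1) cl[OF that(2)] that(4) cl[OF that(3)]]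
        seg_commute[OF that(4) cl[OF that(2)]] by blast
    have "\<exists>l\<in>carrier G. x \<in> seg u (act l p) \<and> x \<in> seg w (act l p)"
      using two[OF ghk(4) ghk(1,2) u] two[OF ghk(5) ghk(2,3) u] two[OF ghk(6) ghk(1,3) u]
        two[OF ghk(4) ghk(1,2) w] two[OF ghk(5) ghk(2,3) w] two[OF ghk(6) ghk(1,3) w] ghk(1-3)
      by blast
    then show "x \<in> A" using proj_eq x cl inA by (metis IntD2)
  qed
  moreover have "finite A" unfolding A_def using finF gen_finite by auto
  ultimately show ?thesis by (rule finite_subset)
qed

definition adj :: "'x \<Rightarrow> 'x \<Rightarrow> bool" where
  "adj x y \<longleftrightarrow> x \<in> vertices \<and> y \<in> vertices \<and> x \<noteq> y \<and> seg x y \<inter> vertices = {x, y}"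

lemma adj_sym: "adj x y \<Longrightarrow> adj y x"
  unfolding adj_def using seg_commute vertices_in by (metis insert_commute)

lemma act_adj: assumes "g \<in> carrier G" "adj x y" shows "adj (act g x) (act g y)"
proof -
  have v: "x \<in> vertices" "y \<in> vertices" "x \<noteq> y" "seg x y \<inter> vertices = {x, y}"
    using assms by (auto simp: adj_def)
  have M: "x \<in> M" "y \<in> M" using v vertices_in by auto
  have "z \<in> {act g x, act g y}" if z: "z \<in> seg (act g x) (act g y)" "z \<in> vertices" for z
  proof -
    have zX: "z \<in> M" using z seg_in by auto
    have "act (inv g) z \<in> seg x y"
      using act_seg[of "inv g" "act g x" "act g y" z] z M assms(1) act_closed by auto
    moreover have "act (inv g) z \<in> vertices" using act_vertices assms z by auto
    ultimately have "act (inv g) z \<in> {x, y}" using v by blast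
    then show ?thesis using act_inv(2)[OF assms(1) zX] by auto
  qed
  then show ?thesis
    unfolding adj_def using v act_vertices[OF assms(1)] act_cancel[OF assms(1) M] seg_ends[of "act g x" "act g y"]
      act_closed[OF assms(1)] M by auto
qed

text \<open>Induction along edges, possible since only finitely many vertices lie between \<open>p\<close> and \<open>x\<close>.\<close>
lemma vertices_induct [consumes 1, case_names base step]:
  assumes "x \<in> vertices" and "P p" and step: "\<And>y x. \<lbrakk>adj y x; P y\<rbrakk> \<Longrightarrow> P x"
  shows "P x"
  using assms(1)
proof (induction "card (vertices \<inter> seg p x)" arbitrary: x rule: less_induct)
  case less
  have xX: "x \<in> M" using less vertices_in by auto
  note fin = finite_vertices_seg[OF base_in xX]
  show ?case
  proof (cases "x = p")
    case True then show ?thesis using assms by simp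
  next
    case False
    define B where "B = vertices \<inter> seg p x - {x}"
    have "finite B" "p \<in> B" using fin False base_in_vertices seg_ends base_in xX unfolding B_def by auto
    then have "Min ((\<lambda>z. d z x) ` B) \<in> (\<lambda>z. d z x) ` B" by (intro Min_in) auto
    then obtain y where "y \<in> B" "d y x = Min ((\<lambda>z. d z x) ` B)" by auto
    with \<open>finite B\<close> have y: "y \<in> B" "\<And>z. z \<in> B \<Longrightarrow> d y x \<le> d z x" by auto
    have yv: "y \<in> vertices" "y \<in> seg p x" "y \<noteq> x" using y unfolding B_def by auto
    have yX: "y \<in> M" using yv vertices_in by auto
    have "z \<in> {y, x}" if z: "z \<in> seg y x" "z \<in> vertices" for z
    proof (cases "z = x")
      case False
      have zX: "z \<in> M" using z vertices_in by auto
      have "z \<in> seg x y" "y \<in> seg x p" using z yv seg_commute xX yX base_in by auto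
      then have "z \<in> seg p x" using seg_order(1)[of y x p z] seg_commute xX base_in by auto
      then have "d y x \<le> d z x" using y(2)[of z] z False unfolding B_def by auto
      then have "d y z = 0" using z(1) dist_nonneg[OF yX zX] unfolding seg_def by auto
      then show ?thesis using dist_eq_0[OF yX zX] by auto
    qed auto
    then have a: "adj y x" unfolding adj_def using yv less.prems seg_ends yX xX by auto
    have sub: "seg p y \<subseteq> seg p x" using seg_order(1)[OF yv(2) _ base_in xX] by auto
    have "x \<notin> seg p y" using seg_antisym[OF _ yv(2) base_in] yv by auto
    then have "vertices \<inter> seg p y \<subset> vertices \<inter> seg p x"
      using sub less.prems seg_ends(2)[OF base_in xX] by auto
    then have "P y" using less.hyps yv psubset_card_mono fin by auto
    then show ?thesis using step a by blast
  qed
qed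

text \<open>Connected sets of vertices through \<open>p\<close> that are embedded in the quotient by the group.\<close>
definition transversals :: "'x set set" where
  "transversals = {Y. Y \<subseteq> vertices \<and> p \<in> Y \<and> (\<forall>x\<in>Y. \<forall>y\<in>Y. seg x y \<inter> vertices \<subseteq> Y) \<and>
     (\<forall>x\<in>Y. \<forall>g\<in>carrier G. act g x \<in> Y \<longrightarrow> g = \<one>)}"

lemma maximal_transversal:
  obtains Y where "Y \<in> transversals" "\<And>Z. \<lbrakk>Z \<in> transversals; Y \<subseteq> Z\<rbrakk> \<Longrightarrow> Z = Y"
proof -
  have "{p} \<in> transversals"
    unfolding transversals_def using base_in_vertices seg_self[OF base_in] act_free base_in by auto
  moreover have "\<Union>C \<in> transversals" if "C \<noteq> {}" "subset.chain transversals C" for C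
  proof -
    have sub: "C \<subseteq> transversals" and tot: "\<And>A B. A \<in> C \<Longrightarrow> B \<in> C \<Longrightarrow> A \<subseteq> B \<or> B \<subseteq> A"
      using that(2) by (auto simp: subset_chain_def)
    have common: "\<exists>A\<in>C. x \<in> A \<and> y \<in> A" if "x \<in> \<Union>C" "y \<in> \<Union>C" for x y
      using that tot by blast
    have mem: "A \<in> transversals" if "A \<in> C" for A using sub that by blast
    have "seg x y \<inter> vertices \<subseteq> \<Union>C" if "x \<in> \<Union>C" "y \<in> \<Union>C" for x y
      using common[OF that] mem unfolding transversals_def by blast
    moreover have "g = \<one>" if "x \<in> \<Union>C" "act g x \<in> \<Union>C" "g \<in> carrier G" for x g
      using common[OF that(1,2)] mem that(3) unfolding transversals_def by blast
    moreover have "\<Union>C \<subseteq> vertices" "p \<in> \<Union>C" using sub that(1) unfolding transversals_def by auto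
    ultimately show ?thesis unfolding transversals_def by blast
  qed
  ultimately obtain Y where "Y \<in> transversals" "\<forall>Z\<in>transversals. Y \<subseteq> Z \<longrightarrow> Z = Y"
    using subset_Zorn_nonempty[of transversals] by blast
  then show thesis using that by blast
qed

text \<open>The median of \<open>z\<close>, \<open>y\<close>, \<open>u\<close> is a vertex on the edge from \<open>y\<close> to \<open>u\<close>, hence \<open>y\<close> or \<open>u\<close>, and it lies in the
  convex set \<open>Y\<close>.\<close>
lemma transversal_exit:
  assumes Y: "Y \<in> transversals" and a: "adj y u" and y: "y \<in> Y" and u: "u \<notin> Y" and z: "z \<in> Y"
  shows "y \<in> seg z u"
proof -
  have v: "y \<in> vertices" "u \<in> vertices" "z \<in> vertices" using a Y z unfolding adj_def transversals_def by auto
  have M: "y \<in> M" "u \<in> M" "z \<in> M" using v vertices_in by auto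
  obtain c where c: "c \<in> seg z y" "c \<in> seg y u" "c \<in> seg z u" using median_exists M by metis
  have "c \<in> vertices" using vertices_median[OF v(3,1,2)] c by auto
  then have "c = y \<or> c = u" using a c unfolding adj_def by blast
  moreover have "c \<in> Y" using Y z y c \<open>c \<in> vertices\<close> unfolding transversals_def by blast
  ultimately show ?thesis using c u by auto
qed

lemma transversal_unique:
  assumes Y: "Y \<in> transversals" and "g \<in> carrier G" "h \<in> carrier G" "x \<in> act g ` Y" "x \<in> act h ` Y"
  shows "g = h"
proof -
  obtain y z where yz: "y \<in> Y" "z \<in> Y" "x = act g y" "x = act h z" using assms by auto
  have M: "y \<in> M" "z \<in> M" using yz Y vertices_in unfolding transversals_def by auto
  have "act (inv h \<otimes> g) y = z" using act_mult yz assms M by (metis act_inv(1) inv_closed)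
  then have "inv h \<otimes> g = \<one>" using Y yz assms unfolding transversals_def by blast
  then show ?thesis using assms by (metis inv_closed inv_equality inv_inv)
qed

text \<open>If a vertex \<open>u\<close> next to \<open>Y\<close> were in no translate of \<open>Y\<close>, then \<open>Y\<close> together with \<open>u\<close> would be a larger transversal.\<close>
lemma maximal_transversal_covers:
  assumes Y: "Y \<in> transversals" and max: "\<And>Z. \<lbrakk>Z \<in> transversals; Y \<subseteq> Z\<rbrakk> \<Longrightarrow> Z = Y"
    and x: "x \<in> vertices"
  shows "\<exists>g\<in>carrier G. x \<in> act g ` Y"
  using x
proof (induction rule: vertices_induct)
  case base
  have "p \<in> Y" using Y unfolding transversals_def by auto
  then have "p \<in> act \<one> ` Y" using act_one[OF base_in] by (metis imageI)
  then show ?case by blast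
next
  case (step y x)
  then obtain g y0 where g: "g \<in> carrier G" "y0 \<in> Y" "y = act g y0" by auto
  have Yv: "Y \<subseteq> vertices" using Y unfolding transversals_def by auto
  have M: "x \<in> M" "y \<in> M" "y0 \<in> M" "x \<in> vertices" using step g Yv vertices_in unfolding adj_def by auto
  define u where "u = act (inv g) x"
  have xu: "x = act g u" unfolding u_def using g M by simp
  have a: "adj y0 u" using act_adj[of "inv g" y x] step g M unfolding u_def by simp
  have uX: "u \<in> M" "u \<in> vertices" using a vertices_in unfolding adj_def by auto
  have y0v: "y0 \<in> vertices" using g Yv by auto
  show ?case
  proof (rule ccontr)
    assume n: "\<not> ?case"
    have nu: "act h u \<notin> Y" if h: "h \<in> carrier G" for h
    proof
      assume "act h u \<in> Y"
      moreover have "x = act (g \<otimes> inv h) (act h u)"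
        using h g uX xu by (simp add: act_mult act_closed)
      ultimately show False using n g h by (metis imageI inv_closed m_closed)
    qed
    have uY: "u \<notin> Y" using nu[of \<one>] act_one uX by auto
    have s: "seg z u \<inter> vertices \<subseteq> insert u Y" if z: "z \<in> Y" for z
    proof
      fix t assume t: "t \<in> seg z u \<inter> vertices"
      have zX: "z \<in> M" using z Yv vertices_in by auto
      have "t \<in> seg z y0 \<or> t \<in> seg y0 u" using seg_split t zX M uX by blast
      moreover have "seg z y0 \<inter> vertices \<subseteq> Y" using Y z g unfolding transversals_def by blast
      moreover have "seg y0 u \<inter> vertices \<subseteq> {y0, u}" using a unfolding adj_def by auto
      ultimately show "t \<in> insert u Y" using t g by blast
    qed
    have "insert u Y \<in> transversals"
    proof -
      have "seg z z' \<inter> vertices \<subseteq> insert u Y" if zz: "z \<in> insert u Y" "z' \<in> insert u Y" for z z'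
      proof -
        consider "z = u" "z' = u" | "z = u" "z' \<in> Y" | "z \<in> Y" "z' = u" | "z \<in> Y" "z' \<in> Y"
          using zz by blast
        then show ?thesis
        proof cases
          case 1 then show ?thesis using seg_self[OF uX(1)] by auto
        next
          case 2
          then have "seg z z' = seg z' u" using seg_commute Yv vertices_in uX by blast
          then show ?thesis using s 2 by simp
        next
          case 3 then show ?thesis using s by simp
        next
          case 4 then show ?thesis using Y unfolding transversals_def by blast
        qed
      qed
      moreover have "h = \<one>" if zh: "z \<in> insert u Y" "act h z \<in> insert u Y" "h \<in> carrier G" for z h
      proof -
        have zX: "z \<in> M" using zh uX Yv vertices_in by auto
        consider "z = u" "act h z = u" | "z = u" "act h z \<in> Y" | "z \<in> Y" "act h z = u" | "z \<in> Y" "act h z \<in> Y"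
          using zh by blast
        then show ?thesis
        proof cases
          case 1 then show ?thesis using act_free zh uX by auto
        next
          case 2 then show ?thesis using nu zh by auto
        next
          case 3
          then have "act (inv h) u = z" using act_inv(1)[OF zh(3) zX] by simp
          then show ?thesis using nu[of "inv h"] zh 3 by auto
        next
          case 4 then show ?thesis using Y zh unfolding transversals_def by blast
        qed
      qed
      moreover have "insert u Y \<subseteq> vertices" "p \<in> insert u Y" using Yv uX Y unfolding transversals_def by auto
      ultimately show ?thesis unfolding transversals_def by blast
    qed
    then show False using max[of "insert u Y"] uY by blast
  qed
qed

text \<open>The pair is an edge that leads from \<open>Y\<close> into its translate by \<open>g\<close>.\<close>
definition crossing :: "'x set \<Rightarrow> 'g \<Rightarrow> 'x \<times> 'x \<Rightarrow> bool" where
  "crossing Y g e \<longleftrightarrow> fst e \<in> Y \<and> snd e \<in> act g ` Y \<and> adj (fst e) (snd e)"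

definition neighbours :: "'x set \<Rightarrow> 'g set" where
  "neighbours Y = {g \<in> carrier G. g \<noteq> \<one> \<and> (\<exists>e. crossing Y g e)}"

lemma crossing_inv:
  assumes "Y \<in> transversals" "g \<in> carrier G" "crossing Y g (y, u)"
  shows "crossing Y (inv g) (act (inv g) u, act (inv g) y)"
proof -
  obtain z where z: "z \<in> Y" "u = act g z" using assms(3) unfolding crossing_def by auto
  have "z \<in> M" using z assms(1) vertices_in unfolding transversals_def by auto
  then have "act (inv g) u \<in> Y" using z assms(2) by simp
  moreover have "adj (act (inv g) u) (act (inv g) y)"
    using act_adj[of "inv g" u y] adj_sym assms unfolding crossing_def by auto
  ultimately show ?thesis using assms(3) unfolding crossing_def by auto
qed

lemma inv_neighbours:
  assumes "Y \<in> transversals" "g \<in> neighbours Y" shows "inv g \<in> neighbours Y"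
  using assms crossing_inv inv_eq_1_iff unfolding neighbours_def by fastforce

text \<open>Both ends of the crossing edge are exits: every path from \<open>Y\<close> to \<open>u\<close> passes through \<open>y\<close>, and every
  path from the translate of \<open>Y\<close> to \<open>y\<close> passes through \<open>u\<close>.\<close>
lemma crossing_exit:
  assumes Y: "Y \<in> transversals" and g: "g \<in> carrier G" "g \<noteq> \<one>" and e: "crossing Y g (y, u)"
  shows "y \<in> M" "u \<in> M" "u \<notin> Y" "z \<in> Y \<Longrightarrow> y \<in> seg z u" "z \<in> Y \<Longrightarrow> u \<in> seg (act g z) y"
proof -
  have a: "y \<in> Y" "u \<in> act g ` Y" "adj y u" using e unfolding crossing_def by auto
  show yu: "y \<in> M" "u \<in> M" using a vertices_in unfolding adj_def by auto
  have Yv: "t \<in> M" if "t \<in> Y" for t using that Y vertices_in unfolding transversals_def by auto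
  have ni: "h = \<one>" if "t \<in> Y" "t \<in> act h ` Y" "h \<in> carrier G" for t h
  proof -
    have "t \<in> act \<one> ` Y" using that act_one Yv by (metis imageI)
    then show ?thesis using transversal_unique[OF Y _ that(3), of \<one>] that by auto
  qed
  show u: "u \<notin> Y" using ni a g by auto
  show "y \<in> seg z u" if "z \<in> Y" using transversal_exit[OF Y a(3) a(1) u that] .
  show "u \<in> seg (act g z) y" if z: "z \<in> Y"
  proof -
    have e': "crossing Y (inv g) (act (inv g) u, act (inv g) y)" by (rule crossing_inv[OF Y g(1) e])
    then have b: "act (inv g) u \<in> Y" "adj (act (inv g) u) (act (inv g) y)"
       "act (inv g) y \<in> act (inv g) ` Y" unfolding crossing_def by auto
    have "act (inv g) y \<notin> Y" using ni[OF _ b(3)] g inv_eq_1_iff by auto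
    then have "act (inv g) u \<in> seg z (act (inv g) y)" using transversal_exit[OF Y b(2,1)] z by auto
    then have "act g (act (inv g) u) \<in> seg (act g z) (act g (act (inv g) y))"
      using act_seg[OF g(1) Yv[OF z] act_closed[OF inv_closed[OF g(1)] yu(1)]] by simp
    then show ?thesis using g yu by simp
  qed
qed

text \<open>Two crossing edges between the same two connected sets would form a circuit.\<close>
lemma crossing_unique:
  assumes Y: "Y \<in> transversals" and g: "g \<in> carrier G" "g \<noteq> \<one>"
    and e: "crossing Y g (y, u)" and e': "crossing Y g (y', u')"
  shows "y = y' \<and> u = u'"
proof -
  note ex = crossing_exit[OF Y g e] and ex' = crossing_exit[OF Y g e']
  have y: "y \<in> Y" "y' \<in> Y" and a: "adj y u" "adj y' u'" using e e' unfolding crossing_def by auto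
  obtain w where w: "w \<in> Y" "u' = act g w" using e' unfolding crossing_def by auto
  have 1: "y \<in> seg y' u" using ex(4)[OF y(2)] .
  have 2: "u \<in> seg y u'" using ex(5)[OF w(1)] w(2) seg_commute ex(1) ex'(2) by auto
  have yu: "y \<noteq> u" using y ex(3) by auto
  have "y \<in> seg y' u'" using seg_concat[OF 1 2 yu] ex ex' by auto
  then have "y = y'" using a ex'(3) y unfolding adj_def by auto
  moreover have "u \<in> seg y' u'" using 2 calculation by simp
  then have "u = u'" using a yu calculation unfolding adj_def by auto
  ultimately show ?thesis by simp
qed

text \<open>Along a path from \<open>p\<close> to \<open>gp\<close> the translate of \<open>Y\<close> changes by a neighbour at each edge or not at all.\<close>
lemma neighbours_generate:
  assumes Y: "Y \<in> transversals" and max: "\<And>Z. \<lbrakk>Z \<in> transversals; Y \<subseteq> Z\<rbrakk> \<Longrightarrow> Z = Y"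
  shows "generate G (neighbours Y) = carrier G"
proof
  have "neighbours Y \<subseteq> carrier G" unfolding neighbours_def by auto
  then show "generate G (neighbours Y) \<subseteq> carrier G" by (rule generate_incl)
  have pY: "p \<in> Y" and Yv: "Y \<subseteq> vertices" using Y unfolding transversals_def by auto
  have "\<forall>g\<in>carrier G. x \<in> act g ` Y \<longrightarrow> g \<in> generate G (neighbours Y)" if "x \<in> vertices" for x
    using that
  proof (induction rule: vertices_induct)
    case base
    have "p \<in> act \<one> ` Y" using pY act_one[OF base_in] by (metis imageI)
    then show ?case using transversal_unique[OF Y _ one_closed] generate.one by metis
  next
    case (step y x)
    show ?case
    proof (intro ballI impI)
      fix g assume g: "g \<in> carrier G" "x \<in> act g ` Y"
      have yv: "y \<in> vertices" using step unfolding adj_def by auto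
      obtain h where h: "h \<in> carrier G" "y \<in> act h ` Y"
        using maximal_transversal_covers[OF Y max yv] by blast
      have hg: "h \<in> generate G (neighbours Y)" using step h by auto
      define k where "k = inv h \<otimes> g"
      obtain y0 x0 where 0: "y0 \<in> Y" "y = act h y0" "x0 \<in> Y" "x = act g x0" using h g by auto
      have X0: "y0 \<in> M" "x0 \<in> M" using 0 Yv vertices_in by auto
      have "adj (act (inv h) y) (act (inv h) x)" using act_adj step h by auto
      moreover have "act (inv h) x = act k x0" using 0 g h X0 unfolding k_def by (simp add: act_mult)
      moreover have "act (inv h) y = y0" using 0 h X0 by simp
      ultimately have "crossing Y k (y0, act k x0)" unfolding crossing_def using 0 by auto
      then have "k = \<one> \<or> k \<in> neighbours Y" unfolding neighbours_def k_def using g h by auto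
      then have "k \<in> generate G (neighbours Y)" using generate.one generate.incl by metis
      then have "h \<otimes> k \<in> generate G (neighbours Y)" using generate.eng hg by metis
      moreover have "h \<otimes> k = g" unfolding k_def using g h by (simp flip: m_assoc)
      ultimately show "g \<in> generate G (neighbours Y)" by simp
    qed
  qed
  then show "carrier G \<subseteq> generate G (neighbours Y)" using orbit_in_vertices pY by blast
qed

definition cut :: "'x set \<Rightarrow> 'g \<Rightarrow> 'x" where
  "cut Y g = (let e = SOME e. crossing Y g e in mid (fst e) (snd e))"

lemma cut_eq:
  assumes "Y \<in> transversals" "g \<in> carrier G" "g \<noteq> \<one>" "crossing Y g (y, u)"
  shows "cut Y g = mid y u"
proof -
  have "crossing Y g (SOME e. crossing Y g e)" using assms(4) by (rule someI)
  then have "(SOME e. crossing Y g e) = (y, u)"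
    using crossing_unique[OF assms] by (metis prod.collapse)
  then show ?thesis unfolding cut_def by simp
qed

text \<open>The inverse element moves the crossing edge of \<open>g\<close> to that of \<open>g\<^sup>-\<^sup>1\<close> with its ends exchanged, so midpoints are
  the right choice of cutting points.\<close>
lemma cut_inv:
  assumes Y: "Y \<in> transversals" and "g \<in> neighbours Y"
  shows "cut Y (inv g) = act (inv g) (cut Y g)"
proof -
  obtain y u where e: "g \<in> carrier G" "g \<noteq> \<one>" "crossing Y g (y, u)"
    using assms unfolding neighbours_def by auto
  note X = crossing_exit(1,2)[OF Y e]
  have "cut Y (inv g) = mid (act (inv g) u) (act (inv g) y)"
    by (rule cut_eq[OF Y _ _ crossing_inv[OF Y e(1,3)]]) (use e inv_eq_1_iff in auto)
  also have "\<dots> = act (inv g) (mid u y)" using act_mid e X by simp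
  also have "mid u y = cut Y g" using mid_commute X cut_eq[OF Y e] by simp
  finally show ?thesis .
qed

lemma mid_not_vertex:
  assumes "adj y u" shows "mid y u \<in> seg y u" "mid y u \<notin> vertices" "mid y u \<noteq> y"
proof -
  have X: "y \<in> M" "u \<in> M" "y \<noteq> u" using assms vertices_in unfolding adj_def by auto
  show "mid y u \<in> seg y u" "mid y u \<noteq> y" using mid_props mid_neq X by auto
  then show "mid y u \<notin> vertices" using assms mid_neq[OF X] unfolding adj_def by blast
qed

lemma cut_between:
  assumes Y: "Y \<in> transversals" and "g \<in> neighbours Y"
  shows "cut Y g \<in> seg p (act g p)"
proof -
  obtain y u where e: "g \<in> carrier G" "g \<noteq> \<one>" "crossing Y g (y, u)"
    using assms unfolding neighbours_def by auto
  note ex = crossing_exit[OF Y e]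
  have gp: "act g p \<in> M" using act_closed e base_in by auto
  have pY: "p \<in> Y" and yY: "y \<in> Y" and a: "adj y u"
    using Y e(3) unfolding transversals_def crossing_def by auto
  have m: "mid y u \<in> seg y u" using mid_not_vertex a by auto
  have 1: "y \<in> seg p u" "u \<in> seg y (act g p)"
    using ex(4)[OF pY] ex(5)[OF pY] seg_commute[OF ex(1) gp] by auto
  have "y \<noteq> u" using ex(3) yY by auto
  then have "y \<in> seg p (act g p)" using seg_concat[OF 1] base_in ex gp by auto
  moreover have "mid y u \<in> seg y (act g p)" using seg_order(1)[OF 1(2) m] ex gp by auto
  ultimately have "mid y u \<in> seg (act g p) p"
    using seg_order(1)[of y "act g p" p "mid y u"] seg_commute ex gp base_in by auto
  then show ?thesis using cut_eq[OF Y e] seg_commute gp base_in by auto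
qed

text \<open>The cutting points lie on distinct edges that leave \<open>Y\<close>. If \<open>m\<close>, in the interior of the edge from \<open>y\<close> to \<open>u\<close>, were
  between \<open>p\<close> and a point of the edge from \<open>y'\<close> to \<open>u'\<close>, then \<open>m\<close> would be between \<open>p\<close> and the median
  of \<open>p\<close>, \<open>u\<close>, \<open>u'\<close>; but this median lies in \<open>Y\<close>, on the near side of \<open>y\<close>.\<close>
lemma cut_unnested:
  assumes Y: "Y \<in> transversals" and g: "g \<in> neighbours Y" and h: "h \<in> neighbours Y" and "g \<noteq> h"
  shows "cut Y g \<notin> seg p (cut Y h)"
proof
  obtain y u where e: "g \<in> carrier G" "g \<noteq> \<one>" "crossing Y g (y, u)"
    using g unfolding neighbours_def by auto
  obtain y' u' where e': "h \<in> carrier G" "h \<noteq> \<one>" "crossing Y h (y', u')"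
    using h unfolding neighbours_def by auto
  note ex = crossing_exit[OF Y e] and ex' = crossing_exit[OF Y e']
  have pY: "p \<in> Y" and yY: "y \<in> Y" "y' \<in> Y" and a: "adj y u" "adj y' u'"
    and conv: "\<And>s t. s \<in> Y \<Longrightarrow> t \<in> Y \<Longrightarrow> seg s t \<inter> vertices \<subseteq> Y"
    using Y e(3) e'(3) unfolding transversals_def crossing_def by auto
  have V: "y \<in> vertices" "u \<in> vertices" "y' \<in> vertices" "u' \<in> vertices" using a unfolding adj_def by auto
  define m where "m = mid y u"
  have m: "m \<in> seg y u" "m \<notin> vertices" "m \<noteq> y" using mid_not_vertex[OF a(1)] unfolding m_def by auto
  have mM: "m \<in> M" using m seg_in by auto
  have m': "mid y' u' \<in> seg y' u'" using mid_not_vertex[OF a(2)] by auto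
  assume "cut Y g \<in> seg p (cut Y h)"
  then have mm': "m \<in> seg p (mid y' u')" using cut_eq[OF Y e] cut_eq[OF Y e'] m_def by simp
  have yseg: "y \<in> seg p u" and y'seg: "y' \<in> seg p u'" using ex(4)[OF pY] ex'(4)[OF pY] .
  have outer: "t \<in> seg p v" if "t \<in> seg x v" "x \<in> seg p v" "x \<in> M" "v \<in> M" for t x v
    using seg_order(1)[of x v p t] that base_in seg_commute by auto
  have "mid y' u' \<in> seg p u'" using outer[OF m' y'seg] ex' by auto
  then have mu': "m \<in> seg p u'" using seg_order(1)[OF _ mm'] base_in ex' by auto
  have mu: "m \<in> seg p u" using outer[OF m(1) yseg] ex by auto
  obtain c where c: "c \<in> seg p u" "c \<in> seg u u'" "c \<in> seg p u'"
    using median_exists[OF base_in ex(2) ex'(2)] by blast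
  have cv: "c \<in> vertices" using vertices_median[OF base_in_vertices V(2,4)] c by auto
  have cM: "c \<in> M" using cv vertices_in by auto
  have ends: "seg y u \<inter> vertices \<subseteq> {y, u}" "seg y' u' \<inter> vertices \<subseteq> {y', u'}"
    using a unfolding adj_def by auto
  have 1: "c \<in> seg p y \<or> c = u"
    using seg_split[OF c(1) base_in ex(1) ex(2)] ends(1) cv seg_ends(2)[OF base_in ex(1)] by blast
  have 2: "c \<in> seg p y' \<or> c = u'"
    using seg_split[OF c(3) base_in ex'(1) ex'(2)] ends(2) cv seg_ends(2)[OF base_in ex'(1)] by blast
  have "u \<noteq> u'"
  proof
    assume "u = u'"
    then have "g = h" using transversal_unique[OF Y e(1) e'(1)] e(3) e'(3) unfolding crossing_def by auto
    then show False using \<open>g \<noteq> h\<close> by simp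
  qed
  then have cy: "c \<in> seg p y" using 1 2 conv[OF pY yY(2)] cv ex(3) ex'(3) by blast
  have mc: "m \<in> seg p c"
  proof (rule ccontr)
    assume n: "m \<notin> seg p c"
    then have "m \<in> seg c u" "m \<in> seg c u'"
      using seg_split[OF mu base_in cM ex(2)] seg_split[OF mu' base_in cM ex'(2)] by auto
    then have "d c m + d m u = d c u" "d c m + d m u' = d c u'" "d u c + d c u' = d u u'"
      using c(2) unfolding seg_def by auto
    moreover have "d u u' \<le> d u m + d m u'" "d u m = d m u" "d u c = d c u"
      using dist_triangle[OF ex(2) mM ex'(2)] dist_sym[OF ex(2) mM] dist_sym[OF ex(2) cM] by auto
    ultimately have "d c m \<le> 0" by simp
    then have "c = m" using dist_nonneg[OF cM mM] dist_eq_0[OF cM mM] by auto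
    then show False using m cv by simp
  qed
  have "m \<in> seg p y" using seg_order(1)[OF cy mc base_in ex(1)] .
  then have "y \<in> seg m u" using seg_order(2)[OF yseg _ base_in ex(2)] by simp
  then have "y \<in> seg u m" "m \<in> seg u y" using m seg_commute ex mM by auto
  then have "y = m" using seg_antisym ex by blast
  then show False using m by simp
qed

lemma generate_finite_support:
  assumes "x \<in> generate G A"
  shows "\<exists>B\<subseteq>A. finite B \<and> x \<in> generate G B"
  using assms
proof (induction rule: generate.induct)
  case one show ?case using generate.one by blast
next
  case (incl h) then show ?case by (intro exI[of _ "{h}"]) (auto intro: generate.incl)
next
  case (inv h) then show ?case by (intro exI[of _ "{h}"]) (auto intro: generate.inv)
next
  case (eng h k)
  then obtain B C where "B \<subseteq> A" "finite B" "h \<in> generate G B" "C \<subseteq> A" "finite C" "k \<in> generate G C" by blast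
  then show ?case using mono_generate[of B "B \<union> C"] mono_generate[of C "B \<union> C"]
    by (intro exI[of _ "B \<union> C"]) (auto intro!: generate.eng)
qed

lemma generate_finite_subset:
  assumes "generate G A = carrier G"
  obtains B where "B \<subseteq> A" "finite B" "generate G B = carrier G"
proof -
  have "\<forall>s\<in>S. \<exists>B\<subseteq>A. finite B \<and> s \<in> generate G B"
    using assms gen_closed generate_finite_support by blast
  then obtain F where F: "\<And>s. s \<in> S \<Longrightarrow> F s \<subseteq> A \<and> finite (F s) \<and> s \<in> generate G (F s)" by metis
  define B where "B = (\<Union>s\<in>S. F s)"
  have AG: "A \<subseteq> carrier G" using assms generate.incl[of _ A G] by blast
  have B: "B \<subseteq> A" "finite B" using F gen_finite unfolding B_def by auto
  have BG: "B \<subseteq> carrier G" using B AG by auto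
  have "S \<subseteq> generate G B" using F mono_generate unfolding B_def by blast
  then have "generate G S \<subseteq> generate G B"
    using generate_subgroup_incl generate_is_subgroup[OF BG] by blast
  then have "generate G B = carrier G" using gen generate_incl[OF BG] by auto
  then show thesis using that B by blast
qed

text \<open>One element is chosen from each pair \<open>a\<close>, \<open>a\<^sup>-\<^sup>1\<close>.\<close>
lemma half_of_symmetric:
  assumes "finite A" "A \<subseteq> carrier G" "\<And>a. a \<in> A \<Longrightarrow> inv a \<noteq> a"
  shows "\<exists>B\<subseteq>A. (\<forall>a\<in>B. inv a \<notin> B) \<and> A \<subseteq> B \<union> m_inv G ` B"
  using assms
proof (induction rule: finite_induct)
  case empty then show ?case by auto
next
  case (insert a A)
  then obtain B where B: "B \<subseteq> A" "\<forall>a\<in>B. inv a \<notin> B" "A \<subseteq> B \<union> m_inv G ` B" by auto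
  have a: "a \<in> carrier G" "inv a \<noteq> a" using insert by auto
  have BG: "B \<subseteq> carrier G" using B insert by auto
  show ?case
  proof (cases "inv a \<in> B")
    case True
    then have "a \<in> m_inv G ` B" using a by (metis imageI inv_inv)
    then show ?thesis using B by (intro exI[of _ B]) auto
  next
    case False
    have "inv b \<noteq> a" if "b \<in> B" for b using that False BG by (metis inv_inv subsetD)
    then show ?thesis using B False a by (intro exI[of _ "insert a B"]) auto
  qed
qed

text \<open>A cutting point \<open>m g\<close> is attached to every generator and every inverse of a generator. None of them
  is between \<open>p\<close> and another, so the parts of the tree beyond the cutting points are disjoint. A
  neighbour is not its own inverse, as it would fix its cutting point.\<close>
theorem separating_generators:
  obtains B m where "finite B" "B \<subseteq> carrier G" "generate G B = carrier G"
    "\<And>g. g \<in> B \<Longrightarrow> inv g \<notin> B"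
    "\<And>g. g \<in> B \<union> m_inv G ` B \<Longrightarrow> m g \<in> seg p (act g p)"
    "\<And>g. g \<in> B \<union> m_inv G ` B \<Longrightarrow> m (inv g) = act (inv g) (m g)"
    "\<And>g h. \<lbrakk>g \<in> B \<union> m_inv G ` B; h \<in> B \<union> m_inv G ` B; g \<noteq> h\<rbrakk> \<Longrightarrow> m g \<notin> seg p (m h)"
proof -
  obtain Y where Y: "Y \<in> transversals" and max: "\<And>Z. \<lbrakk>Z \<in> transversals; Y \<subseteq> Z\<rbrakk> \<Longrightarrow> Z = Y"
    using maximal_transversal by blast
  obtain A where A: "A \<subseteq> neighbours Y" "finite A" "generate G A = carrier G"
    using generate_finite_subset[OF neighbours_generate[OF Y max]] by blast
  have N: "neighbours Y \<subseteq> carrier G" unfolding neighbours_def by auto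
  have ninv: "inv g \<noteq> g" if g: "g \<in> neighbours Y" for g
  proof
    assume eq: "inv g = g"
    have "act g (cut Y g) = cut Y g" using cut_inv[OF Y g] unfolding eq by simp
    moreover have "cut Y g \<in> M" using cut_between[OF Y g] seg_in by blast
    ultimately have "g = \<one>" using act_free g N by blast
    then show False using g unfolding neighbours_def by simp
  qed
  obtain B where B: "B \<subseteq> A" "\<forall>a\<in>B. inv a \<notin> B" "A \<subseteq> B \<union> m_inv G ` B"
    using half_of_symmetric[of A] A N ninv by blast
  have BG: "B \<subseteq> carrier G" using B A N by auto
  have "A \<subseteq> generate G B" using B generate.incl[of _ B G] generate.inv[of _ B G] by blast
  then have "generate G A \<subseteq> generate G B"
    using generate_subgroup_incl generate_is_subgroup[OF BG] by blast
  then have gB: "generate G B = carrier G" using A generate_incl[OF BG] by auto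
  have L: "g \<in> neighbours Y" if "g \<in> B \<union> m_inv G ` B" for g
    using that B A inv_neighbours[OF Y] by blast
  show thesis
  proof (rule that[of B "cut Y"])
    show "finite B" using B A finite_subset by blast
    show "B \<subseteq> carrier G" "generate G B = carrier G" by fact+
    show "inv g \<notin> B" if "g \<in> B" for g using B that by blast
    show "cut Y g \<in> seg p (act g p)" if "g \<in> B \<union> m_inv G ` B" for g
      by (rule cut_between[OF Y L[OF that]])
    show "cut Y (inv g) = act (inv g) (cut Y g)" if "g \<in> B \<union> m_inv G ` B" for g
      by (rule cut_inv[OF Y L[OF that]])
    show "cut Y g \<notin> seg p (cut Y h)"
      if "g \<in> B \<union> m_inv G ` B" "h \<in> B \<union> m_inv G ` B" "g \<noteq> h" for g h
      by (rule cut_unnested[OF Y L[OF that(1)] L[OF that(2)] that(3)])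
  qed
qed

end

section \<open>Homogeneous substitution in polynomials\<close>

text \<open>The polynomial \<open>B\<^sup>n P(A/B)\<close>, that is, the form of degree \<open>n\<close> obtained by homogenising \<open>P\<close>, evaluated at
  \<open>(A, B)\<close>. Keeping the degree \<open>n\<close> explicit makes substitution multiplicative and compatible with
  composition, also where \<open>P\<close> has lower degree.\<close>
definition hom_subst :: "nat \<Rightarrow> 'a::field poly \<Rightarrow> 'a poly \<Rightarrow> 'a poly \<Rightarrow> 'a poly" where
  "hom_subst n P A B = (\<Sum>i\<le>n. smult (coeff P i) (A ^ i * B ^ (n - i)))"

lemma hom_subst_add: "hom_subst n (P + Q) A B = hom_subst n P A B + hom_subst n Q A B"
  by (simp add: hom_subst_def smult_add_left sum.distrib)

lemma hom_subst_smult: "hom_subst n (smult c P) A B = smult c (hom_subst n P A B)"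
  by (simp add: hom_subst_def smult_sum_poly)

lemma hom_subst_0 [simp]: "hom_subst n 0 A B = 0"
  by (simp add: hom_subst_def)

lemma hom_subst_sum: "hom_subst n (\<Sum>i\<in>I. f i) A B = (\<Sum>i\<in>I. hom_subst n (f i) A B)"
  by (induction I rule: infinite_finite_induct) (simp_all add: hom_subst_add)

lemma hom_subst_pCons: "hom_subst (Suc n) (pCons a P) A B = smult a (B ^ Suc n) + A * hom_subst n P A B"
  unfolding hom_subst_def by (subst sum.atMost_Suc_shift) (simp add: sum_distrib_left mult_ac)

lemma hom_subst_const: "hom_subst n [:a:] A B = smult a (B ^ n)"
  by (cases n) (simp_all add: hom_subst_pCons, simp add: hom_subst_def)

lemma hom_subst_linear: "hom_subst 1 [:b, a:] A B = smult a A + smult b B"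
  unfolding One_nat_def by (simp add: hom_subst_pCons hom_subst_const)

lemma hom_subst_mult:
  assumes "degree P \<le> m" "degree Q \<le> n"
  shows "hom_subst (m + n) (P * Q) A B = hom_subst m P A B * hom_subst n Q A B"
  using assms(1)
proof (induction m arbitrary: P)
  case 0
  then obtain a where "P = [:a:]" using degree_eq_zeroE by auto
  then show ?case by (simp add: hom_subst_smult hom_subst_const)
next
  case (Suc m)
  obtain a R where P: "P = pCons a R" by (cases P)
  have R: "degree R \<le> m" using Suc.prems unfolding P by (auto simp: degree_pCons_eq_if split: if_splits)
  have hQ: "hom_subst (Suc (m + n)) Q A B = B ^ Suc m * hom_subst n Q A B"
  proof -
    have "hom_subst (Suc m + n) Q A B = (\<Sum>i\<le>n. smult (coeff Q i) (A ^ i * B ^ (Suc m + n - i)))"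
      unfolding hom_subst_def using assms(2) by (intro sum.mono_neutral_right) (auto simp: coeff_eq_0)
    also have "\<dots> = (\<Sum>i\<le>n. B ^ Suc m * smult (coeff Q i) (A ^ i * B ^ (n - i)))"
    proof (rule sum.cong[OF refl])
      fix i assume "i \<in> {..n}"
      then have "Suc m + n - i = Suc m + (n - i)" by simp
      then have "B ^ (Suc m + n - i) = B ^ Suc m * B ^ (n - i)" by (simp only: power_add)
      then show "smult (coeff Q i) (A ^ i * B ^ (Suc m + n - i)) = B ^ Suc m * smult (coeff Q i) (A ^ i * B ^ (n - i))"
        by (simp add: mult_ac)
    qed
    finally show ?thesis by (simp add: hom_subst_def sum_distrib_left)
  qed
  have "hom_subst (Suc m + n) (P * Q) A B = smult a (hom_subst (Suc (m + n)) Q A B) + A * hom_subst (m + n) (R * Q) A B"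
    using hom_subst_pCons[of "m + n" 0 "R * Q" A B] unfolding P by (simp add: hom_subst_add hom_subst_smult mult_pCons_left)
  also have "\<dots> = (smult a (B ^ Suc m) + A * hom_subst m R A B) * hom_subst n Q A B"
    unfolding hQ Suc.IH[OF R] by (simp add: algebra_simps)
  finally show ?case unfolding P hom_subst_pCons .
qed

lemma hom_subst_one: "hom_subst n 1 A B = B ^ n"
  using hom_subst_const[of n 1 A B] by (simp add: one_pCons)

lemma degree_linear_power:
  fixes P :: "'a::field poly"
  assumes "degree P \<le> 1"
  shows "degree (P ^ n) \<le> n"
  using order_trans[OF degree_power_le[of P n] mult_le_mono1[OF assms, of n]] by simp

lemma hom_subst_power:
  assumes "degree P \<le> 1"
  shows "hom_subst n (P ^ n) A B = hom_subst 1 P A B ^ n"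
proof (induction n)
  case 0 show ?case by (simp add: hom_subst_one)
next
  case (Suc n)
  have "degree (P ^ n) \<le> n" by (rule degree_linear_power[OF assms])
  then show ?case using hom_subst_mult[OF assms, of "P ^ n" n A B] Suc by simp
qed

lemma hom_subst_raise:
  assumes "degree P \<le> m" "m \<le> n"
  shows "hom_subst n P A B = B ^ (n - m) * hom_subst m P A B"
  using hom_subst_mult[OF assms(1), of 1 "n - m" A B] assms(2) by (simp add: hom_subst_one mult.commute)

lemma degree_hom_subst:
  assumes "degree A \<le> 1" "degree B \<le> 1"
  shows "degree (hom_subst n P A B) \<le> n"
  unfolding hom_subst_def
proof (rule degree_sum_le)
  fix i assume i: "i \<in> {..n}"
  have "degree (A ^ i * B ^ (n - i)) \<le> degree (A ^ i) + degree (B ^ (n - i))" by (rule degree_mult_le)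
  also have "\<dots> \<le> degree A * i + degree B * (n - i)" using degree_power_le add_mono by blast
  also have "\<dots> \<le> 1 * i + 1 * (n - i)" using assms by (intro add_mono mult_right_mono) auto
  finally show "degree (smult (coeff P i) (A ^ i * B ^ (n - i))) \<le> n" using i degree_smult_le order_trans by fastforce
qed simp

lemma hom_subst_hom_subst:
  assumes "degree A \<le> 1" "degree B \<le> 1"
  shows "hom_subst n (hom_subst n P A B) A' B' = hom_subst n P (hom_subst 1 A A' B') (hom_subst 1 B A' B')"
proof -
  have "hom_subst n (A ^ i * B ^ (n - i)) A' B' = hom_subst 1 A A' B' ^ i * hom_subst 1 B A' B' ^ (n - i)" if "i \<le> n" for i
  proof -
    have "degree (A ^ i) \<le> i" "degree (B ^ (n - i)) \<le> n - i"
      using degree_linear_power assms by blast+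
    from hom_subst_mult[OF this, of A' B'] show ?thesis using that hom_subst_power[OF assms(1)] hom_subst_power[OF assms(2)] by simp
  qed
  then show ?thesis
    unfolding hom_subst_def[of n P] by (simp add: hom_subst_sum hom_subst_smult)
qed

lemma coeff_mult_top:
  fixes P Q :: "'a::field poly"
  assumes "degree P \<le> m" "degree Q \<le> n"
  shows "coeff (P * Q) (m + n) = coeff P m * coeff Q n"
proof -
  have "coeff (P * Q) (m + n) = (\<Sum>i\<le>m + n. coeff P i * coeff Q (m + n - i))" by (rule coeff_mult)
  also have "\<dots> = (\<Sum>i\<in>{m}. coeff P i * coeff Q (m + n - i))"
  proof (rule sum.mono_neutral_right)
    show "\<forall>i\<in>{..m + n} - {m}. coeff P i * coeff Q (m + n - i) = 0"
    proof
      fix i assume "i \<in> {..m + n} - {m}"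
      then have "i > m \<or> m + n - i > n" by auto
      then show "coeff P i * coeff Q (m + n - i) = 0" using assms by (auto simp: coeff_eq_0)
    qed
  qed auto
  finally show ?thesis by simp
qed

lemma coeff_power_top:
  fixes P :: "'a::field poly"
  assumes "degree P \<le> 1"
  shows "coeff (P ^ n) n = coeff P 1 ^ n"
proof (induction n)
  case (Suc n)
  have "degree (P ^ n) \<le> n" by (rule degree_linear_power[OF assms])
  then show ?case using coeff_mult_top[OF assms, of "P ^ n" n] Suc by simp
qed simp

lemma coeff_hom_subst_top:
  assumes "degree A \<le> 1" "degree B \<le> 1"
  shows "coeff (hom_subst n P A B) n = (\<Sum>i\<le>n. coeff P i * (coeff A 1 ^ i * coeff B 1 ^ (n - i)))"
proof -
  have "coeff (A ^ i * B ^ (n - i)) n = coeff A 1 ^ i * coeff B 1 ^ (n - i)" if "i \<le> n" for i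
  proof -
    have "degree (A ^ i) \<le> i" "degree (B ^ (n - i)) \<le> n - i"
      using degree_linear_power assms by blast+
    from coeff_mult_top[OF this] show ?thesis using that coeff_power_top[OF assms(1)] coeff_power_top[OF assms(2)] by simp
  qed
  then show ?thesis unfolding hom_subst_def by (simp add: coeff_sum)
qed

section \<open>Seminorms and the action of matrices on the projective line\<close>

text \<open>The linear factor loses in the limit against the geometric growth of \<open>(y/M)\<^sup>n\<close>.\<close>
lemma le_of_pow_le_linear:
  fixes y M :: real
  assumes "0 \<le> M" "\<And>n::nat. y ^ n \<le> (real n + 1) * M ^ n"
  shows "y \<le> M"
proof (rule ccontr)
  assume "\<not> y \<le> M"
  then have yM: "M < y" by simp
  then have y0: "0 < y" using assms(1) by linarith
  define q where "q = M / y"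
  have q: "0 \<le> q" "q < 1" using yM y0 assms(1) by (auto simp: q_def)
  have "(\<lambda>n. real n * q ^ n) \<longlonglongrightarrow> 0"
    using powser_times_n_limit_0[of q] q by (simp add: mult.commute)
  moreover have "(\<lambda>n. q ^ n) \<longlonglongrightarrow> 0" using q by (intro LIMSEQ_realpow_zero)
  ultimately have "(\<lambda>n. real n * q ^ n + q ^ n) \<longlonglongrightarrow> 0 + 0" by (rule tendsto_add)
  then have "\<forall>\<^sub>F n in sequentially. real n * q ^ n + q ^ n < 1"
    by (intro order_tendstoD) auto
  then obtain n :: nat where n: "real n * q ^ n + q ^ n < 1" by (meson eventually_sequentially order.refl)
  have "y ^ n \<le> (real n + 1) * M ^ n" using assms(2)[of n] by simp
  then have "1 \<le> (real n + 1) * q ^ n" using y0 by (simp add: q_def power_divide field_simps)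
  then show False using n by (simp add: algebra_simps)
qed

context nonarch_abs
begin

lemma abs_0 [simp]: "v 0 = 0" by (simp add: eq_0_iff)
lemma abs_1 [simp]: "v 1 = 1" using mult[of 1 1] eq_0_iff[of 1] by simp
lemma abs_pos: "a \<noteq> 0 \<Longrightarrow> 0 < v a" using nonneg[of a] eq_0_iff[of a] by linarith
lemma abs_minus_1: "v (- 1) = 1"
proof -
  have "v (- 1) * v (- 1) = 1" using mult[of "-1" "-1"] by simp
  then show ?thesis using nonneg[of "-1"] by (metis abs_of_nonneg real_sqrt_abs2 real_sqrt_one)
qed
lemma abs_minus [simp]: "v (- a) = v a" using mult[of "-1" a] abs_minus_1 by simp
lemma abs_diff: "v (a - b) \<le> max (v a) (v b)" using ultrametric[of a "- b"] by simp
lemma abs_minus_commute: "v (a - b) = v (b - a)" using abs_minus[of "a - b"] by simp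
lemma abs_inverse: "a \<noteq> 0 \<Longrightarrow> v (inverse a) = inverse (v a)"
  using mult[of a "inverse a"] abs_pos[of a] by (simp add: field_simps)
lemma abs_divide: "v (a / b) = v a / v b"
  by (cases "b = 0") (simp_all add: divide_inverse mult abs_inverse)
lemma abs_power: "v (a ^ n) = v a ^ n" by (induction n) (simp_all add: mult)
lemma abs_of_nat: "v (of_nat n) \<le> 1"
  by (induction n) (auto intro: order_trans[OF ultrametric])
lemma abs_sum_le:
  assumes "finite I" "0 \<le> C" "\<And>i. i \<in> I \<Longrightarrow> v (f i) \<le> C"
  shows "v (sum f I) \<le> C"
  using assms by (induction I rule: finite_induct) (auto intro: order_trans[OF ultrametric])
lemma abs_sum_less:
  assumes "finite I" "0 < C" "\<And>i. i \<in> I \<Longrightarrow> v (f i) < C"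
  shows "v (sum f I) < C"
  using assms by (induction I rule: finite_induct) (auto intro: le_less_trans[OF ultrametric])
lemma abs_add_eq: "v b < v a \<Longrightarrow> v (a + b) = v a"
  using ultrametric[of a b] ultrametric[of "a + b" "- b"] by (auto simp: max_def split: if_splits)

lemma berk_A1D:
  assumes "x \<in> berk_A1 v"
  shows "0 \<le> x P" "x (P + Q) \<le> x P + x Q" "x (P * Q) = x P * x Q" "x [:a:] = v a"
  using assms unfolding berk_A1_def by blast+

lemma seminorm_simps:
  assumes "x \<in> berk_A1 v"
  shows "x 0 = 0" "x 1 = 1" "x (smult a P) = v a * x P" "x (P ^ n) = x P ^ n" "x (- P) = x P"
proof -
  note x = berk_A1D[OF assms]
  show "x 0 = 0" "x 1 = 1" using x(4)[of 0] x(4)[of 1] by (simp_all add: one_pCons)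
  show s: "x (smult a P) = v a * x P" for a P using x(3)[of "[:a:]" P] x(4)[of a] by simp
  show "x (P ^ n) = x P ^ n" using \<open>x 1 = 1\<close> by (induction n) (simp_all add: x(3))
  show "x (- P) = x P" using s[of "-1" P] by simp
qed

text \<open>The binomial coefficients have absolute value at most one, so the binomial theorem bounds the
  power \<open>|P + Q|\<^sup>n\<close> by \<open>(n + 1) max(|P|, |Q|)\<^sup>n\<close>.\<close>
lemma seminorm_ultrametric:
  assumes x: "x \<in> berk_A1 v"
  shows "x (P + Q) \<le> max (x P) (x Q)"
proof (rule le_of_pow_le_linear)
  note xs = berk_A1D[OF x] seminorm_simps[OF x]
  let ?M = "max (x P) (x Q)"
  show M0: "0 \<le> ?M" using xs(1)[of P] by simp
  have sum_le: "x (sum f I) \<le> (\<Sum>i\<in>I. x (f i))" for f :: "nat \<Rightarrow> 'a poly" and I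
  proof (induction I rule: infinite_finite_induct)
    case (insert i I)
    then show ?case using xs(2)[of "f i" "sum f I"] by simp
  qed (use xs(5) in auto)
  have nat: "x (of_nat k * R) \<le> x R" for k R
  proof -
    have "of_nat k * R = smult (of_nat k) R" by (simp add: of_nat_poly)
    then show ?thesis using xs(7) abs_of_nat[of k] xs(1)[of R] by (simp add: mult_left_le_one_le nonneg)
  qed
  fix n :: nat
  have "x (P + Q) ^ n = x ((P + Q) ^ n)" using xs(8) by simp
  also have "\<dots> = x (\<Sum>k\<le>n. of_nat (n choose k) * P ^ k * Q ^ (n - k))" by (simp add: binomial_ring)
  also have "\<dots> \<le> (\<Sum>k\<le>n. x (of_nat (n choose k) * P ^ k * Q ^ (n - k)))" by (rule sum_le)
  also have "\<dots> \<le> (\<Sum>k\<le>n. ?M ^ n)"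
  proof (rule sum_mono)
    fix k assume k: "k \<in> {..n}"
    have "x (of_nat (n choose k) * P ^ k * Q ^ (n - k)) \<le> x P ^ k * x Q ^ (n - k)"
      using nat[of "n choose k" "P ^ k * Q ^ (n - k)"] by (simp add: mult.assoc xs)
    also have "\<dots> \<le> ?M ^ k * ?M ^ (n - k)"
      using xs(1) M0 by (intro mult_mono power_mono) auto
    also have "\<dots> = ?M ^ n" using k by (simp flip: power_add)
    finally show "x (of_nat (n choose k) * P ^ k * Q ^ (n - k)) \<le> ?M ^ n" .
  qed
  finally show "x (P + Q) ^ n \<le> (real n + 1) * ?M ^ n" by (simp add: algebra_simps)
qed

lemma seminorm_sum_le:
  assumes x: "x \<in> berk_A1 v" and "finite I" "0 \<le> C" "\<And>i. i \<in> I \<Longrightarrow> x (f i) \<le> C"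
  shows "x (sum f I) \<le> C"
  using assms(2-) by (induction I rule: finite_induct)
    (auto simp: seminorm_simps[OF x] intro: order_trans[OF seminorm_ultrametric[OF x]])

lemma seminorm_add_null:
  assumes x: "x \<in> berk_A1 v" and "x Q = 0" shows "x (P + Q) = x P"
proof -
  have "x (P + Q) \<le> x P" using berk_A1D(2)[OF x, of P Q] assms by simp
  moreover have "x P \<le> x (P + Q)"
    using berk_A1D(2)[OF x, of "P + Q" "- Q"] seminorm_simps(5)[OF x] assms by simp
  ultimately show ?thesis by simp
qed

lemma frac_point_eq:
  assumes x: "x \<in> berk_A1 v" and B: "x B \<noteq> 0" and "degree P \<le> n"
  shows "frac_point x A B P = x (hom_subst n P A B) / x B ^ n"
proof -
  have "x (hom_subst n P A B) = x B ^ (n - degree P) * x (hom_subst (degree P) P A B)"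
    using hom_subst_raise[of P "degree P" n A B] assms(3) berk_A1D(3)[OF x] seminorm_simps(4)[OF x] by simp
  moreover have "x B ^ n = x B ^ (n - degree P) * x B ^ degree P"
    using assms(3) by (simp flip: power_add)
  ultimately show ?thesis using B by (simp add: frac_point_def hom_subst_def)
qed

lemma frac_point_in:
  assumes x: "x \<in> berk_A1 v" and B: "x B \<noteq> 0"
  shows "frac_point x A B \<in> berk_A1 v"
proof -
  note xs = berk_A1D[OF x] seminorm_simps[OF x]
  have B0: "0 < x B" using B xs(1)[of B] by simp
  show ?thesis
    unfolding berk_A1_def
  proof (intro CollectI conjI allI)
    fix P Q :: "'a poly" and a :: 'a
    show "0 \<le> frac_point x A B P" using xs(1) by (simp add: frac_point_def)
    let ?n = "max (degree P) (degree Q)"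
    have "degree (P + Q) \<le> ?n" by (rule degree_add_le) auto
    then have "frac_point x A B (P + Q) = x (hom_subst ?n P A B + hom_subst ?n Q A B) / x B ^ ?n"
      using frac_point_eq[OF x B] hom_subst_add by metis
    also have "\<dots> \<le> (x (hom_subst ?n P A B) + x (hom_subst ?n Q A B)) / x B ^ ?n"
      using B0 xs(2) by (intro divide_right_mono) auto
    also have "\<dots> = frac_point x A B P + frac_point x A B Q"
      using frac_point_eq[OF x B, of P ?n] frac_point_eq[OF x B, of Q ?n] by (simp add: add_divide_distrib)
    finally show "frac_point x A B (P + Q) \<le> frac_point x A B P + frac_point x A B Q" .
    have "frac_point x A B (P * Q) = x (hom_subst (degree P + degree Q) (P * Q) A B) / x B ^ (degree P + degree Q)"
      by (rule frac_point_eq[OF x B degree_mult_le])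
    then show "frac_point x A B (P * Q) = frac_point x A B P * frac_point x A B Q"
      using frac_point_eq[OF x B, of P "degree P" A] frac_point_eq[OF x B, of Q "degree Q" A]
      by (simp add: hom_subst_mult xs power_add)
    show "frac_point x A B [:a:] = v a" by (simp add: frac_point_def xs)
  qed
qed

lemma eval_point_in: "(\<lambda>P. v (poly P a)) \<in> berk_A1 v"
  unfolding berk_A1_def using ultrametric nonneg
  by (auto simp: mult intro!: order_trans[OF ultrametric])

lemma berk_P1_eq: "berk_P1 v = Aff ` berk_A1 v \<union> {Infty}"
proof -
  have "chart_infty y \<in> Aff ` berk_A1 v \<union> {Infty}" if "y \<in> berk_A1 v" for y
    using frac_point_in[OF that, of "[:0, 1:]" 1] by (auto simp: chart_infty_def)
  moreover have "Infty = chart_infty (\<lambda>P. v (poly P 0))" by (simp add: chart_infty_def)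
  ultimately show ?thesis unfolding berk_P1_def using eval_point_in[of 0] by blast
qed

lemma Aff_in_P1 [simp]: "Aff x \<in> berk_P1 v \<longleftrightarrow> x \<in> berk_A1 v"
  by (auto simp: berk_P1_eq)
lemma Infty_in_P1 [simp]: "Infty \<in> berk_P1 v" by (simp add: berk_P1_eq)

end

text \<open>The absolute value at a point of the form of degree \<open>n\<close> with dehomogenisation \<open>P\<close>, in the chart where
  the second coordinate is \<open>1\<close>; at infinity, in the coordinates \<open>(1, 0)\<close>, only the coefficient of
  degree \<open>n\<close> remains. Up to the factor \<open>k\<^sup>n\<close> this is independent of the chosen coordinates,
  which spares case distinctions at infinity.\<close>
fun form_val :: "('a::field \<Rightarrow> real) \<Rightarrow> 'a berk_pt \<Rightarrow> nat \<Rightarrow> 'a poly \<Rightarrow> real" where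
  "form_val v (Aff x) n P = x P"
| "form_val v Infty n P = v (coeff P n)"

abbreviation mnum :: "'a::field ^ 2 ^ 2 \<Rightarrow> 'a poly" where "mnum M \<equiv> [:M $ 1 $ 2, M $ 1 $ 1:]"
abbreviation mden :: "'a::field ^ 2 ^ 2 \<Rightarrow> 'a poly" where "mden M \<equiv> [:M $ 2 $ 2, M $ 2 $ 1:]"

lemma degree_num_den: "degree [:a, b:] \<le> 1"
  by (simp add: degree_pCons_eq_if)

lemma invertible_2: "invertible (M :: 'a::field ^ 2 ^ 2) \<longleftrightarrow> M $ 1 $ 1 * M $ 2 $ 2 \<noteq> M $ 1 $ 2 * M $ 2 $ 1"
  by (simp add: invertible_det_nz det_2)

context nonarch_abs
begin

lemma num_den_nonzero:
  assumes x: "x \<in> berk_A1 v" and M: "invertible M" and B: "x (mden M) = 0"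
  shows "x (mnum M) \<noteq> 0"
proof
  assume A: "x (mnum M) = 0"
  note xs = seminorm_simps[OF x]
  let ?D = "M $ 1 $ 1 * M $ 2 $ 2 - M $ 1 $ 2 * M $ 2 $ 1"
  have "x (smult (- M $ 2 $ 1) (mnum M)) = 0" by (simp only: xs A)
  then have "x (smult (M $ 1 $ 1) (mden M) + smult (- M $ 2 $ 1) (mnum M)) = 0"
    by (simp only: seminorm_add_null[OF x] xs B)
  moreover have "smult (M $ 1 $ 1) (mden M) + smult (- M $ 2 $ 1) (mnum M) = [:?D:]" by (simp add: algebra_simps)
  ultimately have "x [:?D:] = 0" by (simp only:)
  then have "v ?D = 0" using berk_A1D(4)[OF x, of ?D] by (simp only:)
  then show False using M by (simp add: eq_0_iff invertible_2)
qed

text \<open>A matrix acts on forms by linear substitution. The constant \<open>k\<close> compares the coordinates of the image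
  point with the normalised ones; it depends on the point but not on the degree.\<close>
lemma moebius_form_val:
  assumes z: "z \<in> berk_P1 v" and M: "invertible M"
  shows "moebius v M z \<in> berk_P1 v"
    and "\<exists>k>0. \<forall>n P. degree P \<le> n \<longrightarrow>
      k ^ n * form_val v (moebius v M z) n P = form_val v z n (hom_subst n P (mnum M) (mden M))"
proof -
  have "moebius v M z \<in> berk_P1 v \<and> (\<exists>k>0. \<forall>n P. degree P \<le> n \<longrightarrow>
      k ^ n * form_val v (moebius v M z) n P = form_val v z n (hom_subst n P (mnum M) (mden M)))"
  proof (cases z)
    case (Aff x)
    then have x: "x \<in> berk_A1 v" using z by simp
    note xs = berk_A1D[OF x] seminorm_simps[OF x]
    show ?thesis
    proof (cases "x (mden M) = 0")
      case False
      then have "0 < x (mden M)" using xs(1)[of "mden M"] by simp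
      moreover have "moebius v M z = Aff (frac_point x (mnum M) (mden M))"
        using False by (simp add: Aff Let_def)
      ultimately show ?thesis
        using frac_point_in[OF x False] frac_point_eq[OF x False] by (auto simp: Aff intro!: exI[of _ "x (mden M)"])
    next
      case True
      then have I: "moebius v M z = Infty" by (simp add: Aff Let_def)
      have k: "0 < x (mnum M)" using num_den_nonzero[OF x M True] xs(1)[of "mnum M"] by simp
      have "x (mnum M) ^ n * v (coeff P n) = x (hom_subst n P (mnum M) (mden M))" for n P
      proof (cases n)
        case (Suc m)
        let ?f = "\<lambda>i. smult (coeff P i) (mnum M ^ i * mden M ^ (n - i))"
        have "x (sum ?f {..m}) \<le> 0"
        proof (rule seminorm_sum_le[OF x])
          fix i assume "i \<in> {..m}"
          then have "x (mden M) ^ (n - i) = 0" using True Suc by simp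
          moreover have "x (?f i) = v (coeff P i) * (x (mnum M) ^ i * x (mden M) ^ (n - i))" by (simp only: xs)
          ultimately show "x (?f i) \<le> 0" by (simp only: mult_zero_right)
        qed auto
        then have "x (sum ?f {..m}) = 0" using xs(1) by (simp add: order_antisym)
        moreover have "hom_subst n P (mnum M) (mden M) = ?f n + sum ?f {..m}"
          unfolding hom_subst_def Suc by (simp add: add.commute)
        ultimately have "x (hom_subst n P (mnum M) (mden M)) = x (?f n)" using seminorm_add_null[OF x] by simp
        then show ?thesis by (simp add: xs mult.commute)
      qed (simp add: hom_subst_def xs)
      then show ?thesis using I k by (auto simp: Aff)
    qed
  next
    case Infty
    have h: "v (coeff (hom_subst n P (mnum M) (mden M)) n)
        = v (\<Sum>i\<le>n. coeff P i * (M $ 1 $ 1 ^ i * M $ 2 $ 1 ^ (n - i)))" for n P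
      by (subst coeff_hom_subst_top[OF degree_num_den degree_num_den]) simp
    show ?thesis
    proof (cases "M $ 2 $ 1 = 0")
      case True
      then have "M $ 1 $ 1 \<noteq> 0" using M by (auto simp: invertible_2)
      moreover have "v (coeff (hom_subst n P (mnum M) (mden M)) n) = v (M $ 1 $ 1) ^ n * v (coeff P n)" for n P
      proof -
        have "(\<Sum>i\<le>n. coeff P i * (M $ 1 $ 1 ^ i * M $ 2 $ 1 ^ (n - i)))
            = (\<Sum>i\<in>{n}. coeff P i * (M $ 1 $ 1 ^ i * M $ 2 $ 1 ^ (n - i)))"
          using True by (intro sum.mono_neutral_right) auto
        then show ?thesis unfolding h by (simp add: mult abs_power mult.commute)
      qed
      ultimately show ?thesis using True abs_pos by (auto simp: Infty intro!: exI[of _ "v (M $ 1 $ 1)"])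
    next
      case False
      let ?a = "M $ 1 $ 1" and ?c = "M $ 2 $ 1"
      have "v ?c ^ n * v (poly P (?a / ?c)) = v (coeff (hom_subst n P (mnum M) (mden M)) n)"
        if "degree P \<le> n" for n P
      proof -
        have "poly P (?a / ?c) = (\<Sum>i\<le>n. coeff P i * (?a / ?c) ^ i)"
          unfolding poly_altdef using that by (intro sum.mono_neutral_left) (auto simp: coeff_eq_0)
        then have "?c ^ n * poly P (?a / ?c) = (\<Sum>i\<le>n. ?c ^ n * (coeff P i * (?a / ?c) ^ i))"
          by (simp add: sum_distrib_left)
        also have "\<dots> = (\<Sum>i\<le>n. coeff P i * (?a ^ i * ?c ^ (n - i)))"
        proof (rule sum.cong[OF refl])
          fix i assume "i \<in> {..n}"
          then have "?c ^ n = ?c ^ i * ?c ^ (n - i)" by (simp flip: power_add)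
          then show "?c ^ n * (coeff P i * (?a / ?c) ^ i) = coeff P i * (?a ^ i * ?c ^ (n - i))"
            using False by (simp add: power_divide)
        qed
        finally have "v (?c ^ n * poly P (?a / ?c)) = v (coeff (hom_subst n P (mnum M) (mden M)) n)"
          unfolding h by (rule arg_cong)
        then show ?thesis by (simp only: mult abs_power)
      qed
      then show ?thesis using False abs_pos eval_point_in
        by (auto simp: Infty intro!: exI[of _ "v ?c"])
    qed
  qed
  then show "moebius v M z \<in> berk_P1 v"
    and "\<exists>k>0. \<forall>n P. degree P \<le> n \<longrightarrow>
      k ^ n * form_val v (moebius v M z) n P = form_val v z n (hom_subst n P (mnum M) (mden M))" by auto
qed

text \<open>A point is determined by its values on forms, up to a change of homogeneous coordinates.\<close>
lemma berk_pt_eqI: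
  assumes "z \<in> berk_P1 v" "z' \<in> berk_P1 v" "0 < k"
    and eq: "\<And>n P. degree P \<le> n \<Longrightarrow> form_val v z n P = k ^ n * form_val v z' n P"
  shows "z = z'"
proof -
  have 1: "form_val v z 1 1 = k * form_val v z' 1 1" using eq[of 1 1] by simp
  have c: "coeff (1::'a poly) 1 = 0" by (simp add: coeff_eq_0)
  show ?thesis
  proof (cases z)
    case Infty
    then have "form_val v z' 1 1 = 0" using 1 c assms(3) by simp
    moreover have "y 1 = 1" if "z' = Aff y" for y
      using that assms(2) by (intro seminorm_simps(2)) simp
    ultimately show ?thesis using Infty by (cases z') auto
  next
    case (Aff x)
    then have x: "x \<in> berk_A1 v" using assms by simp
    have "form_val v z' 1 1 \<noteq> 0" using 1 Aff seminorm_simps(2)[OF x] by auto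
    then obtain y where y: "z' = Aff y" using c by (cases z') auto
    then have "y \<in> berk_A1 v" using assms by simp
    then have "k = 1" using 1 Aff y seminorm_simps(2)[OF x] seminorm_simps(2)[of y] by simp
    then have "x P = y P" for P using eq[of P "degree P"] Aff y by simp
    then show ?thesis using Aff y by auto
  qed
qed

lemma moebius_comp:
  assumes z: "z \<in> berk_P1 v" and M: "invertible M" and N: "invertible N"
  shows "moebius v M (moebius v N z) = moebius v (M ** N) z"
proof -
  have MN: "invertible (M ** N)" using M N by (rule invertible_mult)
  let ?w = "moebius v N z"
  have w: "?w \<in> berk_P1 v" using moebius_form_val(1)[OF z N] .
  obtain k where k: "k > 0" "\<And>n P. degree P \<le> n \<Longrightarrow>
      k ^ n * form_val v (moebius v M ?w) n P = form_val v ?w n (hom_subst n P (mnum M) (mden M))"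
    using moebius_form_val(2)[OF w M] by blast
  obtain l where l: "l > 0" "\<And>n P. degree P \<le> n \<Longrightarrow>
      l ^ n * form_val v ?w n P = form_val v z n (hom_subst n P (mnum N) (mden N))"
    using moebius_form_val(2)[OF z N] by blast
  obtain m where m: "m > 0" "\<And>n P. degree P \<le> n \<Longrightarrow>
      m ^ n * form_val v (moebius v (M ** N) z) n P = form_val v z n (hom_subst n P (mnum (M ** N)) (mden (M ** N)))"
    using moebius_form_val(2)[OF z MN] by blast
  have "hom_subst 1 (mnum M) (mnum N) (mden N) = mnum (M ** N)" "hom_subst 1 (mden M) (mnum N) (mden N) = mden (M ** N)"
    unfolding hom_subst_linear by (simp_all add: matrix_matrix_mult_def sum_2)
  then have hh: "hom_subst n (hom_subst n P (mnum M) (mden M)) (mnum N) (mden N) = hom_subst n P (mnum (M ** N)) (mden (M ** N))" for n P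
    using hom_subst_hom_subst[OF degree_num_den degree_num_den] by metis
  show ?thesis
  proof (rule berk_pt_eqI)
    show "moebius v M ?w \<in> berk_P1 v" "moebius v (M ** N) z \<in> berk_P1 v"
      using moebius_form_val(1) w M z MN by auto
    show "0 < m / (k * l)" using k l m by simp
    fix n P assume P: "degree (P :: 'a poly) \<le> n"
    have "l ^ n * (k ^ n * form_val v (moebius v M ?w) n P) = l ^ n * form_val v ?w n (hom_subst n P (mnum M) (mden M))"
      using k(2)[OF P] by simp
    also have "\<dots> = form_val v z n (hom_subst n P (mnum (M ** N)) (mden (M ** N)))"
      using l(2)[OF degree_hom_subst[OF degree_num_den degree_num_den]] hh by simp
    also have "\<dots> = m ^ n * form_val v (moebius v (M ** N) z) n P" using m(2)[OF P] by simp
    finally show "form_val v (moebius v M ?w) n P = (m / (k * l)) ^ n * form_val v (moebius v (M ** N) z) n P"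
      using k(1) l(1) by (simp add: power_divide power_mult_distrib field_simps)
  qed
qed

lemma moebius_one:
  assumes z: "z \<in> berk_P1 v" shows "moebius v (mat 1) z = z"
proof (cases z)
  case (Aff x)
  then have x: "x \<in> berk_A1 v" using z by simp
  note xs = seminorm_simps[OF x]
  have d: "mden (mat 1 :: 'a ^ 2 ^ 2) = 1" "mnum (mat 1 :: 'a ^ 2 ^ 2) = [:0, 1:]" by (simp_all add: mat_def one_pCons)
  have "(\<Sum>i\<le>degree P. smult (coeff P i) ([:0, 1:] ^ i)) = P" for P :: "'a poly"
    using poly_as_sum_of_monoms[of P] by (simp add: monom_altdef)
  then have "frac_point x [:0, 1:] 1 = x" by (intro ext) (simp add: frac_point_def xs)
  then show ?thesis unfolding Aff moebius.simps Let_def d using xs by simp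
qed (simp add: mat_def)

end

section \<open>Disc points and their distance\<close>

text \<open>The seminorm that a point induces on linear forms; the vector \<open>f\<close> stands for \<open>f\<^sub>1 T + f\<^sub>2\<close>. All discs and
  all distances are expressed by it.\<close>
definition lin :: "('a::field \<Rightarrow> real) \<Rightarrow> 'a berk_pt \<Rightarrow> 'a ^ 2 \<Rightarrow> real" where
  "lin v z f = form_val v z 1 [:f $ 2, f $ 1:]"

text \<open>The Gauss norm of radius \<open>r\<close> around \<open>0\<close>.\<close>
definition gauss :: "('a::field \<Rightarrow> real) \<Rightarrow> real \<Rightarrow> 'a poly \<Rightarrow> real" where
  "gauss v r Q = Max ((\<lambda>i. v (coeff Q i) * r ^ i) ` {..degree Q})"

definition eta :: "('a::field \<Rightarrow> real) \<Rightarrow> 'a \<Rightarrow> real \<Rightarrow> 'a poly \<Rightarrow> real" where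
  "eta v a r P = gauss v r (P \<circ>\<^sub>p [:a, 1:])"

definition disc_pt :: "('a::field \<Rightarrow> real) \<Rightarrow> 'a \<Rightarrow> real \<Rightarrow> 'a berk_pt" where
  "disc_pt v a r = Aff (eta v a r)"

definition disc_pts :: "('a::field \<Rightarrow> real) \<Rightarrow> 'a berk_pt set" where
  "disc_pts v = {disc_pt v a r | a r. 0 < r}"

text \<open>The radius of the smallest disc that contains the discs of centres \<open>a\<close>, \<open>b\<close> and radii \<open>r\<close>, \<open>s\<close>.\<close>
definition join_radius :: "('a::field \<Rightarrow> real) \<Rightarrow> 'a \<Rightarrow> real \<Rightarrow> 'a \<Rightarrow> real \<Rightarrow> real" where
  "join_radius v a r b s = max (max r s) (v (a - b))"

text \<open>The maximal ratio of the two norms on linear forms; a bound that is attained is unique.\<close>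
definition dilation :: "('a::field \<Rightarrow> real) \<Rightarrow> 'a berk_pt \<Rightarrow> 'a berk_pt \<Rightarrow> real" where
  "dilation v p q = (THE c. (\<forall>f. lin v p f \<le> c * lin v q f) \<and> (\<exists>f. 0 < lin v q f \<and> lin v p f = c * lin v q f))"

text \<open>The distance on the building of \<open>PGL\<^sub>2\<close>, up to normalisation. It does not change when the norms are scaled, which is why
  \<open>PGL\<^sub>2(k)\<close> acts by isometries.\<close>
definition hdist :: "('a::field \<Rightarrow> real) \<Rightarrow> 'a berk_pt \<Rightarrow> 'a berk_pt \<Rightarrow> real" where
  "hdist v p q = ln (dilation v p q * dilation v q p)"

lemma ultrametric_four_points:
  fixes xy zt xz yt xt yz :: real
  assumes "xy \<le> max xz yz" "xy \<le> max xt yt" "zt \<le> max xz xt" "zt \<le> max yz yt"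
    and pos: "0 < xy" "0 < zt" "0 < xz" "0 < yt" "0 < xt" "0 < yz"
  shows "xy * zt \<le> max (xz * yt) (xt * yz)"
proof -
  consider "xy \<le> xz \<and> zt \<le> yt" | "xy \<le> yt \<and> zt \<le> xz" | "xy \<le> xt \<and> zt \<le> yz" | "xy \<le> yz \<and> zt \<le> xt"
    using assms(1-4) unfolding le_max_iff_disj by linarith
  then show ?thesis
  proof cases
    case 1 then have "xy * zt \<le> xz * yt" using pos by (intro mult_mono) auto
    then show ?thesis by simp
  next
    case 2 then have "xy * zt \<le> yt * xz" using pos by (intro mult_mono) auto
    then show ?thesis by (simp add: mult.commute)
  next
    case 3 then have "xy * zt \<le> xt * yz" using pos by (intro mult_mono) auto
    then show ?thesis by simp
  next
    case 4 then have "xy * zt \<le> yz * xt" using pos by (intro mult_mono) auto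
    then show ?thesis by (simp add: mult.commute)
  qed
qed

context nonarch_abs
begin

lemma lin_Aff: "lin v (Aff x) f = x [:f $ 2, f $ 1:]"
  by (simp add: lin_def)
lemma lin_Infty: "lin v Infty f = v (f $ 1)"
  by (simp add: lin_def)

lemma lin_nonneg: "z \<in> berk_P1 v \<Longrightarrow> 0 \<le> lin v z f"
  by (cases z) (auto simp: lin_Aff lin_Infty nonneg berk_A1D(1))

lemma lin_add: assumes "z \<in> berk_P1 v" shows "lin v z (f + g) \<le> max (lin v z f) (lin v z g)"
proof (cases z)
  case (Aff x)
  then show ?thesis using assms seminorm_ultrametric[of x "[:f $ 2, f $ 1:]" "[:g $ 2, g $ 1:]"]
    by (simp add: lin_Aff)
qed (simp add: lin_Infty ultrametric)

lemma lin_scale: assumes "z \<in> berk_P1 v" shows "lin v z (c *s f) = v c * lin v z f"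
proof (cases z)
  case (Aff x)
  then show ?thesis using assms seminorm_simps(3)[of x c "[:f $ 2, f $ 1:]"]
    by (simp add: lin_Aff)
qed (simp add: lin_Infty mult)

lemma lin_moebius:
  assumes "z \<in> berk_P1 v" "invertible M"
  shows "\<exists>k>0. \<forall>f. k * lin v (moebius v M z) f = lin v z (f v* M)"
proof -
  have "hom_subst 1 [:f $ 2, f $ 1:] (mnum M) (mden M) = [:(f v* M) $ 2, (f v* M) $ 1:]" for f
    unfolding hom_subst_linear by (simp add: vector_matrix_mult_def sum_2 mult.commute)
  then show ?thesis
    using moebius_form_val(2)[OF assms] degree_num_den unfolding lin_def by (metis power_one_right)
qed

lemma gauss_ge: "0 \<le> r \<Longrightarrow> v (coeff Q i) * r ^ i \<le> gauss v r Q"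
proof (cases "i \<le> degree Q")
  case True then show ?thesis unfolding gauss_def by (intro Max_ge) auto
next
  case False
  assume "0 \<le> r"
  have "v (coeff Q 0) * r ^ 0 \<le> gauss v r Q"
    unfolding gauss_def by (rule Max_ge) (auto intro!: image_eqI[of _ _ 0])
  moreover have "coeff Q i = 0" using False by (simp add: coeff_eq_0)
  ultimately show ?thesis using nonneg[of "coeff Q 0"] by simp
qed

lemma gauss_attained: "\<exists>i. gauss v r Q = v (coeff Q i) * r ^ i"
proof -
  have "gauss v r Q \<in> (\<lambda>i. v (coeff Q i) * r ^ i) ` {..degree Q}"
    unfolding gauss_def by (intro Max_in) auto
  then show ?thesis by blast
qed

lemma gauss_nonneg: "0 \<le> r \<Longrightarrow> 0 \<le> gauss v r Q"
  using gauss_attained[of r Q] nonneg by auto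

lemma gauss_le: "(\<And>i. v (coeff Q i) * r ^ i \<le> C) \<Longrightarrow> gauss v r Q \<le> C"
  using gauss_attained[of r Q] by auto

lemma gauss_pos: "0 < r \<Longrightarrow> Q \<noteq> 0 \<Longrightarrow> 0 < gauss v r Q"
  using less_le_trans[OF mult_pos_pos[OF abs_pos[of "coeff Q (degree Q)"] zero_less_power] gauss_ge[of r Q "degree Q"]]
  by simp

lemma gauss_add: assumes "0 \<le> r" shows "gauss v r (P + Q) \<le> max (gauss v r P) (gauss v r Q)"
proof (rule gauss_le)
  fix i
  have "v (coeff (P + Q) i) * r ^ i \<le> max (v (coeff P i)) (v (coeff Q i)) * r ^ i"
    using assms ultrametric by (intro mult_right_mono) auto
  also have "\<dots> = max (v (coeff P i) * r ^ i) (v (coeff Q i) * r ^ i)"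
    using assms by (simp add: max_mult_distrib_right)
  also have "\<dots> \<le> max (gauss v r P) (gauss v r Q)" using gauss_ge[OF assms] by (intro max.mono)
  finally show "v (coeff (P + Q) i) * r ^ i \<le> max (gauss v r P) (gauss v r Q)" .
qed

lemma gauss_const: "gauss v r [:a:] = v a"
  by (simp add: gauss_def)

lemma gauss_pCons: assumes "0 \<le> r" shows "gauss v r (pCons c Q) = max (v c) (r * gauss v r Q)"
proof (rule order_antisym)
  show "gauss v r (pCons c Q) \<le> max (v c) (r * gauss v r Q)"
  proof (rule gauss_le)
    fix i show "v (coeff (pCons c Q) i) * r ^ i \<le> max (v c) (r * gauss v r Q)"
    proof (cases i)
      case (Suc j)
      have "r * (v (coeff Q j) * r ^ j) \<le> r * gauss v r Q" using gauss_ge assms by (intro mult_left_mono)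
      then show ?thesis using Suc by (simp add: mult_ac)
    qed simp
  qed
  obtain j where "gauss v r Q = v (coeff Q j) * r ^ j" using gauss_attained by blast
  then have "r * gauss v r Q \<le> gauss v r (pCons c Q)"
    using gauss_ge[OF assms, of "pCons c Q" "Suc j"] by (simp add: mult_ac)
  moreover have "v c \<le> gauss v r (pCons c Q)" using gauss_ge[OF assms, of "pCons c Q" 0] by simp
  ultimately show "max (v c) (r * gauss v r Q) \<le> gauss v r (pCons c Q)" by simp
qed

text \<open>Gauss's lemma: the product of the terms of least degree that attain the two norms dominates
  its coefficient of the product.\<close>
lemma gauss_mult: assumes r: "0 < r" shows "gauss v r (P * Q) = gauss v r P * gauss v r Q"
proof (cases "P = 0 \<or> Q = 0")
  case True then show ?thesis using gauss_const[of r 0] by auto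
next
  case False
  let ?p = "gauss v r P" and ?q = "gauss v r Q"
  have r0: "0 \<le> r" using r by simp
  have pos: "0 < ?p" "0 < ?q" using gauss_pos[OF r] False by auto
  have term_bound: "v (coeff P i * coeff Q (n - i)) * r ^ n = (v (coeff P i) * r ^ i) * (v (coeff Q (n - i)) * r ^ (n - i))"
    if "i \<le> n" for i n
  proof -
    have "r ^ n = r ^ i * r ^ (n - i)" using that by (simp flip: power_add)
    then show ?thesis by (simp add: mult)
  qed
  show ?thesis
  proof (rule order_antisym)
    show "gauss v r (P * Q) \<le> ?p * ?q"
    proof (rule gauss_le)
      fix n
      have "v (coeff (P * Q) n) \<le> ?p * ?q / r ^ n"
        unfolding coeff_mult
      proof (rule abs_sum_le)
        fix i assume "i \<in> {..n}"
        then have "v (coeff P i * coeff Q (n - i)) * r ^ n \<le> ?p * ?q"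
          using term_bound[of i n] gauss_ge[OF r0] pos r nonneg
          by (auto intro!: mult_mono)
        then show "v (coeff P i * coeff Q (n - i)) \<le> ?p * ?q / r ^ n" using r by (simp add: field_simps)
      qed (use pos r in auto)
      then show "v (coeff (P * Q) n) * r ^ n \<le> ?p * ?q" using r by (simp add: field_simps)
    qed
    \<comment> \<open>the least indices make every other product of terms of total degree \<open>i0 + j0\<close> strictly smaller\<close>
    define i0 where "i0 = (LEAST i. ?p = v (coeff P i) * r ^ i)"
    define j0 where "j0 = (LEAST j. ?q = v (coeff Q j) * r ^ j)"
    have i0: "?p = v (coeff P i0) * r ^ i0" unfolding i0_def using gauss_attained by (rule LeastI_ex)
    have j0: "?q = v (coeff Q j0) * r ^ j0" unfolding j0_def using gauss_attained by (rule LeastI_ex)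
    have lessP: "v (coeff P i) * r ^ i < ?p" if "i < i0" for i
      using not_less_Least[of i "\<lambda>i. ?p = v (coeff P i) * r ^ i"] that gauss_ge[OF r0, of P i] unfolding i0_def by force
    have lessQ: "v (coeff Q i) * r ^ i < ?q" if "i < j0" for i
      using not_less_Least[of i "\<lambda>i. ?q = v (coeff Q i) * r ^ i"] that gauss_ge[OF r0, of Q i] unfolding j0_def by force
    define n where "n = i0 + j0"
    have main: "v (coeff P i0 * coeff Q j0) = ?p * ?q / r ^ n"
      using term_bound[of i0 n] i0 j0 r unfolding n_def by (simp add: field_simps)
    have "v (\<Sum>i\<in>{..n} - {i0}. coeff P i * coeff Q (n - i)) < ?p * ?q / r ^ n"
    proof (rule abs_sum_less)
      fix i assume i: "i \<in> {..n} - {i0}"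
      then consider "i < i0" | "n - i < j0" unfolding n_def by fastforce
      then have "(v (coeff P i) * r ^ i) * (v (coeff Q (n - i)) * r ^ (n - i)) < ?p * ?q"
      proof cases
        case 1
        have "(v (coeff P i) * r ^ i) * (v (coeff Q (n - i)) * r ^ (n - i)) \<le> (v (coeff P i) * r ^ i) * ?q"
          using gauss_ge[OF r0, of Q "n - i"] r nonneg by (intro mult_left_mono) auto
        also have "\<dots> < ?p * ?q" using lessP[OF 1] pos by simp
        finally show ?thesis .
      next
        case 2
        have "(v (coeff P i) * r ^ i) * (v (coeff Q (n - i)) * r ^ (n - i)) \<le> ?p * (v (coeff Q (n - i)) * r ^ (n - i))"
          using gauss_ge[OF r0, of P i] r nonneg by (intro mult_right_mono) auto
        also have "\<dots> < ?p * ?q" using lessQ[OF 2] pos by simp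
        finally show ?thesis .
      qed
      then show "v (coeff P i * coeff Q (n - i)) < ?p * ?q / r ^ n"
        using term_bound[of i n] i r by (simp add: field_simps)
    qed (use pos r in auto)
    moreover have "coeff (P * Q) n = coeff P i0 * coeff Q j0 + (\<Sum>i\<in>{..n} - {i0}. coeff P i * coeff Q (n - i))"
      unfolding coeff_mult by (subst sum.remove[of _ i0]) (auto simp: n_def)
    ultimately have "v (coeff (P * Q) n) = ?p * ?q / r ^ n" using abs_add_eq main by metis
    then have "?p * ?q = v (coeff (P * Q) n) * r ^ n" using r by simp
    then show "?p * ?q \<le> gauss v r (P * Q)" using gauss_ge[OF r0] by simp
  qed
qed

lemma eta_in: assumes "0 < r" shows "eta v a r \<in> berk_A1 v"
proof -
  have "gauss v r (P + Q) \<le> gauss v r P + gauss v r Q" for P Q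
    using gauss_add[of r P Q] gauss_nonneg[of r P] gauss_nonneg[of r Q] assms by auto
  then show ?thesis
    unfolding berk_A1_def eta_def using assms
    by (auto simp: gauss_nonneg pcompose_add pcompose_mult gauss_mult gauss_const pcompose_pCons)
qed

lemma eta_linear: "0 \<le> r \<Longrightarrow> eta v a r [:b, c:] = max (v c * r) (v (c * a + b))"
proof -
  assume r: "0 \<le> r"
  have "[:b, c:] \<circ>\<^sub>p [:a, 1:] = pCons (c * a + b) [:c:]"
    by (simp add: pcompose_pCons algebra_simps)
  then show ?thesis unfolding eta_def using gauss_pCons[OF r, of "c * a + b" "[:c:]"]
    by (simp add: gauss_const max.commute mult.commute)
qed

text \<open>The disc point dominates every point of its closed disc, by expanding \<open>P\<close> in powers of \<open>T - a\<close>.\<close>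
lemma seminorm_le_eta:
  assumes x: "x \<in> berk_A1 v" and r: "0 \<le> r" and le: "x [:- a, 1:] \<le> r"
  shows "x P \<le> eta v a r P"
proof -
  note xs = berk_A1D[OF x] seminorm_simps[OF x]
  have "x (Q \<circ>\<^sub>p [:- a, 1:]) \<le> gauss v r Q" for Q
  proof (induction Q rule: pCons_induct)
    case 0 then show ?case using xs gauss_const[of r 0] by simp
  next
    case (pCons c Q)
    have "x (pCons c Q \<circ>\<^sub>p [:- a, 1:]) \<le> max (x [:c:]) (x ([:- a, 1:] * (Q \<circ>\<^sub>p [:- a, 1:])))"
      unfolding pcompose_pCons by (rule seminorm_ultrametric[OF x])
    also have "\<dots> \<le> max (v c) (r * gauss v r Q)"
      unfolding xs(3,4) using le pCons.IH r xs(1) by (intro max.mono mult_mono) auto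
    finally show ?case using gauss_pCons[OF r] by simp
  qed
  moreover have "(P \<circ>\<^sub>p [:a, 1:]) \<circ>\<^sub>p [:- a, 1:] = P"
    by (simp add: pcompose_assoc[symmetric] pcompose_pCons pcompose_idR)
  ultimately show ?thesis unfolding eta_def by metis
qed

lemma disc_pt_in: "0 < r \<Longrightarrow> disc_pt v a r \<in> berk_P1 v"
  by (simp add: disc_pt_def eta_in)

lemma disc_pts_in_P1: "disc_pts v \<subseteq> berk_P1 v"
  unfolding disc_pts_def using disc_pt_in by auto

lemma lin_disc_pt: "0 \<le> r \<Longrightarrow> lin v (disc_pt v a r) f = max (v (f $ 1) * r) (v (f $ 1 * a + f $ 2))"
  by (simp add: disc_pt_def lin_Aff eta_linear)

lemma lin_disc_pos:
  assumes "p \<in> disc_pts v" "f \<noteq> 0" shows "0 < lin v p f"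
proof -
  obtain a r where p: "p = disc_pt v a r" "0 < r" using assms unfolding disc_pts_def by auto
  show ?thesis
  proof (cases "f $ 1 = 0")
    case True
    then have "f $ 2 \<noteq> 0" using assms(2) by (auto simp: vec_eq_iff forall_2)
    then show ?thesis using p True abs_pos by (simp add: lin_disc_pt less_max_iff_disj)
  next
    case False
    then show ?thesis using p abs_pos by (simp add: lin_disc_pt less_max_iff_disj)
  qed
qed

text \<open>Among all points with the same values on linear forms, the disc point is the largest one. Hence disc points
  can be recognised without coordinates.\<close>
lemma disc_pt_dominates:
  assumes z: "z \<in> berk_P1 v" and r: "0 < r" and k: "0 < k"
    and eq: "\<And>f. lin v z f = k * lin v (disc_pt v a r) f"
  obtains x where "x \<in> berk_A1 v" "z = Aff x" "k = 1" "\<And>P. x P \<le> eta v a r P"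
proof (cases z)
  case Infty
  have "lin v z (vector [0, 1]) = 0" using Infty by (simp add: lin_Infty)
  then show thesis using eq[of "vector [0, 1]"] k r by (simp add: lin_disc_pt)
next
  case (Aff x)
  then have x: "x \<in> berk_A1 v" using z by simp
  have "lin v z (vector [0, 1]) = x 1" using Aff by (simp add: lin_Aff one_pCons)
  then have k1: "k = 1" using eq[of "vector [0, 1]"] r seminorm_simps(2)[OF x] by (simp add: lin_disc_pt)
  have "x [:- a, 1:] = r" using eq[of "vector [1, - a]"] r Aff k1 by (simp add: lin_Aff lin_disc_pt)
  then show thesis using that[OF x Aff k1] seminorm_le_eta[OF x, of r a] r by simp
qed

lemma disc_pt_eqI:
  assumes "p \<in> disc_pts v" "q \<in> disc_pts v" "0 < k" and eq: "\<And>f. lin v p f = k * lin v q f"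
  shows "p = q"
proof -
  obtain a r b s where p: "p = disc_pt v a r" "0 < r" and q: "q = disc_pt v b s" "0 < s"
    using assms unfolding disc_pts_def by auto
  have P: "p \<in> berk_P1 v" "q \<in> berk_P1 v" using assms disc_pts_in_P1 by auto
  obtain x where x: "p = Aff x" "\<And>P. x P \<le> eta v b s P" "k = 1"
    using disc_pt_dominates[OF P(1) q(2) assms(3)] eq q by metis
  obtain y where y: "q = Aff y" "\<And>P. y P \<le> eta v a r P"
    using disc_pt_dominates[OF P(2) p(2), of 1] eq p x(3) by (metis mult_1 zero_less_one)
  have "x = y" using x y p q unfolding disc_pt_def by (auto intro!: ext order_antisym)
  then show ?thesis using x y by simp
qed

lemma disc_pt_center: assumes "0 < r" "v (a - b) \<le> r" shows "disc_pt v a r = disc_pt v b r"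
proof (rule disc_pt_eqI)
  fix f :: "'a ^ 2"
  have le: "lin v (disc_pt v a r) f \<le> lin v (disc_pt v b r) f" if "v (a - b) \<le> r" for a b
  proof -
    have "f $ 1 * a + f $ 2 = (f $ 1 * b + f $ 2) + f $ 1 * (a - b)" by (simp add: algebra_simps)
    then have "v (f $ 1 * a + f $ 2) \<le> max (v (f $ 1 * b + f $ 2)) (v (f $ 1) * v (a - b))"
      using ultrametric mult by metis
    moreover have "v (f $ 1) * v (a - b) \<le> v (f $ 1) * r" using that nonneg by (intro mult_left_mono) auto
    ultimately show ?thesis using assms(1) by (auto simp: lin_disc_pt)
  qed
  show "lin v (disc_pt v a r) f = 1 * lin v (disc_pt v b r) f"
    using le[OF assms(2)] le[of b a] assms(2) abs_minus_commute[of a b] by (simp add: order_antisym)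
qed (use assms disc_pts_def in auto)

lemma diagonal_norm_aux:
  fixes N :: "'a ^ 2 \<Rightarrow> real"
  assumes ab: "0 < \<alpha>" "0 < \<beta>" and N: "\<And>x y. N (x *s e1 + y *s e2) = max (\<alpha> * v x) (\<beta> * v y)"
    and rep: "vector [0, 1] = x1 *s e1 + y1 *s e2" and dom: "\<beta> * v y1 \<le> \<alpha> * v x1"
  shows "\<exists>a r k. 0 < r \<and> 0 < k \<and> (\<forall>f. N f = k * max (v (f $ 1) * r) (v (f $ 1 * a + f $ 2)))"
proof -
  let ?o = "vector [0, 1] :: 'a ^ 2"
  have x1: "x1 \<noteq> 0"
  proof
    assume x: "x1 = 0"
    then have "v y1 \<le> 0" using dom ab by (simp add: mult_le_0_iff)
    then have "y1 = 0" using nonneg[of y1] eq_0_iff[of y1] by simp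
    then have "?o $ 2 = 0" using rep x by simp
    then show False by simp
  qed
  have basis: "N (u *s ?o + w *s e2) = max (\<alpha> * v x1 * v u) (\<beta> * v w)" for u w
  proof -
    have comb: "u *s ?o + w *s e2 = (u * x1) *s e1 + (u * y1 + w) *s e2"
      unfolding rep by (simp add: vec_eq_iff algebra_simps)
    have eq: "N (u *s ?o + w *s e2) = max (\<alpha> * v x1 * v u) (\<beta> * v (u * y1 + w))"
      unfolding comb N by (simp add: mult mult_ac)
    have "\<beta> * v y1 * v u \<le> \<alpha> * v x1 * v u" using dom nonneg by (intro mult_right_mono)
    then have d: "\<beta> * v (u * y1) \<le> \<alpha> * v x1 * v u" by (simp add: mult mult_ac)
    have "\<beta> * v (u * y1 + w) \<le> \<beta> * max (v (u * y1)) (v w)"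
      using ab ultrametric by (intro mult_left_mono) auto
    moreover have "\<beta> * v w \<le> \<beta> * max (v (u * y1 + w)) (v (u * y1))"
      using ab abs_diff[of "u * y1 + w" "u * y1"] by (intro mult_left_mono) auto
    ultimately have "\<beta> * v (u * y1 + w) \<le> max (\<beta> * v (u * y1)) (\<beta> * v w)"
      "\<beta> * v w \<le> max (\<beta> * v (u * y1 + w)) (\<beta> * v (u * y1))"
      using ab by (simp_all add: max_mult_distrib_left)
    then show ?thesis unfolding eq using d by linarith
  qed
  let ?c = "e2 $ 1"
  have c: "?c \<noteq> 0"
  proof
    assume "?c = 0"
    then have "(- (e2 $ 2)) *s ?o + 1 *s e2 = 0 *s ?o + 0 *s e2" by (simp add: vec_eq_iff forall_2)
    then have "N ((- (e2 $ 2)) *s ?o + 1 *s e2) = 0" using basis[of 0 0] by simp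
    then show False using basis[of "- (e2 $ 2)" 1] ab by (simp add: max_def split: if_splits)
  qed
  define a k where "a = - (e2 $ 2) / ?c" and "k = \<alpha> * v x1"
  have k: "0 < k" unfolding k_def using ab x1 abs_pos by simp
  have "N f = k * max (v (f $ 1) * (\<beta> / (v ?c * k))) (v (f $ 1 * a + f $ 2))" for f
  proof -
    have "f = (f $ 1 * a + f $ 2) *s ?o + (f $ 1 / ?c) *s e2"
      using c by (simp add: a_def vec_eq_iff forall_2)
    then have "N f = max (k * v (f $ 1 * a + f $ 2)) (\<beta> * v (f $ 1 / ?c))"
      using basis unfolding k_def by metis
    moreover have "k * (v (f $ 1) * (\<beta> / (v ?c * k))) = \<beta> * v (f $ 1 / ?c)"
      using k by (simp add: abs_divide)
    ultimately show ?thesis using k by (simp add: max_mult_distrib_left max.commute)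
  qed
  then show ?thesis using k ab abs_pos[OF c] by (metis divide_pos_pos mult_pos_pos)
qed

text \<open>A norm with an orthogonal basis comes from a disc point: one of the two basis vectors can be replaced by the
  constant form \<open>1\<close>, and a multiple of the other one is then \<open>T - a\<close>.\<close>
lemma diagonal_norm:
  fixes N :: "'a ^ 2 \<Rightarrow> real"
  assumes ab: "0 < \<alpha>" "0 < \<beta>" and N: "\<And>x y. N (x *s e1 + y *s e2) = max (\<alpha> * v x) (\<beta> * v y)"
    and rep: "vector [0, 1] = x1 *s e1 + y1 *s e2"
  obtains q k where "q \<in> disc_pts v" "0 < k" "\<And>f. N f = k * lin v q f"
proof -
  have "\<exists>a r k. 0 < r \<and> 0 < k \<and> (\<forall>f. N f = k * max (v (f $ 1) * r) (v (f $ 1 * a + f $ 2)))"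
  proof (cases "\<beta> * v y1 \<le> \<alpha> * v x1")
    case True then show ?thesis by (rule diagonal_norm_aux[OF ab N rep])
  next
    case False
    have "N (x *s e2 + y *s e1) = max (\<beta> * v x) (\<alpha> * v y)" for x y
      using N[of y x] by (simp only: add.commute[of "x *s e2"] max.commute[of "\<beta> * v x"])
    moreover have "vector [0, 1] = y1 *s e2 + x1 *s e1" unfolding rep by (rule add.commute)
    ultimately show ?thesis using False by (intro diagonal_norm_aux[OF ab(2,1), of N e2 e1 y1 x1]) auto
  qed
  then obtain a r k where "0 < r" "0 < k" "\<And>f. N f = k * max (v (f $ 1) * r) (v (f $ 1 * a + f $ 2))" by blast
  then show thesis using that[of "disc_pt v a r" k] unfolding disc_pts_def by (auto simp: lin_disc_pt)
qed

text \<open>The image \<open>w\<close> of \<open>q\<close> induces on linear forms a norm with an orthogonal basis, which comes from a disc point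
  \<open>q'\<close>. As \<open>q'\<close> dominates \<open>w\<close>, its preimage dominates \<open>q\<close>; but \<open>q\<close> dominates every point with its
  values on linear forms, so the preimage is \<open>q\<close>, and \<open>w = q'\<close>.\<close>
lemma moebius_disc_pts:
  assumes q: "q \<in> disc_pts v" and M: "invertible M"
  shows "moebius v M q \<in> disc_pts v"
proof -
  obtain a r where qd: "q = disc_pt v a r" and r: "0 < r" using q unfolding disc_pts_def by auto
  have qP: "q \<in> berk_P1 v" using q disc_pts_in_P1 by auto
  obtain M' where MM: "M ** M' = mat 1" "M' ** M = mat 1" using M unfolding invertible_def by blast
  then have M': "invertible M'" unfolding invertible_def by blast
  define w where "w = moebius v M q"
  have w: "w \<in> berk_P1 v" unfolding w_def using moebius_form_val(1)[OF qP M] .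
  have w_back: "moebius v M' w = q" unfolding w_def
    using moebius_comp[OF qP M' M] moebius_one[OF qP] MM by simp
  obtain k where k: "0 < k" "\<And>f. k * lin v w f = lin v q (f v* M)"
    using lin_moebius[OF qP M] unfolding w_def by blast
  define e1 e2 where "e1 = vector [1, - a] v* M'" and "e2 = (vector [0, 1] :: 'a ^ 2) v* M'"
  have eM: "e1 v* M = vector [1, - a]" "e2 v* M = vector [0, 1]"
    unfolding e1_def e2_def by (simp_all add: vector_matrix_mul_assoc MM vector_matrix_mul_rid)
  have lc: "(x *s f + y *s g) v* A = x *s (f v* A) + y *s (g v* A)"
    for x y :: 'a and f g :: "'a ^ 2" and A :: "'a ^ 2 ^ 2"
    by (simp add: vec_eq_iff vector_matrix_mult_def forall_2 sum_2 algebra_simps)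
  have N: "lin v q ((x *s e1 + y *s e2) v* M) = max (r * v x) (1 * v y)" for x y
    unfolding lc eM qd using r by (simp add: lin_disc_pt mult.commute)
  obtain x1 y1 where rep: "vector [0, 1] = x1 *s e1 + y1 *s e2"
  proof
    let ?h = "(vector [0, 1] :: 'a ^ 2) v* M"
    have "?h = ?h $ 1 *s vector [1, - a] + (?h $ 1 * a + ?h $ 2) *s vector [0, 1]"
      by (simp add: vec_eq_iff forall_2)
    then have "?h v* M' = (?h $ 1 *s vector [1, - a] + (?h $ 1 * a + ?h $ 2) *s vector [0, 1]) v* M'" by metis
    then show "vector [0, 1] = ?h $ 1 *s e1 + (?h $ 1 * a + ?h $ 2) *s e2"
      unfolding lc e1_def e2_def by (simp add: vector_matrix_mul_assoc MM vector_matrix_mul_rid)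
  qed
  obtain q' l where q': "q' \<in> disc_pts v" "0 < l" "\<And>f. lin v q (f v* M) = l * lin v q' f"
    using diagonal_norm[OF r zero_less_one, of "\<lambda>f. lin v q (f v* M)" e1 e2 x1 y1] N rep by blast
  obtain b s where q'd: "q' = disc_pt v b s" and s: "0 < s" using q' unfolding disc_pts_def by auto
  have q'P: "q' \<in> berk_P1 v" using q' disc_pts_in_P1 by auto
  have wq': "lin v w f = (l / k) * lin v q' f" for f using k q' by (simp add: field_simps)
  obtain x where x: "w = Aff x" "l / k = 1" "\<And>P. x P \<le> eta v b s P"
    using disc_pt_dominates[OF w s, of "l / k" b] wq' q'd k q' by (metis divide_pos_pos)
  have lin_eq: "lin v w f = lin v q' f" for f using wq' x by simp
  define z where "z = moebius v M' q'"
  have z: "z \<in> berk_P1 v" unfolding z_def using moebius_form_val(1)[OF q'P M'] .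
  obtain k1 where k1: "k1 > 0" "\<And>n P. degree P \<le> n \<Longrightarrow>
      k1 ^ n * form_val v z n P = form_val v q' n (hom_subst n P (mnum M') (mden M'))"
    using moebius_form_val(2)[OF q'P M'] unfolding z_def by blast
  obtain k2 where k2: "k2 > 0" "\<And>n P. degree P \<le> n \<Longrightarrow>
      k2 ^ n * form_val v q n P = form_val v w n (hom_subst n P (mnum M') (mden M'))"
    using moebius_form_val(2)[OF w M'] unfolding w_back by blast
  have hs: "hom_subst 1 [:f $ 2, f $ 1:] (mnum M') (mden M') = [:(f v* M') $ 2, (f v* M') $ 1:]" for f
    unfolding hom_subst_linear by (simp add: vector_matrix_mult_def sum_2 mult.commute)
  \<comment> \<open>since \<open>w\<close> and \<open>q'\<close> agree on linear forms, so do their images under \<open>M'\<close>, up to the scaling constants\<close>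
  have l1: "k1 * lin v z f = k2 * lin v q f" for f
  proof -
    have "k1 * lin v z f = lin v q' (f v* M')"
      using k1(2)[of "[:f $ 2, f $ 1:]" 1] degree_num_den hs unfolding lin_def by (metis power_one_right)
    moreover have "k2 * lin v q f = lin v w (f v* M')"
      using k2(2)[of "[:f $ 2, f $ 1:]" 1] degree_num_den hs unfolding lin_def by (metis power_one_right)
    ultimately show ?thesis using lin_eq by simp
  qed
  then have zq: "lin v z f = (k2 / k1) * lin v q f" for f using k1 by (simp add: field_simps)
  obtain y where y: "z = Aff y" "k2 / k1 = 1" "\<And>P. y P \<le> eta v a r P"
    using disc_pt_dominates[OF z r, of "k2 / k1" a] zq qd k1 k2 by (metis divide_pos_pos)
  have k12: "k1 = k2" using y k1 by simp
  have "eta v a r P \<le> y P" for P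
  proof -
    have "k2 ^ degree P * eta v a r P = x (hom_subst (degree P) P (mnum M') (mden M'))"
      using k2(2)[of P "degree P"] qd x by (simp add: disc_pt_def)
    also have "\<dots> \<le> eta v b s (hom_subst (degree P) P (mnum M') (mden M'))" using x by blast
    also have "\<dots> = k2 ^ degree P * y P"
      using k1(2)[of P "degree P"] q'd y k12 by (simp add: disc_pt_def)
    finally show ?thesis using k2 by simp
  qed
  then have "y = eta v a r" using y by (intro ext order_antisym)
  then have "z = q" using y qd by (simp add: disc_pt_def)
  then have "w = moebius v M (moebius v M' q')" unfolding w_def z_def by simp
  also have "\<dots> = q'" using moebius_comp[OF q'P M M'] moebius_one[OF q'P] MM by simp
  finally show ?thesis using q' w_def by simp
qed

lemma dilation_eqI:
  assumes "\<And>f. lin v p f \<le> c * lin v q f" "0 < lin v q f" "lin v p f = c * lin v q f"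
  shows "dilation v p q = c"
  unfolding dilation_def
proof (rule the_equality)
  fix e assume e: "(\<forall>f. lin v p f \<le> e * lin v q f) \<and> (\<exists>f. 0 < lin v q f \<and> lin v p f = e * lin v q f)"
  then obtain g where g: "0 < lin v q g" "lin v p g = e * lin v q g" by blast
  have "e * lin v q g \<le> c * lin v q g" using assms(1)[of g] g by simp
  moreover have "c * lin v q f \<le> e * lin v q f" using assms(3) e by metis
  ultimately show "e = c" using g assms(2) by simp
qed (use assms in blast)

lemma join_radius_commute: "join_radius v a r b s = join_radius v b s a r"
  unfolding join_radius_def using abs_minus_commute[of a b] by (simp add: max.commute)

lemma join_radius_ultrametric:
  "join_radius v a r c t \<le> max (join_radius v a r b s) (join_radius v b s c t)"
  unfolding join_radius_def using ultrametric[of "a - b" "b - c"] by auto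

lemma join_radius_ge: "r \<le> join_radius v a r b s" "s \<le> join_radius v a r b s" "v (a - b) \<le> join_radius v a r b s"
  unfolding join_radius_def by auto

lemma dilation_disc_pt:
  fixes a b :: 'a and r s :: real
  assumes r: "0 < r" and s: "0 < s"
  defines "R \<equiv> join_radius v a r b s"
  shows "dilation v (disc_pt v a r) (disc_pt v b s) = R / s"
    and "lin v (disc_pt v a r) f \<le> R / s * lin v (disc_pt v b s) f"
    and "\<exists>f. 0 < lin v (disc_pt v b s) f \<and> lin v (disc_pt v a r) f = R / s * lin v (disc_pt v b s) f"
proof -
  have R: "r \<le> R" "s \<le> R" "v (a - b) \<le> R" "0 < R"
    using r unfolding R_def join_radius_def by (auto simp: less_max_iff_disj)
  show le: "lin v (disc_pt v a r) f \<le> R / s * lin v (disc_pt v b s) f" for f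
  proof -
    let ?N = "max (v (f $ 1) * s) (v (f $ 1 * b + f $ 2))"
    have N: "v (f $ 1) * R \<le> R / s * ?N"
    proof -
      have "R / s * (v (f $ 1) * s) \<le> R / s * ?N" using R s by (intro mult_left_mono) auto
      then show ?thesis using s by (simp add: mult.commute)
    qed
    have "v (f $ 1) * r \<le> v (f $ 1) * R" "v (f $ 1) * v (a - b) \<le> v (f $ 1) * R"
      using R nonneg by (auto intro: mult_left_mono)
    moreover have "v (f $ 1 * b + f $ 2) \<le> R / s * ?N"
    proof -
      have "1 * v (f $ 1 * b + f $ 2) \<le> R / s * ?N" using R s nonneg by (intro mult_mono) auto
      then show ?thesis by simp
    qed
    moreover have "f $ 1 * a + f $ 2 = (f $ 1 * b + f $ 2) + f $ 1 * (a - b)" by (simp add: algebra_simps)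
    then have "v (f $ 1 * a + f $ 2) \<le> max (v (f $ 1 * b + f $ 2)) (v (f $ 1) * v (a - b))"
      using ultrametric mult by metis
    ultimately show ?thesis using N r s by (simp add: lin_disc_pt)
  qed
  show ex: "\<exists>f. 0 < lin v (disc_pt v b s) f \<and> lin v (disc_pt v a r) f = R / s * lin v (disc_pt v b s) f"
  proof (cases "R = s")
    case True
    then show ?thesis using r s by (intro exI[of _ "vector [0, 1]"]) (simp add: lin_disc_pt)
  next
    case False
    then have "R = max r (v (a - b))" using R unfolding R_def join_radius_def by (auto simp: max_def split: if_splits)
    then show ?thesis using r s by (intro exI[of _ "vector [1, - b]"]) (simp add: lin_disc_pt)
  qed
  show "dilation v (disc_pt v a r) (disc_pt v b s) = R / s"
    using dilation_eqI le ex by blast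
qed

lemma dilation_props:
  assumes "p \<in> disc_pts v" "q \<in> disc_pts v"
  shows "0 < dilation v p q" "lin v p f \<le> dilation v p q * lin v q f"
    "\<exists>f. 0 < lin v q f \<and> lin v p f = dilation v p q * lin v q f"
proof -
  obtain a r b s where p: "p = disc_pt v a r" "0 < r" and q: "q = disc_pt v b s" "0 < s"
    using assms unfolding disc_pts_def by auto
  show "0 < dilation v p q" "lin v p f \<le> dilation v p q * lin v q f"
    "\<exists>f. 0 < lin v q f \<and> lin v p f = dilation v p q * lin v q f"
    unfolding p(1) q(1) using dilation_disc_pt[OF p(2) q(2)] less_le_trans[OF p(2) join_radius_ge(1)] q(2) by auto
qed

lemma hdist_disc_pt:
  assumes "0 < r" "0 < s"
  shows "hdist v (disc_pt v a r) (disc_pt v b s) = 2 * ln (join_radius v a r b s) - ln r - ln s"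
proof -
  have "0 < join_radius v a r b s" using less_le_trans[OF assms(1) join_radius_ge(1)] .
  then show ?thesis
    using assms join_radius_commute[of b s a r] by (simp add: hdist_def dilation_disc_pt ln_mult ln_div)
qed

lemma hdist_moebius:
  assumes p: "p \<in> disc_pts v" and q: "q \<in> disc_pts v" and M: "invertible M"
  shows "hdist v (moebius v M p) (moebius v M q) = hdist v p q"
proof -
  obtain M' where MM: "M ** M' = mat 1" "M' ** M = mat 1" using M unfolding invertible_def by blast
  have P: "p \<in> berk_P1 v" "q \<in> berk_P1 v" using p q disc_pts_in_P1 by auto
  have dil: "dilation v (moebius v M p) (moebius v M q) = dilation v p q * l / k"
    if p: "p \<in> disc_pts v" and q: "q \<in> disc_pts v" and "0 < k" "0 < l"
      and k: "\<And>f. k * lin v (moebius v M p) f = lin v p (f v* M)"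
      and l: "\<And>f. l * lin v (moebius v M q) f = lin v q (f v* M)" for p q k l
  proof -
    obtain f where f: "0 < lin v q f" "lin v p f = dilation v p q * lin v q f"
      using dilation_props(3)[OF p q] by blast
    define g where "g = f v* M'"
    have g: "g v* M = f" unfolding g_def by (simp add: vector_matrix_mul_assoc MM vector_matrix_mul_rid)
    show ?thesis
    proof (rule dilation_eqI)
      show "0 < lin v (moebius v M q) g" using l[of g] g f \<open>0 < l\<close> by (metis zero_less_mult_pos)
      show "lin v (moebius v M p) g = dilation v p q * l / k * lin v (moebius v M q) g"
        using k[of g] l[of g] g f \<open>0 < k\<close> by (simp add: field_simps)
      fix h
      have "k * lin v (moebius v M p) h \<le> dilation v p q * (l * lin v (moebius v M q) h)"
        unfolding k l by (rule dilation_props(2)[OF p q])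
      then show "lin v (moebius v M p) h \<le> dilation v p q * l / k * lin v (moebius v M q) h"
        using \<open>0 < k\<close> by (simp add: field_simps)
    qed
  qed
  obtain k where k: "0 < k" "\<And>f. k * lin v (moebius v M p) f = lin v p (f v* M)"
    using lin_moebius[OF P(1) M] by blast
  obtain l where l: "0 < l" "\<And>f. l * lin v (moebius v M q) f = lin v q (f v* M)"
    using lin_moebius[OF P(2) M] by blast
  show ?thesis unfolding hdist_def
    using dil[OF p q k(1) l(1) k(2) l(2)] dil[OF q p l(1) k(1) l(2) k(2)] k l by simp
qed

end

section \<open>Directions at a disc point and discs\<close>

text \<open>The ratio of the norm of \<open>z\<close> to that of \<open>q\<close> is not maximal at \<open>f\<close>. For \<open>q = \<eta>(a, r)\<close> and \<open>f = T - a\<close> this means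
  that \<open>z\<close> is in the open disc of radius \<open>r\<close> around \<open>a\<close>; for \<open>f = 1\<close> it means that \<open>z\<close> is outside the closed disc.\<close>
definition in_dir :: "('a::field \<Rightarrow> real) \<Rightarrow> 'a berk_pt \<Rightarrow> 'a ^ 2 \<Rightarrow> 'a berk_pt \<Rightarrow> bool" where
  "in_dir v q f z \<longleftrightarrow> (\<exists>g. lin v z f * lin v q g < lin v z g * lin v q f)"

definition dir_disc :: "('a::field \<Rightarrow> real) \<Rightarrow> 'a berk_pt \<Rightarrow> 'a ^ 2 \<Rightarrow> 'a berk_pt set" where
  "dir_disc v q f = {z \<in> berk_P1 v. in_dir v q f z}"

text \<open>For disc points \<open>p \<noteq> q\<close> this is the open disc with boundary point \<open>q\<close> that contains \<open>p\<close>.\<close>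
definition branch :: "('a::field \<Rightarrow> real) \<Rightarrow> 'a berk_pt \<Rightarrow> 'a berk_pt \<Rightarrow> 'a berk_pt set" where
  "branch v q p = {z \<in> berk_P1 v. \<exists>f. in_dir v q f p \<and> in_dir v q f z}"

context nonarch_abs
begin

lemma disc_pt_mem: "0 < r \<Longrightarrow> disc_pt v a r \<in> disc_pts v"
  unfolding disc_pts_def by blast

lemma hdist_self: assumes "p \<in> disc_pts v" shows "hdist v p p = 0"
proof -
  have "dilation v p p = 1"
    by (rule dilation_eqI[of _ _ _ "vector [0, 1]"])
      (use assms lin_disc_pos[of p "vector [0, 1]"] in \<open>auto simp: vec_eq_iff forall_2\<close>)
  then show ?thesis by (simp add: hdist_def)
qed

text \<open>The points between \<open>\<eta>(a, r)\<close> and \<open>\<eta>(b, s)\<close> are the discs that grow from one of the two until they meet.\<close>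
lemma hdist_between:
  assumes r: "0 < r" and s: "0 < s" and t: "0 < t"
    and eq: "hdist v (disc_pt v a r) (disc_pt v c t) + hdist v (disc_pt v c t) (disc_pt v b s)
      = hdist v (disc_pt v a r) (disc_pt v b s)"
  shows "(disc_pt v c t = disc_pt v a t \<and> r \<le> t \<and> t \<le> join_radius v a r b s) \<or>
    (disc_pt v c t = disc_pt v b t \<and> s \<le> t \<and> t \<le> join_radius v b s a r)"
proof -
  let ?R = "join_radius v a r b s" and ?A = "join_radius v a r c t" and ?B = "join_radius v c t b s"
  have pos: "0 < ?R" "0 < ?A" "0 < ?B" using less_le_trans[OF r join_radius_ge(1)] less_le_trans[OF t join_radius_ge(1)] by auto
  have "2 * ln ?A + 2 * ln ?B = 2 * ln ?R + 2 * ln t" using eq unfolding hdist_disc_pt[OF r t] hdist_disc_pt[OF t s] hdist_disc_pt[OF r s] by simp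
  then have "ln (?A * ?B) = ln (?R * t)" using pos t by (simp add: ln_mult)
  then have prod: "?A * ?B = ?R * t" using pos t by simp
  have RAB: "?R \<le> max ?A ?B" by (rule join_radius_ultrametric)
  have At: "t \<le> ?A" "t \<le> ?B" using join_radius_ge by auto
  consider "?R \<le> ?A" | "?R \<le> ?B" using RAB by linarith
  then show ?thesis
  proof cases
    case 1
    have "?R * t \<le> ?A * t" using 1 t by simp
    moreover have "?R * t = ?A * ?B" using prod by simp
    ultimately have "?B \<le> t" using pos by simp
    then have Bt: "?B = t" using At by simp
    then have "?A = ?R" using prod t by simp
    then have "t \<le> ?R" using At by simp
    moreover have "v (c - b) \<le> t" "s \<le> t" using Bt join_radius_ge(2,3) by metis+
    ultimately show ?thesis using disc_pt_center[OF t] join_radius_commute[of a r b s] by auto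
  next
    case 2
    have "?R * t \<le> ?B * t" using 2 t by simp
    moreover have "?R * t = ?B * ?A" using prod by (simp add: mult.commute)
    ultimately have "?A \<le> t" using pos by simp
    then have Bt: "?A = t" using At by simp
    then have "?B = ?R" using prod t by simp
    then have "t \<le> ?R" using At by simp
    moreover have "v (a - c) \<le> t" "r \<le> t" using Bt join_radius_ge(1,3) by metis+
    ultimately show ?thesis using disc_pt_center[OF t, of a c] by auto
  qed
qed

text \<open>The four-point condition is the ultrametric inequality for \<open>join_radius\<close>, in the form of
  \<open>ultrametric_four_points\<close>; the logarithms of the radii contribute equally to the three sums.\<close>
lemma disc_tree_metric:
  assumes sub: "D \<subseteq> disc_pts v"
    and convex: "\<And>a r b s t. \<lbrakk>disc_pt v a r \<in> D; disc_pt v b s \<in> D; 0 < r; 0 < s; r \<le> t;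
      t \<le> join_radius v a r b s\<rbrakk> \<Longrightarrow> disc_pt v a t \<in> D"
  shows "tree_metric D (hdist v)"
proof
  have rep: "\<exists>a r. 0 < r \<and> x = disc_pt v a r" if "x \<in> D" for x
    using subsetD[OF sub that] unfolding disc_pts_def by blast
  have jpos: "0 < join_radius v a r b s" if "0 < r" for a r b s using less_le_trans[OF that join_radius_ge(1)] .
  fix x y assume x: "x \<in> D" and y: "y \<in> D"
  obtain a r where xa: "0 < r" "x = disc_pt v a r" using rep x by blast
  obtain b s where yb: "0 < s" "y = disc_pt v b s" using rep y by blast
  let ?R = "join_radius v a r b s"
  have d: "hdist v x y = 2 * ln ?R - ln r - ln s" using hdist_disc_pt xa yb by simp
  show "hdist v x y = 0 \<longleftrightarrow> x = y"
  proof
    assume "hdist v x y = 0"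
    then have "ln ?R - ln r + (ln ?R - ln s) = 0" using d by simp
    moreover have "ln r \<le> ln ?R" "ln s \<le> ln ?R" using xa yb jpos join_radius_ge by (auto simp: ln_le_cancel_iff)
    ultimately have "ln ?R = ln r" "ln ?R = ln s" by auto
    then have "?R = r" "?R = s" using jpos[OF xa(1), of a b s] xa yb by auto
    then have "v (a - b) \<le> r" "r = s" using join_radius_ge(3)[of a b r s] by auto
    then show "x = y" using disc_pt_center xa yb by simp
  next
    assume "x = y" then show "hdist v x y = 0" using hdist_self sub x by auto
  qed
  show "hdist v x y = hdist v y x" unfolding hdist_def by (simp add: mult.commute)
  fix z assume z: "z \<in> D"
  obtain c t where zc: "0 < t" "z = disc_pt v c t" using rep z by blast
  let ?RA = "join_radius v a r c t" and ?RB = "join_radius v b s c t"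
  show "hdist v x z \<le> hdist v x y + hdist v y z"
  proof -
    have "?RA * s \<le> ?R * ?RB"
    proof -
      have "?RA \<le> max ?R ?RB" by (rule join_radius_ultrametric)
      then consider "?RA \<le> ?R" | "?RA \<le> ?RB" by linarith
      then show ?thesis
      proof cases
        case 1 then show ?thesis using join_radius_ge(1)[of s b c t] yb jpos[OF xa(1), of a b s] by (intro mult_mono) auto
      next
        case 2
        then have "?RA * s \<le> ?RB * ?R" using join_radius_ge(2)[of s a r b] yb jpos[OF yb(1), of b c t] by (intro mult_mono) auto
        then show ?thesis by (simp add: mult.commute)
      qed
    qed
    then have "ln (?RA * s) \<le> ln (?R * ?RB)" using jpos xa yb by (subst ln_le_cancel_iff) auto
    moreover have "ln (?RA * s) = ln ?RA + ln s" "ln (?R * ?RB) = ln ?R + ln ?RB"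
      using jpos[OF xa(1), of a c t] jpos[OF xa(1), of a b s] jpos[OF yb(1), of b c t] yb
      by (simp_all add: ln_mult_pos)
    ultimately show ?thesis using xa yb zc by (simp add: hdist_disc_pt)
  qed
  fix u assume u: "u \<in> D"
  obtain e w where uw: "0 < w" "u = disc_pt v e w" using rep u by blast
  have "?R * join_radius v c t e w \<le> max (?RA * join_radius v b s e w) (join_radius v a r e w * ?RB)"
  proof (rule ultrametric_four_points)
    show "?R \<le> max ?RA ?RB"
      using join_radius_ultrametric[of a r b s c t] join_radius_commute[of c t b s] by simp
    show "?R \<le> max (join_radius v a r e w) (join_radius v b s e w)"
      using join_radius_ultrametric[of a r b s e w] join_radius_commute[of e w b s] by simp
    show "join_radius v c t e w \<le> max ?RA (join_radius v a r e w)"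
      using join_radius_ultrametric[of c t e w a r] join_radius_commute[of c t a r] by simp
    show "join_radius v c t e w \<le> max ?RB (join_radius v b s e w)"
      using join_radius_ultrametric[of c t e w b s] join_radius_commute[of c t b s] by simp
  qed (use jpos xa yb zc in auto)
  then consider "?R * join_radius v c t e w \<le> ?RA * join_radius v b s e w"
    | "?R * join_radius v c t e w \<le> join_radius v a r e w * ?RB" by linarith
  then show "hdist v x y + hdist v z u \<le> max (hdist v x z + hdist v y u) (hdist v x u + hdist v y z)"
  proof cases
    case 1
    then have "ln (?R * join_radius v c t e w) \<le> ln (?RA * join_radius v b s e w)"
      using jpos xa yb zc by (subst ln_le_cancel_iff) auto
    then have "ln ?R + ln (join_radius v c t e w) \<le> ln ?RA + ln (join_radius v b s e w)"
      using jpos[OF xa(1)] jpos[OF yb(1)] jpos[OF zc(1)] by (simp add: ln_mult_pos)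
    then have "hdist v x y + hdist v z u \<le> hdist v x z + hdist v y u"
      using xa yb zc uw by (simp add: hdist_disc_pt)
    then show ?thesis by simp
  next
    case 2
    then have "ln (?R * join_radius v c t e w) \<le> ln (join_radius v a r e w * ?RB)"
      using jpos xa yb zc by (subst ln_le_cancel_iff) auto
    then have "ln ?R + ln (join_radius v c t e w) \<le> ln (join_radius v a r e w) + ln ?RB"
      using jpos[OF xa(1)] jpos[OF yb(1)] jpos[OF zc(1)] by (simp add: ln_mult_pos)
    then have "hdist v x y + hdist v z u \<le> hdist v x u + hdist v y z"
      using xa yb zc uw by (simp add: hdist_disc_pt)
    then show ?thesis by simp
  qed
next
  fix x y :: "'a berk_pt" and l :: real assume x: "x \<in> D" and y: "y \<in> D" and l: "0 \<le> l" "l \<le> hdist v x y"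
  obtain a r where xa: "0 < r" "x = disc_pt v a r" using sub x unfolding disc_pts_def by auto
  obtain b s where yb: "0 < s" "y = disc_pt v b s" using sub y unfolding disc_pts_def by auto
  have leg: "disc_pt v a t \<in> D \<and> hdist v (disc_pt v a r) (disc_pt v a t) = ln t - ln r \<and>
      hdist v (disc_pt v a t) (disc_pt v b s) = 2 * ln (join_radius v a r b s) - ln t - ln s"
    if "0 < r" "0 < s" "disc_pt v a r \<in> D" "disc_pt v b s \<in> D" "r \<le> t" "t \<le> join_radius v a r b s" for a r b s t
  proof -
    have t: "0 < t" using that by simp
    have "join_radius v a r a t = t" using that t unfolding join_radius_def by auto
    moreover have "join_radius v a t b s = join_radius v a r b s" using that unfolding join_radius_def by auto
    moreover have "disc_pt v a t \<in> D" by (rule convex[OF that(3,4,1,2,5,6)])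
    ultimately show ?thesis using hdist_disc_pt[OF that(1) t] hdist_disc_pt[OF t that(2)] by simp
  qed
  let ?R = "join_radius v a r b s"
  have d: "hdist v x y = 2 * ln ?R - ln r - ln s" using hdist_disc_pt xa yb by simp
  have R: "0 < ?R" using less_le_trans[OF xa(1) join_radius_ge(1)] .
  show "\<exists>z\<in>D. hdist v x z = l \<and> hdist v z y = hdist v x y - l"
  proof (cases "l \<le> ln ?R - ln r")
    case True
    \<comment> \<open>on the leg from \<open>x\<close> up to the join, the distance from \<open>x\<close> is the logarithm of the growth of the radius\<close>
    define t where "t = r * exp l"
    have t: "r \<le> t" "ln t = ln r + l" using xa l unfolding t_def by (simp_all add: ln_mult)
    have "t \<le> ?R" using t True xa R by (simp flip: ln_le_cancel_iff)
    then have "disc_pt v a t \<in> D \<and> hdist v x (disc_pt v a t) = ln t - ln r \<and>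
      hdist v (disc_pt v a t) y = 2 * ln ?R - ln t - ln s"
      using leg[of r s a b t] xa yb x y t by simp
    then show ?thesis using t(2) d by (intro bexI[of _ "disc_pt v a t"]) simp_all
  next
    case False
    define t where "t = s * exp (hdist v x y - l)"
    have t: "s \<le> t" "ln t = ln s + (hdist v x y - l)" using yb l unfolding t_def by (simp_all add: ln_mult)
    have "t \<le> ?R" using t False d yb R by (simp flip: ln_le_cancel_iff)
    then have "disc_pt v b t \<in> D \<and> hdist v (disc_pt v b s) (disc_pt v b t) = ln t - ln s \<and>
      hdist v (disc_pt v b t) (disc_pt v a r) = 2 * ln ?R - ln t - ln r"
      using leg[of s r b a t] xa yb x y t join_radius_commute[of a r b s] by auto
    moreover have "hdist v z z' = hdist v z' z" for z z' unfolding hdist_def by (simp add: mult.commute)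
    ultimately show ?thesis using xa yb t d by (intro bexI[of _ "disc_pt v b t"]) auto
  qed
qed

lemma disc_pts_tree: "tree_metric (disc_pts v) (hdist v)"
proof (rule disc_tree_metric[OF subset_refl])
  fix a b :: 'a and r s t :: real assume "0 < r" "r \<le> t"
  then have "0 < t" by simp
  then show "disc_pt v a t \<in> disc_pts v" unfolding disc_pts_def by blast
qed

lemma lin_minus: "z \<in> berk_P1 v \<Longrightarrow> lin v z (- f) = lin v z f"
  using lin_scale[of z "-1" f] by (simp add: abs_minus_1)

lemma in_dir_irrefl: "\<not> in_dir v q f q"
  unfolding in_dir_def by (simp add: mult.commute)

lemma in_dir_nonzero: "q \<in> berk_P1 v \<Longrightarrow> z \<in> berk_P1 v \<Longrightarrow> in_dir v q f z \<Longrightarrow> f \<noteq> 0"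
proof
  assume q: "q \<in> berk_P1 v" and z: "z \<in> berk_P1 v" and "in_dir v q f z" and "f = 0"
  then obtain g where g: "lin v z 0 * lin v q g < lin v z g * lin v q 0" unfolding in_dir_def by blast
  have "lin v q 0 = 0" using lin_scale[OF q, of 0 0] by simp
  then show False using g mult_nonneg_nonneg[OF lin_nonneg[OF z, of 0] lin_nonneg[OF q, of g]] by simp
qed

text \<open>Forms that are small at a common point define the same direction. If \<open>f'\<close> is, up to a smaller
  form, a multiple of \<open>f\<close>, then it is small wherever \<open>f\<close> is. Otherwise \<open>f\<close>, \<open>f'\<close> is an orthogonal basis
  for \<open>q\<close>, and a norm cannot be smaller than its maximal ratio to \<open>q\<close> on both vectors.\<close>
lemma direction_unique:
  assumes q: "q \<in> disc_pts v" and z: "z \<in> berk_P1 v" and z': "z' \<in> berk_P1 v"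
    and dir: "in_dir v q f z" "in_dir v q f' z" "in_dir v q f z'"
  shows "in_dir v q f' z'"
proof -
  have qP: "q \<in> berk_P1 v" using q disc_pts_in_P1 by auto
  have f0: "f \<noteq> 0" "f' \<noteq> 0" using in_dir_nonzero dir qP z by blast+
  have qpos: "0 < lin v q f" "0 < lin v q f'" using lin_disc_pos[OF q] f0 by auto
  note nn = lin_nonneg[OF qP] lin_nonneg[OF z] lin_nonneg[OF z']
  show ?thesis
  proof (cases "\<exists>c. lin v q (f' - c *s f) < lin v q f'")
    case True
    then obtain c where c: "lin v q (f' - c *s f) < lin v q f'" by blast
    define h where "h = f' - c *s f"
    have f': "f' = h + c *s f" and cf: "c *s f = f' + (- h)" unfolding h_def by (simp_all add: vec_eq_iff)
    have le: "v c * lin v q f \<le> lin v q f'"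
      using lin_add[OF qP, of f' "- h"] c
      unfolding cf[symmetric] h_def[symmetric] lin_scale[OF qP] lin_minus[OF qP] by simp
    have "c \<noteq> 0" using c by auto
    then have cpos: "0 < v c" by (rule abs_pos)
    obtain g where g: "lin v z' f * lin v q g < lin v z' g * lin v q f" using dir(3) unfolding in_dir_def by blast
    have "0 \<le> lin v z' f * lin v q g" using nn by simp
    then have gpos: "0 < lin v z' g" using g qpos nn by (metis less_le_trans order_less_le mult_zero_left order_le_less_trans)
    have "lin v z' f' \<le> max (lin v z' h) (v c * lin v z' f)"
      using lin_add[OF z', of h "c *s f"] unfolding f'[symmetric] lin_scale[OF z'] .
    then consider "lin v z' f' \<le> v c * lin v z' f" | "lin v z' f' \<le> lin v z' h" by linarith
    then show ?thesis
    proof cases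
      case 1
      have "lin v z' f' * lin v q g \<le> v c * lin v z' f * lin v q g" using 1 nn by (intro mult_right_mono)
      also have "\<dots> < v c * (lin v z' g * lin v q f)" using g cpos by (simp add: mult.assoc)
      also have "\<dots> = lin v z' g * (v c * lin v q f)" by (simp add: mult_ac)
      also have "\<dots> \<le> lin v z' g * lin v q f'" using le nn by (intro mult_left_mono)
      finally show ?thesis unfolding in_dir_def by blast
    next
      case 2
      show ?thesis
      proof (cases "lin v z' h = 0")
        case True
        then have "lin v z' f' = 0" using 2 nn(3)[of f'] by simp
        then show ?thesis unfolding in_dir_def using gpos qpos by (intro exI[of _ g]) simp
      next
        case False
        then have "0 < lin v z' h" using nn(3)[of h] by simp
        have "lin v z' f' * lin v q h \<le> lin v z' h * lin v q h" using 2 nn by (intro mult_right_mono)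
        also have "\<dots> < lin v z' h * lin v q f'" using c \<open>0 < lin v z' h\<close> unfolding h_def by simp
        finally show ?thesis unfolding in_dir_def by blast
      qed
    qed
  next
    case False
    then have orth: "lin v q f' \<le> lin v q (f' - c *s f)" for c by (simp add: not_less)
    define D where "D = f $ 1 * f' $ 2 - f $ 2 * f' $ 1"
    have "D \<noteq> 0"
    proof
      assume D: "D = 0"
      obtain c where "f' = c *s f"
      proof (cases "f $ 1 = 0")
        case True
        then have f2: "f $ 2 \<noteq> 0" using f0 by (auto simp: vec_eq_iff forall_2)
        then have "f' $ 1 = 0" using D True unfolding D_def by simp
        then show thesis using that[of "f' $ 2 / f $ 2"] f2 True by (simp add: vec_eq_iff forall_2)
      next
        case f1: False
        then show thesis using that[of "f' $ 1 / f $ 1"] D unfolding D_def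
          by (simp add: vec_eq_iff forall_2 field_simps)
      qed
      then have "lin v q (f' - c *s f) = 0" using lin_scale[OF qP, of 0 0] by simp
      then show False using orth[of c] qpos by simp
    qed
    have both: "max (v x * lin v q f) (v y * lin v q f') \<le> lin v q (x *s f + y *s f')" for x y
    proof -
      have y: "v y * lin v q f' \<le> lin v q (x *s f + y *s f')"
      proof (cases "y = 0")
        case False
        then have comb: "x *s f + y *s f' = y *s (f' - (- x / y) *s f)" by (simp add: vec_eq_iff algebra_simps)
        show ?thesis unfolding comb lin_scale[OF qP] by (rule mult_left_mono[OF orth nonneg])
      qed (simp add: nn)
      have "x *s f = (x *s f + y *s f') + (- y) *s f'" by (simp add: vec_eq_iff)
      then have "v x * lin v q f \<le> max (lin v q (x *s f + y *s f')) (v y * lin v q f')"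
        using lin_add[OF qP, of "x *s f + y *s f'" "(- y) *s f'"] by (simp only: lin_scale[OF qP] abs_minus)
      then show ?thesis using y by simp
    qed
    \<comment> \<open>if \<open>f\<close>, \<open>f'\<close> is orthogonal for \<open>q\<close>, the larger of the two ratios bounds the ratio at every form\<close>
    define m where "m = max (lin v z f / lin v q f) (lin v z f' / lin v q f')"
    have "lin v z f / lin v q f \<le> m" "lin v z f' / lin v q f' \<le> m" unfolding m_def by auto
    then have m: "lin v z f \<le> m * lin v q f" "lin v z f' \<le> m * lin v q f'" "0 \<le> m"
      using qpos order_trans[OF divide_nonneg_pos[OF nn(2)[of f] qpos(1)]] by (simp_all add: pos_divide_le_eq)
    have all: "lin v z g \<le> m * lin v q g" for g
    proof -
      define x y where "x = (g $ 1 * f' $ 2 - g $ 2 * f' $ 1) / D" and "y = (f $ 1 * g $ 2 - f $ 2 * g $ 1) / D"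
      have xy: "D * x = g $ 1 * f' $ 2 - g $ 2 * f' $ 1" "D * y = f $ 1 * g $ 2 - f $ 2 * g $ 1"
        using \<open>D \<noteq> 0\<close> unfolding x_def y_def by simp_all
      have "D * g $ i = D * (x * f $ i + y * f' $ i)" if "i = 1 \<or> i = 2" for i
      proof -
        have "D * (x * f $ i + y * f' $ i) = (D * x) * f $ i + (D * y) * f' $ i" by (simp add: algebra_simps)
        then show ?thesis using that unfolding xy unfolding D_def by (auto simp: algebra_simps)
      qed
      then have g: "g = x *s f + y *s f'" using \<open>D \<noteq> 0\<close> by (simp add: vec_eq_iff forall_2)
      have "lin v z g \<le> max (v x * lin v z f) (v y * lin v z f')"
        using lin_add[OF z, of "x *s f" "y *s f'"] unfolding g lin_scale[OF z] .
      also have "\<dots> \<le> max (v x * (m * lin v q f)) (v y * (m * lin v q f'))"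
        using m nonneg by (intro max.mono mult_left_mono)
      also have "\<dots> = m * max (v x * lin v q f) (v y * lin v q f')" using m by (simp add: max_mult_distrib_left mult_ac)
      also have "\<dots> \<le> m * lin v q g" unfolding g using both m by (intro mult_left_mono)
      finally show ?thesis .
    qed
    have "m * lin v q f = lin v z f \<or> m * lin v q f' = lin v z f'" unfolding m_def max_def using qpos by auto
    moreover have False if "m * lin v q f = lin v z f" and d: "in_dir v q f z" for f
    proof -
      obtain g where "lin v z f * lin v q g < lin v z g * lin v q f" using d unfolding in_dir_def by blast
      moreover have "lin v z g * lin v q f \<le> m * lin v q g * lin v q f" using all nn by (intro mult_right_mono)
      ultimately show False using that(1)[symmetric] by (simp add: mult_ac)
    qed
    ultimately show ?thesis using dir by blast
  qed
qed

lemma dilation_le: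
  assumes "p \<in> disc_pts v" "q \<in> disc_pts v" "\<And>f. lin v p f \<le> c * lin v q f"
  shows "dilation v p q \<le> c"
proof -
  obtain f where f: "0 < lin v q f" "lin v p f = dilation v p q * lin v q f" using dilation_props(3)[OF assms(1,2)] by blast
  then show ?thesis using assms(3)[of f] by simp
qed

lemma dilation_submult:
  assumes "p \<in> disc_pts v" "q \<in> disc_pts v" "z \<in> disc_pts v"
  shows "dilation v p z \<le> dilation v p q * dilation v q z"
proof (rule dilation_le[OF assms(1,3)])
  fix f
  have "lin v p f \<le> dilation v p q * lin v q f" using dilation_props assms by auto
  also have "\<dots> \<le> dilation v p q * (dilation v q z * lin v z f)"
    using dilation_props assms by (intro mult_left_mono) (auto simp: less_imp_le)
  finally show "lin v p f \<le> dilation v p q * dilation v q z * lin v z f" by (simp add: mult.assoc)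
qed

text \<open>A form at which the ratio of \<open>q\<close> to \<open>p\<close> is maximal is small at \<open>p\<close>, unless the two norms are proportional.\<close>
lemma in_dir_of_max:
  assumes p: "p \<in> disc_pts v" and q: "q \<in> disc_pts v" and "p \<noteq> q"
    and f: "0 < lin v p f" "lin v q f = dilation v q p * lin v p f"
  shows "in_dir v q f p"
proof (rule ccontr)
  assume "\<not> ?thesis"
  then have le: "lin v p g * lin v q f \<le> lin v p f * lin v q g" for g
    unfolding in_dir_def by (simp add: not_less)
  have pos: "0 < dilation v q p" using dilation_props p q by auto
  have "lin v p g = (1 / dilation v q p) * lin v q g" for g
  proof -
    have "lin v p f * (dilation v q p * lin v p g) \<le> lin v p f * lin v q g"
      using le[of g] f(2) by (simp add: mult_ac)
    then have "dilation v q p * lin v p g \<le> lin v q g" using f(1) by simp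
    moreover have "lin v q g \<le> dilation v q p * lin v p g" using dilation_props p q by auto
    ultimately show ?thesis using pos by (simp add: field_simps)
  qed
  then have "p = q" using disc_pt_eqI[OF p q] pos by (metis zero_less_divide_1_iff)
  then show False using \<open>p \<noteq> q\<close> by simp
qed

lemma direction_exists:
  assumes "p \<in> disc_pts v" "q \<in> disc_pts v" "p \<noteq> q"
  obtains f where "in_dir v q f p"
  using dilation_props(3)[OF assms(2,1)] in_dir_of_max[OF assms] by blast

lemma not_in_dir_max:
  assumes q: "q \<in> disc_pts v" and p: "p \<in> disc_pts v" and "\<not> in_dir v q f p"
  shows "dilation v p q * lin v q f \<le> lin v p f"
proof -
  obtain g where g: "0 < lin v q g" "lin v p g = dilation v p q * lin v q g" using dilation_props(3)[OF p q] by blast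
  have "lin v p g * lin v q f \<le> lin v p f * lin v q g" using assms(3) unfolding in_dir_def by (simp add: not_less)
  then have "(dilation v p q * lin v q f) * lin v q g \<le> lin v p f * lin v q g" using g by (simp add: mult_ac)
  then show ?thesis using g by simp
qed

text \<open>Distances add up exactly if both dilations are multiplicative. A form that is minimal for \<open>p'\<close> relative
  to \<open>q\<close> is maximal for \<open>p\<close> relative to \<open>q\<close> exactly if the directions of \<open>p\<close> and \<open>p'\<close> differ.\<close>
lemma in_dir_iff_not_between:
  assumes p: "p \<in> disc_pts v" and q: "q \<in> disc_pts v" and p': "p' \<in> disc_pts v" and dir: "in_dir v q f p"
  shows "in_dir v q f p' \<longleftrightarrow> hdist v p q + hdist v q p' \<noteq> hdist v p p'"
proof -
  have P: "p \<in> berk_P1 v" "q \<in> berk_P1 v" "p' \<in> berk_P1 v" using p q p' disc_pts_in_P1 by auto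
  have pq: "p \<noteq> q" using dir in_dir_irrefl by auto
  let ?d = "dilation v"
  note pos = dilation_props(1)[OF p q] dilation_props(1)[OF q p] dilation_props(1)[OF q p']
    dilation_props(1)[OF p' q] dilation_props(1)[OF p p'] dilation_props(1)[OF p' p]
  show ?thesis
  proof
    assume dir': "in_dir v q f p'"
    then have pq': "p' \<noteq> q" using in_dir_irrefl by auto
    show "hdist v p q + hdist v q p' \<noteq> hdist v p p'"
    proof
      assume "hdist v p q + hdist v q p' = hdist v p p'"
      then have "ln ((?d p q * ?d q p') * (?d p' q * ?d q p)) = ln (?d p p' * ?d p' p)"
        using pos unfolding hdist_def by (simp add: ln_mult)
      then have prod: "(?d p q * ?d q p') * (?d p' q * ?d q p) = ?d p p' * ?d p' p" using pos by simp
      have "?d p p' = ?d p q * ?d q p'"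
      proof (rule antisym)
        show "?d p p' \<le> ?d p q * ?d q p'" by (rule dilation_submult[OF p q p'])
        have "(?d p q * ?d q p') * ?d p' p \<le> (?d p q * ?d q p') * (?d p' q * ?d q p)"
          using dilation_submult[OF p' q p] pos by (intro mult_left_mono) auto
        then show "?d p q * ?d q p' \<le> ?d p p'" unfolding prod using pos by simp
      qed
      then obtain g where g: "0 < lin v p' g" "lin v p g = ?d p q * ?d q p' * lin v p' g"
        using dilation_props(3)[OF p p'] by auto
      have le: "lin v p g \<le> ?d p q * lin v q g" "lin v q g \<le> ?d q p' * lin v p' g"
        using dilation_props p q p' by auto
      have "?d p q * lin v q g \<le> ?d p q * (?d q p' * lin v p' g)" using le pos by (intro mult_left_mono) auto
      then have eq: "lin v p g = ?d p q * lin v q g" using le g by (simp add: mult.assoc)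
      then have "lin v q g = ?d q p' * lin v p' g" using g pos by (simp add: mult.assoc)
      then have "in_dir v q g p'" using in_dir_of_max[OF p' q pq'] g by blast
      then have "in_dir v q g p" using direction_unique[OF q P(3,1) dir' _ dir] by blast
      then obtain h where "lin v p g * lin v q h < lin v p h * lin v q g" unfolding in_dir_def by blast
      moreover have "lin v p h * lin v q g \<le> (?d p q * lin v q h) * lin v q g"
        using dilation_props(2)[OF p q] lin_nonneg[OF P(2)] by (intro mult_right_mono)
      ultimately show False using eq by (simp add: mult_ac)
    qed
  next
    assume neq: "hdist v p q + hdist v q p' \<noteq> hdist v p p'"
    show "in_dir v q f p'"
    proof (rule ccontr)
      assume nd: "\<not> in_dir v q f p'"
      have pq': "p' \<noteq> q" using neq hdist_self[OF q] by auto
      have "?d p' q * ?d q p \<le> ?d p' p"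
      proof -
        obtain g where g: "0 < lin v p g" "lin v q g = ?d q p * lin v p g" using dilation_props(3)[OF q p] by blast
        have "in_dir v q g p" using in_dir_of_max[OF p q pq g] .
        then have "\<not> in_dir v q g p'" using direction_unique[OF q P(1,3) _ dir] nd by blast
        then have "?d p' q * lin v q g \<le> lin v p' g" by (rule not_in_dir_max[OF q p'])
        also have "\<dots> \<le> ?d p' p * lin v p g" using dilation_props p p' by auto
        finally show ?thesis using g by simp
      qed
      moreover have "?d p q * ?d q p' \<le> ?d p p'"
      proof -
        obtain g where g: "0 < lin v p' g" "lin v q g = ?d q p' * lin v p' g" using dilation_props(3)[OF q p'] by blast
        have "in_dir v q g p'" using in_dir_of_max[OF p' q pq' g] .
        then have "\<not> in_dir v q g p" using direction_unique[OF q P(1,3) _ dir] nd by blast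
        then have "?d p q * lin v q g \<le> lin v p g" by (rule not_in_dir_max[OF q p])
        also have "\<dots> \<le> ?d p p' * lin v p' g" using dilation_props p p' by auto
        finally show ?thesis using g by simp
      qed
      ultimately have "?d p p' = ?d p q * ?d q p'" "?d p' p = ?d p' q * ?d q p"
        using dilation_submult[OF p q p'] dilation_submult[OF p' q p] by auto
      then have "hdist v p p' = ln ((?d p q * ?d q p) * (?d q p' * ?d p' q))" unfolding hdist_def by (simp add: mult_ac)
      also have "\<dots> = hdist v p q + hdist v q p'" using pos unfolding hdist_def by (simp add: ln_mult)
      finally show False using neq by simp
    qed
  qed
qed

text \<open>If \<open>z\<close> is not in the direction of \<open>m'\<close> seen from \<open>m\<close>, then it is, seen from \<open>m'\<close>, in the direction of \<open>m\<close>. This also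
  holds for points \<open>z\<close> that are in no direction at \<open>m\<close>.\<close>
lemma directions_cover:
  assumes m: "m \<in> disc_pts v" and m': "m' \<in> disc_pts v" and z: "z \<in> berk_P1 v"
    and dir: "in_dir v m f m'" "\<not> in_dir v m f z" "in_dir v m' f' m"
  shows "in_dir v m' f' z"
proof -
  have P: "m \<in> berk_P1 v" "m' \<in> berk_P1 v" using m m' disc_pts_in_P1 by auto
  note nn = lin_nonneg[OF P(1)] lin_nonneg[OF P(2)] lin_nonneg[OF z]
  have neq: "m' \<noteq> m" using dir(1) in_dir_irrefl by auto
  have f0: "0 < lin v m f" using lin_disc_pos[OF m] in_dir_nonzero[OF P dir(1)] by auto
  have f'0: "0 < lin v m' f'" "0 < lin v m f'" using lin_disc_pos m m' in_dir_nonzero[OF P(2,1) dir(3)] by auto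
  obtain g where g: "0 < lin v m' g" "lin v m g = dilation v m m' * lin v m' g" using dilation_props(3)[OF m m'] by blast
  have "in_dir v m g m'" using in_dir_of_max[OF m' m neq g] .
  then have ng: "\<not> in_dir v m g z" using direction_unique[OF m P(2) z _ dir(1)] dir(2) by blast
  have mg: "0 < lin v m g" using g dilation_props(1)[OF m m'] by simp
  obtain h where h: "lin v m f' * lin v m' h < lin v m h * lin v m' f'" using dir(3) unfolding in_dir_def by blast
  \<comment> \<open>so \<open>z\<close> attains its maximal ratio to \<open>m\<close> at \<open>g\<close>, where \<open>m\<close> attains its maximal ratio to \<open>m'\<close>\<close>
  have zg: "lin v z h * lin v m g \<le> lin v z g * lin v m h" for h using ng unfolding in_dir_def by (simp add: not_less)
  have zpos: "0 < lin v z g"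
  proof (rule ccontr)
    assume "\<not> ?thesis"
    then have 0: "lin v z g = 0" using nn(3)[of g] by simp
    have all0: "lin v z h = 0" for h using zg[of h] mg nn(3)[of h] unfolding 0 by (simp add: mult_le_0_iff)
    show False
    proof (cases z)
      case Infty then show ?thesis using all0[of "vector [1, 0]"] by (simp add: lin_Infty)
    next
      case (Aff x)
      then have "x \<in> berk_A1 v" using z by simp
      then show ?thesis using all0[of "vector [0, 1]"] Aff seminorm_simps(2)[of x] by (simp add: lin_Aff one_pCons)
    qed
  qed
  have strict: "lin v m f' * lin v m' g < lin v m g * lin v m' f'"
  proof -
    have "lin v m h * lin v m' f' \<le> dilation v m m' * lin v m' h * lin v m' f'"
      using dilation_props(2)[OF m m'] nn by (intro mult_right_mono)
    then have lt: "lin v m f' * lin v m' h < (dilation v m m' * lin v m' f') * lin v m' h" using h by (simp add: mult_ac)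
    then have "lin v m f' < dilation v m m' * lin v m' f'"
      using nn(2)[of h] by (simp add: mult_less_cancel_right)
    then show ?thesis using g by (simp add: mult_ac)
  qed
  have "lin v z f' * lin v m' g < lin v z g * lin v m' f'"
  proof -
    have "(lin v z f' * lin v m g) * lin v m' g \<le> (lin v z g * lin v m f') * lin v m' g"
      using zg[of f'] nn by (intro mult_right_mono)
    also have "\<dots> = lin v z g * (lin v m f' * lin v m' g)" by (simp add: mult_ac)
    also have "\<dots> < lin v z g * (lin v m g * lin v m' f')" using strict zpos by simp
    finally have "lin v m g * (lin v z f' * lin v m' g) < lin v m g * (lin v z g * lin v m' f')" by (simp add: mult_ac)
    then show ?thesis using mg by simp
  qed
  then show ?thesis unfolding in_dir_def by blast
qed

lemma branch_eq_dir_disc: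
  assumes "q \<in> disc_pts v" "p \<in> berk_P1 v" "in_dir v q f p"
  shows "branch v q p = dir_disc v q f"
  unfolding branch_def dir_disc_def using direction_unique[OF assms(1,2)] assms(3) by blast

lemma branch_mem_iff:
  assumes p: "p \<in> disc_pts v" and q: "q \<in> disc_pts v" and p': "p' \<in> disc_pts v" and "p \<noteq> q"
  shows "p' \<in> branch v q p \<longleftrightarrow> hdist v p q + hdist v q p' \<noteq> hdist v p p'"
proof -
  obtain f where f: "in_dir v q f p" using direction_exists[OF p q \<open>p \<noteq> q\<close>] .
  have "branch v q p = dir_disc v q f" using branch_eq_dir_disc[OF q _ f] p disc_pts_in_P1 by auto
  then show ?thesis using in_dir_iff_not_between[OF p q p' f] p' disc_pts_in_P1 unfolding dir_disc_def by auto
qed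

lemma branch_disjoint:
  assumes p: "p \<in> disc_pts v" and q: "q \<in> disc_pts v" and p': "p' \<in> disc_pts v" and "p \<noteq> q" "p' \<noteq> q"
    and between: "hdist v p q + hdist v q p' = hdist v p p'"
  shows "branch v q p \<inter> branch v q p' = {}"
proof -
  have P: "p \<in> berk_P1 v" "p' \<in> berk_P1 v" using p p' disc_pts_in_P1 by auto
  obtain f where f: "in_dir v q f p" using direction_exists[OF p q \<open>p \<noteq> q\<close>] .
  obtain f' where f': "in_dir v q f' p'" using direction_exists[OF p' q \<open>p' \<noteq> q\<close>] .
  have n: "\<not> in_dir v q f p'" using in_dir_iff_not_between[OF p q p' f] between by blast
  have "False" if "z \<in> berk_P1 v" "in_dir v q f z" "in_dir v q f' z" for z
    using direction_unique[OF q that(1) P(2) that(3,2) f'] n by blast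
  then show ?thesis
    unfolding branch_eq_dir_disc[OF q P(1) f] branch_eq_dir_disc[OF q P(2) f'] dir_disc_def by blast
qed

text \<open>In the figure, this is the disjointness of the two complementary closed discs.\<close>
lemma branches_cover:
  assumes p: "p \<in> disc_pts v" and m: "m \<in> disc_pts v" and m': "m' \<in> disc_pts v" and "p \<noteq> m" "p \<noteq> m'"
    and "hdist v p m + hdist v m m' \<noteq> hdist v p m'" and "hdist v p m' + hdist v m' m \<noteq> hdist v p m"
  shows "branch v m p \<union> branch v m' p = berk_P1 v"
proof -
  have P: "p \<in> berk_P1 v" using p disc_pts_in_P1 by auto
  obtain f where f: "in_dir v m f p" using direction_exists[OF p m \<open>p \<noteq> m\<close>] .
  obtain f' where f': "in_dir v m' f' p" using direction_exists[OF p m' \<open>p \<noteq> m'\<close>] .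
  have "in_dir v m f m'" "in_dir v m' f' m"
    using in_dir_iff_not_between[OF p m m' f] in_dir_iff_not_between[OF p m' m f'] assms by auto
  then show ?thesis
    unfolding branch_eq_dir_disc[OF m P f] branch_eq_dir_disc[OF m' P f'] dir_disc_def
    using directions_cover[OF m m'] by blast
qed

lemma in_dir_moebius:
  assumes q: "q \<in> berk_P1 v" and z: "z \<in> berk_P1 v" and M: "invertible M"
  shows "in_dir v (moebius v M q) f (moebius v M z) \<longleftrightarrow> in_dir v q (f v* M) z"
proof -
  obtain k where k: "0 < k" "\<And>f. k * lin v (moebius v M q) f = lin v q (f v* M)"
    using lin_moebius[OF q M] by blast
  obtain l where l: "0 < l" "\<And>f. l * lin v (moebius v M z) f = lin v z (f v* M)"
    using lin_moebius[OF z M] by blast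
  obtain M' where MM: "M ** M' = mat 1" "M' ** M = mat 1" using M unfolding invertible_def by blast
  have "in_dir v q (f v* M) z \<longleftrightarrow> (\<exists>g. lin v z (f v* M) * lin v q (g v* M) < lin v z (g v* M) * lin v q (f v* M))"
    unfolding in_dir_def
  proof
    assume "\<exists>g. lin v z (f v* M) * lin v q g < lin v z g * lin v q (f v* M)"
    then obtain g where g: "lin v z (f v* M) * lin v q g < lin v z g * lin v q (f v* M)" by blast
    have "(g v* M') v* M = g" by (simp add: vector_matrix_mul_assoc MM vector_matrix_mul_rid)
    then show "\<exists>g. lin v z (f v* M) * lin v q (g v* M) < lin v z (g v* M) * lin v q (f v* M)" using g by metis
  qed blast
  also have "\<dots> \<longleftrightarrow> (\<exists>g. (l * k) * (lin v (moebius v M z) f * lin v (moebius v M q) g)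
      < (l * k) * (lin v (moebius v M z) g * lin v (moebius v M q) f))"
    unfolding k(2)[symmetric] l(2)[symmetric] by (simp add: mult_ac)
  also have "\<dots> \<longleftrightarrow> in_dir v (moebius v M q) f (moebius v M z)" using k l unfolding in_dir_def by simp
  finally show ?thesis by blast
qed

lemma moebius_image:
  assumes M: "invertible M" and S: "S \<subseteq> berk_P1 v" and T: "T \<subseteq> berk_P1 v"
    and iff: "\<And>z. z \<in> berk_P1 v \<Longrightarrow> moebius v M z \<in> T \<longleftrightarrow> z \<in> S"
  shows "moebius v M ` S = T"
proof
  show "moebius v M ` S \<subseteq> T" using iff S by blast
  obtain M' where MM: "M ** M' = mat 1" "M' ** M = mat 1" using M unfolding invertible_def by blast
  then have M': "invertible M'" unfolding invertible_def by blast
  show "T \<subseteq> moebius v M ` S"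
  proof
    fix t assume t: "t \<in> T"
    then have tP: "t \<in> berk_P1 v" using T by auto
    have "moebius v M (moebius v M' t) = t" using moebius_comp[OF tP M M'] moebius_one[OF tP] MM by simp
    moreover have "moebius v M' t \<in> berk_P1 v" using moebius_form_val(1)[OF tP M'] .
    ultimately show "t \<in> moebius v M ` S" using iff t by (metis imageI)
  qed
qed

lemma moebius_dir_disc:
  assumes "q \<in> berk_P1 v" "invertible M"
  shows "moebius v M ` dir_disc v q (f v* M) = dir_disc v (moebius v M q) f"
  by (rule moebius_image[OF assms(2)])
    (use assms in_dir_moebius moebius_form_val(1) in \<open>auto simp: dir_disc_def\<close>)

lemma moebius_compl_dir_disc:
  assumes "q \<in> berk_P1 v" "invertible M"
  shows "moebius v M ` (berk_P1 v - dir_disc v q (f v* M)) = berk_P1 v - dir_disc v (moebius v M q) f"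
  by (rule moebius_image[OF assms(2)])
    (use assms in_dir_moebius moebius_form_val(1) in \<open>auto simp: dir_disc_def\<close>)

lemma moebius_branch:
  assumes q: "q \<in> disc_pts v" and p: "p \<in> disc_pts v" and M: "invertible M" and "p \<noteq> q"
  shows "moebius v M ` branch v q p = branch v (moebius v M q) (moebius v M p)"
proof -
  have P: "p \<in> berk_P1 v" "q \<in> berk_P1 v" using p q disc_pts_in_P1 by auto
  obtain f where f: "in_dir v q f p" using direction_exists[OF p q \<open>p \<noteq> q\<close>] .
  obtain M' where MM: "M ** M' = mat 1" "M' ** M = mat 1" using M unfolding invertible_def by blast
  define g where "g = f v* M'"
  have g: "g v* M = f" unfolding g_def by (simp add: vector_matrix_mul_assoc MM vector_matrix_mul_rid)
  have "in_dir v (moebius v M q) g (moebius v M p)" using in_dir_moebius[OF P(2,1) M, of g] f g by simp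
  then have "branch v (moebius v M q) (moebius v M p) = dir_disc v (moebius v M q) g"
    using branch_eq_dir_disc moebius_disc_pts[OF q M] moebius_form_val(1)[OF P(1) M] by blast
  then show ?thesis
    using branch_eq_dir_disc[OF q P(1) f] moebius_dir_disc[OF P(2) M, of g] g by simp
qed

lemma in_dir_disc_pt:
  assumes z: "z \<in> berk_P1 v" and r: "0 < r"
  shows "in_dir v (disc_pt v a r) (vector [1, - a]) z \<longleftrightarrow> lin v z (vector [1, - a]) < r * lin v z (vector [0, 1])"
    and "in_dir v (disc_pt v a r) (vector [0, 1]) z \<longleftrightarrow> r * lin v z (vector [0, 1]) < lin v z (vector [1, - a])"
proof -
  let ?q = "disc_pt v a r" and ?c = "vector [1, - a] :: 'a ^ 2" and ?o = "vector [0, 1] :: 'a ^ 2"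
  note nn = lin_nonneg[OF z]
  have q: "lin v ?q ?c = r" "lin v ?q ?o = 1" using r by (simp_all add: lin_disc_pt)
  have g: "lin v z g \<le> max (v (g $ 1) * lin v z ?c) (v (g $ 1 * a + g $ 2) * lin v z ?o)" for g
  proof -
    have "g = g $ 1 *s ?c + (g $ 1 * a + g $ 2) *s ?o" by (simp add: vec_eq_iff forall_2)
    then have "lin v z g = lin v z (g $ 1 *s ?c + (g $ 1 * a + g $ 2) *s ?o)" by simp
    also have "\<dots> \<le> max (lin v z (g $ 1 *s ?c)) (lin v z ((g $ 1 * a + g $ 2) *s ?o))" by (rule lin_add[OF z])
    finally show ?thesis by (simp only: lin_scale[OF z])
  qed
  show "in_dir v ?q ?c z \<longleftrightarrow> lin v z ?c < r * lin v z ?o"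
  proof
    assume "lin v z ?c < r * lin v z ?o"
    then show "in_dir v ?q ?c z" unfolding in_dir_def using q by (intro exI[of _ ?o]) (simp add: mult.commute)
  next
    assume "in_dir v ?q ?c z"
    then obtain g where gd: "lin v z ?c * lin v ?q g < lin v z g * r" unfolding in_dir_def q by blast
    show "lin v z ?c < r * lin v z ?o"
    proof (rule ccontr)
      assume "\<not> ?thesis"
      then have le: "r * lin v z ?o \<le> lin v z ?c" by simp
      have "lin v z g * r \<le> max (v (g $ 1) * lin v z ?c) (v (g $ 1 * a + g $ 2) * lin v z ?o) * r"
        using g r by (intro mult_right_mono) auto
      also have "\<dots> = max (lin v z ?c * (v (g $ 1) * r)) (v (g $ 1 * a + g $ 2) * (r * lin v z ?o))"
        using r by (simp add: max_mult_distrib_right max_mult_distrib_left mult_ac)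
      also have "\<dots> \<le> max (lin v z ?c * (v (g $ 1) * r)) (v (g $ 1 * a + g $ 2) * lin v z ?c)"
        using le nonneg nn by (intro max.mono mult_left_mono) auto
      also have "\<dots> = lin v z ?c * lin v ?q g" using nn r by (simp add: lin_disc_pt max_mult_distrib_left mult_ac)
      finally show False using gd by simp
    qed
  qed
  show "in_dir v ?q ?o z \<longleftrightarrow> r * lin v z ?o < lin v z ?c"
  proof
    assume "r * lin v z ?o < lin v z ?c"
    then show "in_dir v ?q ?o z" unfolding in_dir_def using q by (intro exI[of _ ?c]) (simp add: mult.commute)
  next
    assume "in_dir v ?q ?o z"
    then obtain g where gd: "lin v z ?o * lin v ?q g < lin v z g * 1" unfolding in_dir_def q by blast
    show "r * lin v z ?o < lin v z ?c"
    proof (rule ccontr)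
      assume "\<not> ?thesis"
      then have le: "lin v z ?c \<le> r * lin v z ?o" by simp
      have "lin v z g \<le> max (v (g $ 1) * lin v z ?c) (v (g $ 1 * a + g $ 2) * lin v z ?o)" by (rule g)
      also have "\<dots> \<le> max (v (g $ 1) * (r * lin v z ?o)) (v (g $ 1 * a + g $ 2) * lin v z ?o)"
        using le nonneg by (intro max.mono mult_left_mono) auto
      also have "\<dots> = lin v z ?o * lin v ?q g" using nn r by (simp add: lin_disc_pt max_mult_distrib_left mult_ac)
      finally show False using gd by simp
    qed
  qed
qed

lemma open_disc_A1_eq: assumes "0 < r" shows "open_disc_A1 v a r = dir_disc v (disc_pt v a r) (vector [1, - a])"
  unfolding open_disc_A1_def dir_disc_def berk_P1_eq
  using in_dir_disc_pt(1)[OF _ assms]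
  by (auto simp: lin_Aff lin_Infty seminorm_simps(2) simp flip: one_pCons)

lemma closed_disc_A1_eq: assumes "0 < r" shows "closed_disc_A1 v a r = berk_P1 v - dir_disc v (disc_pt v a r) (vector [0, 1])"
  unfolding closed_disc_A1_def dir_disc_def berk_P1_eq
  using in_dir_disc_pt(2)[OF _ assms]
  by (auto simp: lin_Aff lin_Infty seminorm_simps(2) simp flip: one_pCons)

lemma dir_disc_scale:
  assumes "q \<in> berk_P1 v" "c \<noteq> 0" shows "dir_disc v q (c *s f) = dir_disc v q f"
proof -
  have "in_dir v q (c *s f) z \<longleftrightarrow> in_dir v q f z" if z: "z \<in> berk_P1 v" for z
  proof -
    have "v c * lin v z f * lin v q g < lin v z g * (v c * lin v q f) \<longleftrightarrow> lin v z f * lin v q g < lin v z g * lin v q f" for g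
    proof -
      have "v c * lin v z f * lin v q g < lin v z g * (v c * lin v q f) \<longleftrightarrow>
         v c * (lin v z f * lin v q g) < v c * (lin v z g * lin v q f)" by (simp add: mult_ac)
      then show ?thesis using abs_pos[OF assms(2)] by simp
    qed
    then show ?thesis unfolding in_dir_def lin_scale[OF assms(1)] lin_scale[OF z] by blast
  qed
  then show ?thesis unfolding dir_disc_def by auto
qed

lemma dir_disc_cases:
  assumes q: "q \<in> disc_pts v" and f: "f \<noteq> 0"
  obtains (centre) a r where "0 < r" "q = disc_pt v a r" "dir_disc v q f = dir_disc v q (vector [1, - a])"
    | (infinity) a r where "0 < r" "q = disc_pt v a r" "dir_disc v q f = dir_disc v q (vector [0, 1])"
proof -
  obtain b s where qb: "q = disc_pt v b s" "0 < s" using q unfolding disc_pts_def by auto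
  have qP: "q \<in> berk_P1 v" using q disc_pts_in_P1 by auto
  show thesis
  proof (cases "v (f $ 1 * b + f $ 2) \<le> v (f $ 1) * s")
    case True
    have f1: "f $ 1 \<noteq> 0"
    proof
      assume 0: "f $ 1 = 0"
      then have "v (f $ 2) = 0" using True nonneg[of "f $ 2"] by simp
      then show False using f 0 eq_0_iff by (auto simp: vec_eq_iff forall_2)
    qed
    define a where "a = - f $ 2 / f $ 1"
    have "f $ 1 * (b - a) = f $ 1 * b + f $ 2" using f1 unfolding a_def by (simp add: field_simps)
    then have "v (f $ 1) * v (b - a) \<le> v (f $ 1) * s" using True by (simp flip: mult)
    then have "v (b - a) \<le> s" using abs_pos[OF f1] by simp
    then have "q = disc_pt v a s" using disc_pt_center[OF qb(2)] qb by simp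
    moreover have "f = f $ 1 *s vector [1, - a]" using f1 unfolding a_def by (simp add: vec_eq_iff forall_2)
    then have "dir_disc v q f = dir_disc v q (vector [1, - a])" using dir_disc_scale[OF qP f1] by metis
    ultimately show thesis using centre qb by blast
  next
    case False
    have 1: "in_dir v q (vector [0, 1]) Infty" using in_dir_disc_pt(2)[of Infty s b] qb by (simp add: lin_Infty)
    have 2: "in_dir v q f Infty" unfolding in_dir_def
      using False qb by (intro exI[of _ "vector [1, - b]"]) (simp add: lin_disc_pt lin_Infty)
    have "dir_disc v q f = dir_disc v q (vector [0, 1])"
      unfolding dir_disc_def using direction_unique[OF q _ _ 1 2] direction_unique[OF q _ _ 2 1] by auto
    then show thesis using infinity qb by blast
  qed
qed

text \<open>The map \<open>T \<mapsto> b + 1/T\<close> exchanges discs around \<open>0\<close> with complements of discs around \<open>b\<close>.\<close>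
lemma inversion_disc_pt:
  fixes b :: 'a and s :: real
  assumes s: "0 < s"
  defines "M \<equiv> (vector [vector [b, 1], vector [1, 0]] :: 'a ^ 2 ^ 2)"
  shows "invertible M" and "moebius v M (disc_pt v 0 (1 / s)) = disc_pt v b s"
    and "vector [0, 1] v* M = vector [1, 0]" and "vector [1, - b] v* M = vector [0, 1]"
proof -
  show M: "invertible M" unfolding M_def by (simp add: invertible_2)
  show "vector [0, 1] v* M = vector [1, 0]" "vector [1, - b] v* M = vector [0, 1]"
    unfolding M_def by (simp_all add: vec_eq_iff forall_2 vector_matrix_mult_def sum_2)
  let ?q = "disc_pt v 0 (1 / s)"
  have q: "?q \<in> disc_pts v" "disc_pt v b s \<in> disc_pts v" using s disc_pt_mem by auto
  then have qP: "?q \<in> berk_P1 v" using disc_pts_in_P1 by auto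
  obtain k where k: "0 < k" "\<And>f. k * lin v (moebius v M ?q) f = lin v ?q (f v* M)"
    using lin_moebius[OF qP M] by blast
  have "lin v ?q (f v* M) = (1 / s) * lin v (disc_pt v b s) f" for f
    using s unfolding M_def by (simp add: lin_disc_pt vector_matrix_mult_def sum_2 max_mult_distrib_left
        max_divide_distrib_right max.commute)
  moreover have "lin v (moebius v M ?q) f = lin v ?q (f v* M) / k" for f
    using k(1) k(2)[of f] by (simp add: field_simps)
  ultimately have "lin v (moebius v M ?q) f = 1 / (s * k) * lin v (disc_pt v b s) f" for f by simp
  then show "moebius v M ?q = disc_pt v b s"
    using disc_pt_eqI[OF moebius_disc_pts[OF q(1) M] q(2), of "1 / (s * k)"] k s by simp
qed

text \<open>The disc in a direction is either an affine disc around a centre in \<open>k\<close> or the complement of one,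
  and an inversion makes the latter affine.\<close>
lemma dir_disc_is_disc:
  assumes q: "q \<in> disc_pts v" and f: "f \<noteq> 0"
  shows "\<exists>M a r. invertible M \<and> 0 < r \<and> dir_disc v q f = moebius v M ` open_disc_A1 v a r"
    and "\<exists>M a r. invertible M \<and> 0 < r \<and> berk_P1 v - dir_disc v q f = moebius v M ` closed_disc_A1 v a r"
proof -
  have id: "moebius v (mat 1) ` S = S" if "S \<subseteq> berk_P1 v" for S
    using that moebius_one by (force simp: image_def)
  have inv1: "invertible (mat 1 :: 'a ^ 2 ^ 2)" by (simp add: invertible_2 mat_def)
  have sub: "dir_disc v q f \<subseteq> berk_P1 v" for q f unfolding dir_disc_def by auto
  from q f show "\<exists>M a r. invertible M \<and> 0 < r \<and> dir_disc v q f = moebius v M ` open_disc_A1 v a r"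
  proof (cases rule: dir_disc_cases)
    case (centre a r)
    then show ?thesis using id[OF sub] open_disc_A1_eq inv1 by metis
  next
    case (infinity a r)
    note J = inversion_disc_pt[OF infinity(1), of a]
    have P: "disc_pt v 0 (1 / r) \<in> berk_P1 v" using infinity disc_pt_in by simp
    show ?thesis using moebius_dir_disc[OF P J(1), of "vector [0, 1]"] J infinity open_disc_A1_eq[of "1 / r" 0]
      by (metis minus_zero zero_less_divide_1_iff)
  qed
  from q f show "\<exists>M a r. invertible M \<and> 0 < r \<and> berk_P1 v - dir_disc v q f = moebius v M ` closed_disc_A1 v a r"
  proof (cases rule: dir_disc_cases)
    case (infinity a r)
    then show ?thesis using id[of "berk_P1 v - dir_disc v q f"] closed_disc_A1_eq inv1 by (metis Diff_subset)
  next
    case (centre a r)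
    note J = inversion_disc_pt[OF centre(1), of a]
    have P: "disc_pt v 0 (1 / r) \<in> berk_P1 v" using centre disc_pt_in by simp
    show ?thesis using moebius_compl_dir_disc[OF P J(1), of "vector [1, - a]"] J centre closed_disc_A1_eq[of "1 / r" 0]
      by (metis zero_less_divide_1_iff)
  qed
qed

lemma moebius_open_disc:
  assumes M: "invertible M" and r: "0 < r"
  obtains q f where "q \<in> disc_pts v" "moebius v M ` open_disc_A1 v a r = dir_disc v q f"
proof -
  obtain M' where MM: "M ** M' = mat 1" "M' ** M = mat 1" using M unfolding invertible_def by blast
  define g where "g = vector [1, - a] v* M'"
  have g: "g v* M = vector [1, - a]" unfolding g_def by (simp add: vector_matrix_mul_assoc MM vector_matrix_mul_rid)
  have q: "disc_pt v a r \<in> disc_pts v" using r by (rule disc_pt_mem)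
  show thesis
    using that[OF moebius_disc_pts[OF q M]] moebius_dir_disc[OF disc_pt_in[OF r] M, of a g] g open_disc_A1_eq[OF r] by metis
qed

text \<open>A disc \<open>D\<close> in some direction at \<open>q\<^sub>2\<close> that contains the branch of \<open>p'\<close> and misses the branch of \<open>p\<close> must be
  attached at \<open>q\<close>: otherwise the midpoint \<open>z\<close> of \<open>q\<close> and \<open>q\<^sub>2\<close> is in the branch of \<open>p\<close> or \<open>p'\<close>, and membership of \<open>z\<close> in
  \<open>D\<close> contradicts the position of \<open>q\<^sub>2\<close>.\<close>
lemma maximal_dir_disc:
  assumes p: "p \<in> disc_pts v" and q: "q \<in> disc_pts v" and p': "p' \<in> disc_pts v" and "p \<noteq> q" "p' \<noteq> q"
    and between: "hdist v p q + hdist v q p' = hdist v p p'"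
    and q2: "q2 \<in> disc_pts v" and lower: "branch v q p' \<subseteq> dir_disc v q2 f2"
    and upper: "dir_disc v q2 f2 \<subseteq> berk_P1 v - branch v q p"
  shows "dir_disc v q2 f2 = branch v q p'"
proof -
  interpret tree_metric "disc_pts v" "hdist v" by (rule disc_pts_tree)
  have P: "p \<in> berk_P1 v" "q \<in> berk_P1 v" "p' \<in> berk_P1 v" using p q p' disc_pts_in_P1 by auto
  have mem: "y \<in> branch v q x \<longleftrightarrow> q \<notin> seg x y" if "x \<in> disc_pts v" "y \<in> disc_pts v" "x \<noteq> q" for x y
    using branch_mem_iff[OF that(1) q that(2,3)] q unfolding seg_def by auto
  have mem2: "y \<in> dir_disc v q2 f2 \<longleftrightarrow> q2 \<notin> seg x y"
    if "x \<in> disc_pts v" "y \<in> disc_pts v" "x \<in> dir_disc v q2 f2" for x y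
    using in_dir_iff_not_between[OF that(1) q2 that(2)] that(3) q2 that(2) disc_pts_in_P1
    unfolding seg_def dir_disc_def by auto
  have own: "x \<in> branch v q x" if "x \<in> disc_pts v" "x \<noteq> q" for x
    using mem[OF that(1,1,2)] seg_self[OF that(1)] that(2) by auto
  have p'D: "p' \<in> dir_disc v q2 f2" using own[OF p' \<open>p' \<noteq> q\<close>] lower by auto
  have pD: "p \<notin> dir_disc v q2 f2" using own[OF p \<open>p \<noteq> q\<close>] upper by auto
  have "q2 = q"
  proof (rule ccontr)
    assume neq: "q2 \<noteq> q"
    define z where "z = mid q q2"
    have z: "z \<in> seg q q2" "z \<noteq> q" "z \<noteq> q2" using mid_props[OF q q2] mid_neq[OF q q2] neq unfolding z_def by auto
    have zD: "z \<in> disc_pts v" using z seg_in by blast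
    have same_branch: "z \<in> branch v q x" if x: "x \<in> disc_pts v" "x \<noteq> q" "q2 \<in> seg q x" for x
    proof -
      have "z \<in> seg q x" using seg_order(1)[OF x(3) z(1) q x(1)] .
      then have "z \<in> seg x q" using seg_commute[OF q x(1)] by simp
      then have "q \<notin> seg x z" using seg_antisym[of z x q] x z by auto
      then show ?thesis using mem[OF x(1) zD x(2)] by simp
    qed
    show False
    proof (cases "q \<in> dir_disc v q2 f2")
      case True
      have "q2 \<in> seg q p" using mem2[OF q p True] pD by simp
      then have "z \<in> branch v q p" using same_branch p \<open>p \<noteq> q\<close> by blast
      then have "z \<notin> dir_disc v q2 f2" using upper by blast
      then have "q2 \<in> seg q z" using mem2[OF q zD True] by simp
      then show False using seg_antisym[OF _ z(1) q] z by auto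
    next
      case False
      then have "q2 \<in> seg p' q" using mem2[OF p' q p'D] by simp
      then have q2: "q2 \<in> seg q p'" using seg_commute[OF q p'] by simp
      then have "z \<in> dir_disc v q2 f2" using same_branch p' \<open>p' \<noteq> q\<close> lower by blast
      then have "q2 \<notin> seg p' z" using mem2[OF p' zD p'D] by simp
      moreover have "q2 \<in> seg z p'" using seg_order(2)[OF q2 z(1) q p'] .
      ultimately show False using seg_commute[OF zD p'] by simp
    qed
  qed
  then have "in_dir v q f2 p'" using p'D unfolding dir_disc_def by simp
  then show ?thesis using branch_eq_dir_disc[OF q P(3)] \<open>q2 = q\<close> by simp
qed

end

section \<open>Disc points and connectedness\<close>

context nonarch_abs
begin

lemma chart_infty_eq: "chart_infty y = moebius v (vector [vector [0, 1], vector [1, 0]]) (Aff y)"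
  by (simp add: chart_infty_def one_pCons)

lemma continuous_map_eval: "continuous_map (berk_A1_top v) euclideanreal (\<lambda>x. x P)"
  unfolding continuous_map_def
proof (intro conjI allI impI)
  fix W :: "real set" assume "openin euclidean W"
  then have "{x \<in> berk_A1 v. x P \<in> W} \<in> {{x \<in> berk_A1 v. x P \<in> W} | P W. open W}" by auto
  then show "openin (berk_A1_top v) {x \<in> topspace (berk_A1_top v). x P \<in> W}"
    unfolding topspace_berk_A1_top unfolding berk_A1_top_def by (rule topology_generated_by_Basis)
qed simp

lemma openin_eval_less: "openin (berk_A1_top v) {x \<in> berk_A1 v. x P < c * x Q}"
proof -
  have "continuous_map (berk_A1_top v) euclideanreal (\<lambda>x. c * x Q - x P)"
    by (intro continuous_map_diff continuous_map_real_mult_left continuous_map_eval)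
  then have "openin (berk_A1_top v) {x \<in> topspace (berk_A1_top v). c * x Q - x P \<in> {0<..}}"
    by (rule openin_continuous_map_preimage) auto
  then show ?thesis by simp
qed

text \<open>Inequalities between forms of the same degree are independent of the chart, since the
  second chart is the action of a matrix.\<close>
lemma openin_form_val_less:
  assumes "degree P \<le> n" "degree Q \<le> n"
  shows "openin (berk_P1_top v) {z \<in> berk_P1 v. form_val v z n P < c * form_val v z n Q}"
proof -
  let ?S = "{z \<in> berk_P1 v. form_val v z n P < c * form_val v z n Q}"
  let ?J = "vector [vector [0, 1], vector [1, 0]] :: 'a ^ 2 ^ 2"
  have J: "invertible ?J" by (simp add: invertible_2)
  have "chart_infty y \<in> ?S \<longleftrightarrow> y (hom_subst n P (mnum ?J) (mden ?J)) < c * y (hom_subst n Q (mnum ?J) (mden ?J))"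
    if y: "y \<in> berk_A1 v" for y
  proof -
    have yP: "Aff y \<in> berk_P1 v" using y by simp
    obtain k where k: "k > 0" "\<And>n P. degree P \<le> n \<Longrightarrow>
       k ^ n * form_val v (chart_infty y) n P = y (hom_subst n P (mnum ?J) (mden ?J))"
      using moebius_form_val(2)[OF yP J] unfolding chart_infty_eq[symmetric] by auto
    have "chart_infty y \<in> berk_P1 v" using moebius_form_val(1)[OF yP J] unfolding chart_infty_eq .
    then have "chart_infty y \<in> ?S \<longleftrightarrow>
       k ^ n * form_val v (chart_infty y) n P < k ^ n * (c * form_val v (chart_infty y) n Q)"
      using k by simp
    also have "k ^ n * (c * form_val v (chart_infty y) n Q) = c * (k ^ n * form_val v (chart_infty y) n Q)" by simp
    finally show ?thesis unfolding k(2)[OF assms(1)] k(2)[OF assms(2)] .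
  qed
  then have "{y \<in> berk_A1 v. chart_infty y \<in> ?S}
      = {y \<in> berk_A1 v. y (hom_subst n P (mnum ?J) (mden ?J)) < c * y (hom_subst n Q (mnum ?J) (mden ?J))}" by blast
  moreover have "{x \<in> berk_A1 v. Aff x \<in> ?S} = {x \<in> berk_A1 v. x P < c * x Q}" by auto
  ultimately show ?thesis
    unfolding openin_berk_P1_top berk_P1_open_def using openin_eval_less by auto
qed

lemma eta_const: "eta v a r [:b:] = v b"
  by (simp add: eta_def gauss_const)

lemma eta_shift: "0 < r \<Longrightarrow> eta v a r [:- a, 1:] = r"
  using eta_linear[of r a "- a" 1] by simp

lemma linear_factor_times_synthetic_div:
  fixes P :: "'a poly"
  shows "[:- a, 1:] * synthetic_div P a = P + [:- poly P a:]"
proof -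
  have "[:- a, 1:] * synthetic_div P a = [:- a, 1:] * synthetic_div P a + [:poly P a:] + [:- poly P a:]" by simp
  then show ?thesis by (simp only: synthetic_div_correct')
qed

lemma eta_synthetic_le:
  assumes r: "0 < r"
  shows "r * eta v a r (synthetic_div P a) \<le> max (eta v a r P) (v (poly P a))"
proof -
  have "r * eta v a r (synthetic_div P a) = eta v a r ([:- a, 1:] * synthetic_div P a)"
    by (simp only: berk_A1D(3)[OF eta_in[OF r]] eta_shift[OF r])
  also have "[:- a, 1:] * synthetic_div P a = P + [:- poly P a:]" by (rule linear_factor_times_synthetic_div)
  also have "eta v a r (P + [:- poly P a:]) \<le> max (eta v a r P) (v (poly P a))"
    using seminorm_ultrametric[OF eta_in[OF r]] eta_const[of a r "- poly P a"] by (metis abs_minus)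
  finally show ?thesis .
qed

text \<open>If the constant term at \<open>a\<close> attains the Gauss norm of \<open>Q\<close>, then \<open>Q\<close> has constant absolute value on the open disc around \<open>a\<close>.\<close>
lemma seminorm_near_centre:
  assumes x: "x \<in> berk_A1 v" and r: "0 < r" and near: "x [:- a, 1:] < r" and Q: "eta v a r Q = v (poly Q a)"
  shows "v (poly Q a) \<le> x Q"
proof (rule ccontr)
  assume "\<not> ?thesis"
  then have lt: "x Q < v (poly Q a)" by simp
  let ?S = "synthetic_div Q a"
  note xs = berk_A1D[OF x] seminorm_simps[OF x]
  have pos: "0 < v (poly Q a)" using lt xs(1)[of Q] by linarith
  have S: "r * eta v a r ?S \<le> v (poly Q a)" using eta_synthetic_le[OF r, of a Q] Q by simp
  have "x ([:- a, 1:] * ?S) < v (poly Q a)"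
  proof (cases "eta v a r ?S = 0")
    case True
    then have "x ?S \<le> 0" using seminorm_le_eta[OF x, of r a ?S] r near by simp
    then have "x ?S = 0" using xs(1)[of ?S] by simp
    then show ?thesis using pos by (simp only: xs(3) mult_zero_right)
  next
    case False
    then have ep: "0 < eta v a r ?S" using berk_A1D(1)[OF eta_in[OF r]] by (metis order_le_less)
    have "x [:- a, 1:] * x ?S \<le> x [:- a, 1:] * eta v a r ?S"
      using seminorm_le_eta[OF x, of r a ?S] r near xs(1) by (intro mult_left_mono) auto
    also have "\<dots> < r * eta v a r ?S" using near ep by simp
    finally show ?thesis using S unfolding xs(3) by (rule less_le_trans)
  qed
  moreover have "[:poly Q a:] = Q + - ([:- a, 1:] * ?S)"
    unfolding linear_factor_times_synthetic_div by simp
  then have "v (poly Q a) = x (Q + - ([:- a, 1:] * ?S))" using xs(4) by metis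
  then have "v (poly Q a) \<le> max (x Q) (x ([:- a, 1:] * ?S))"
    using seminorm_ultrametric[OF x, of Q "- ([:- a, 1:] * ?S)"] by (simp only: xs(9))
  ultimately show False using lt by simp
qed

text \<open>If the constant term of \<open>P\<close> at \<open>a\<close> is too small to attain the Gauss norm, it can be subtracted and a factor
  \<open>T - a\<close> divided out, which preserves that \<open>x\<close> is below the disc point.\<close>
lemma seminorm_drop_witness:
  assumes x: "x \<in> berk_A1 v" and r: "0 < r" and on: "x [:- a, 1:] = r" and drop: "x P < eta v a r P"
  shows "\<exists>Q. eta v a r Q = v (poly Q a) \<and> x Q < v (poly Q a)"
  using drop
proof (induction "degree P" arbitrary: P rule: less_induct)
  case less
  note xs = berk_A1D[OF x] seminorm_simps[OF x]
  have le: "v (poly P a) \<le> eta v a r P"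
  proof -
    have "v (coeff (P \<circ>\<^sub>p [:a, 1:]) 0) * r ^ 0 \<le> gauss v r (P \<circ>\<^sub>p [:a, 1:])" using r by (intro gauss_ge) simp
    moreover have "coeff (P \<circ>\<^sub>p [:a, 1:]) 0 = poly P a"
      by (simp add: poly_0_coeff_0[symmetric] poly_pcompose)
    ultimately show ?thesis unfolding eta_def by simp
  qed
  show ?case
  proof (cases "eta v a r P = v (poly P a)")
    case True then show ?thesis using less.prems by auto
  next
    case False
    then have lt: "v (poly P a) < eta v a r P" using le by simp
    let ?S = "synthetic_div P a"
    have P: "P = [:- a, 1:] * ?S + [:poly P a:]" using synthetic_div_correct'[of a P] by simp
    have deg: "degree P \<noteq> 0"
    proof
      assume "degree P = 0"
      then obtain c where "P = [:c:]" by (rule degree_eq_zeroE)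
      then show False using lt by (simp add: eta_const)
    qed
    have "eta v a r P \<le> max (r * eta v a r ?S) (v (poly P a))"
      using seminorm_ultrametric[OF eta_in[OF r, of a], of "[:- a, 1:] * ?S" "[:poly P a:]"]
      unfolding P[symmetric] berk_A1D(3,4)[OF eta_in[OF r, of a]] eta_shift[OF r] .
    then have 1: "eta v a r P \<le> r * eta v a r ?S" using lt by simp
    have "x ([:- a, 1:] * ?S) \<le> max (x P) (v (poly P a))"
    proof -
      show ?thesis using seminorm_ultrametric[OF x, of P "[:- poly P a:]"]
        unfolding linear_factor_times_synthetic_div xs(4) abs_minus .
    qed
    then have "r * x ?S \<le> max (x P) (v (poly P a))" by (simp only: xs(3) on)
    then have "r * x ?S < eta v a r P" using less.prems lt by simp
    then have "r * x ?S < r * eta v a r ?S" using 1 by simp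
    then have "x ?S < eta v a r ?S" using r by simp
    then show ?thesis using less.hyps[of ?S] degree_synthetic_div[of P a] deg by simp
  qed
qed

text \<open>The open disc of radius \<open>r\<close> around \<open>a\<close>, cut out by forms of degree one so that \<open>openin_form_val_less\<close> applies.\<close>
definition near :: "'a \<Rightarrow> real \<Rightarrow> 'a berk_pt set" where
  "near a r = {z \<in> berk_P1 v. form_val v z 1 [:- a, 1:] < r * form_val v z 1 1}"

lemma Aff_near: "x \<in> berk_A1 v \<Longrightarrow> Aff x \<in> near a r \<longleftrightarrow> x [:- a, 1:] < r"
  by (simp add: near_def seminorm_simps)

lemma Infty_near: "Infty \<notin> near a r"
  by (simp add: near_def)

lemma disc_pt_near: "0 < s \<Longrightarrow> disc_pt v b s \<in> near a r \<longleftrightarrow> max s (v (a - b)) < r"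
  unfolding disc_pt_def using Aff_near[OF eta_in] eta_linear[of s b "- a" 1] abs_minus_commute[of a b] by simp

lemma openin_near: "openin (berk_P1_top v) (near a r)"
  unfolding near_def by (rule openin_form_val_less) simp_all

text \<open>A point on the boundary circle other than the disc point takes on some polynomial a value below
  the Gauss norm, and by \<open>seminorm_drop_witness\<close> one can take a polynomial whose constant term attains the Gauss norm. By
  \<open>seminorm_near_centre\<close> the set where that polynomial is small is an open set disjoint from the open disc.\<close>
lemma disc_pt_separates:
  assumes r: "0 < r"
  obtains W where "openin (berk_P1_top v) W" "near a r \<inter> W = {}" "disc_pt v a r \<notin> W"
    "berk_P1 v \<subseteq> insert (disc_pt v a r) (near a r \<union> W)"
proof -
  define far where "far = {z \<in> berk_P1 v. form_val v z 1 1 < (1 / r) * form_val v z 1 [:- a, 1:]}"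
  define low where "low Q = {z \<in> berk_P1 v. form_val v z (degree Q) Q < 1 * form_val v z (degree Q) [:poly Q a:]}" for Q
  define \<Q> where "\<Q> = {Q. eta v a r Q = v (poly Q a)}"
  define W where "W = far \<union> (\<Union>Q\<in>\<Q>. low Q)"
  have farA: "Aff x \<in> far \<longleftrightarrow> r < x [:- a, 1:]" if "x \<in> berk_A1 v" for x
    using that r by (simp add: far_def seminorm_simps field_simps)
  have farI: "Infty \<in> far" using r by (simp add: far_def)
  have lowA: "Aff x \<in> low Q \<longleftrightarrow> x Q < v (poly Q a)" if "x \<in> berk_A1 v" for x Q
    using that by (simp add: low_def berk_A1D(4))
  show thesis
  proof
    have "openin (berk_P1_top v) far" unfolding far_def by (rule openin_form_val_less) simp_all
    moreover have "openin (berk_P1_top v) (low Q)" for Q unfolding low_def by (rule openin_form_val_less) simp_all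
    ultimately show "openin (berk_P1_top v) W" unfolding W_def by (intro openin_Un openin_Union) auto
    show "near a r \<inter> W = {}"
    proof (rule ccontr)
      assume "near a r \<inter> W \<noteq> {}"
      then obtain z where z: "z \<in> near a r" "z \<in> W" by blast
      then obtain x where x: "z = Aff x" "x \<in> berk_A1 v"
        using Infty_near by (cases z) (auto simp: near_def)
      have nx: "x [:- a, 1:] < r" using z x Aff_near by simp
      then have "z \<notin> far" using farA x by simp
      then obtain Q where "Q \<in> \<Q>" "z \<in> low Q" using z unfolding W_def by blast
      then have "eta v a r Q = v (poly Q a)" "x Q < v (poly Q a)" using lowA[OF x(2)] x(1) unfolding \<Q>_def by simp_all
      then show False using seminorm_near_centre[OF x(2) r nx, of Q] by simp
    qed
    show "disc_pt v a r \<notin> W"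
      unfolding W_def disc_pt_def using farA[OF eta_in[OF r]] lowA[OF eta_in[OF r]] eta_shift[OF r]
      by (auto simp: \<Q>_def)
    show "berk_P1 v \<subseteq> insert (disc_pt v a r) (near a r \<union> W)"
    proof
      fix z assume zP: "z \<in> berk_P1 v"
      show "z \<in> insert (disc_pt v a r) (near a r \<union> W)"
      proof (cases z)
        case Infty then show ?thesis using farI unfolding W_def by simp
      next
        case (Aff x)
        then have x: "x \<in> berk_A1 v" using zP by simp
        consider "x [:- a, 1:] < r" | "r < x [:- a, 1:]" | "x [:- a, 1:] = r" by linarith
        then show ?thesis
        proof cases
          case 1 then show ?thesis using Aff_near[OF x] Aff by simp
        next
          case 2 then show ?thesis using farA[OF x] Aff unfolding W_def by simp
        next
          case 3
          show ?thesis
          proof (cases "x = eta v a r")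
            case True then show ?thesis using Aff by (simp add: disc_pt_def)
          next
            case False
            then obtain P where "x P \<noteq> eta v a r P" by blast
            then have "x P < eta v a r P" using seminorm_le_eta[OF x, of r a P] 3 r by simp
            then obtain Q where "Q \<in> \<Q>" "x Q < v (poly Q a)"
              using seminorm_drop_witness[OF x r 3] unfolding \<Q>_def by blast
            then show ?thesis using lowA[OF x] Aff unfolding W_def by blast
          qed
        qed
      qed
    qed
  qed
qed

lemma connected_near_dichotomy:
  assumes U: "connectedin (berk_P1_top v) U" and r: "0 < r" and "disc_pt v a r \<notin> U"
  shows "U \<subseteq> near a r \<or> U \<inter> near a r = {}"
proof (rule ccontr)
  assume n: "\<not> ?thesis"
  obtain W where W: "openin (berk_P1_top v) W" "near a r \<inter> W = {}" "disc_pt v a r \<notin> W"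
    "berk_P1 v \<subseteq> insert (disc_pt v a r) (near a r \<union> W)"
    by (rule disc_pt_separates[OF r])
  have "U \<subseteq> berk_P1 v" using connectedin_subset_topspace[OF U] by simp
  then have "U \<subseteq> near a r \<union> W" using W(4) assms(3) by blast
  moreover have "near a r \<inter> W \<inter> U = {}" "near a r \<inter> U \<noteq> {}" "W \<inter> U \<noteq> {}" using W(2) n calculation by blast+
  ultimately show False using connectedinD[OF U openin_near W(1)] by blast
qed

text \<open>The disc point \<open>\<eta>(a, t)\<close> separates the two given points unless it is one of them.\<close>
lemma connected_disc_convex:
  assumes U: "connectedin (berk_P1_top v) U" and p: "disc_pt v a r \<in> U" and q: "disc_pt v b s \<in> U"
    and r: "0 < r" and s: "0 < s" and t: "r \<le> t" "t \<le> join_radius v a r b s"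
  shows "disc_pt v a t \<in> U"
proof (cases "t = r")
  case False
  then have rt: "r < t" using t by simp
  show ?thesis
  proof (rule ccontr)
    assume n: "disc_pt v a t \<notin> U"
    have "disc_pt v a r \<in> near a t" using rt r by (simp add: disc_pt_near)
    moreover have "disc_pt v b s \<notin> near a t"
      using rt t s by (auto simp: disc_pt_near join_radius_def)
    ultimately show False using connected_near_dichotomy[OF U _ n] p q rt r by auto
  qed
qed (use p in simp)

lemma continuous_gauss: "continuous_on {0..} (\<lambda>r. gauss v r Q)"
proof (induction Q rule: pCons_induct)
  case 0
  then show ?case using gauss_const[of _ 0] by simp
next
  case (pCons c Q)
  have "continuous_on {0..} (\<lambda>r. max (v c) (r * gauss v r Q))"
    using pCons by (intro continuous_intros)
  then show ?case by (rule continuous_on_eq) (simp add: gauss_pCons)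
qed

lemma compactin_path:
  assumes r: "0 < r"
  shows "compactin (berk_P1_top v) (disc_pt v a ` {r..R})"
proof (rule image_compactin)
  let ?T = "top_of_set {r..R}"
  show "compactin ?T {r..R}" by (simp add: compactin_subtopology)
  have A: "continuous_map ?T (berk_A1_top v) (eta v a)"
    unfolding berk_A1_top_def
  proof (rule continuous_on_generated_topo)
    fix V assume "V \<in> {{x \<in> berk_A1 v. x P \<in> W} | P W. open W}"
    then obtain P W where V: "V = {x \<in> berk_A1 v. x P \<in> W}" "open W" by blast
    have "continuous_on {r..R} (\<lambda>t. eta v a t P)"
      unfolding eta_def using continuous_gauss by (rule continuous_on_subset) (use r in auto)
    then have "openin ?T ({r..R} \<inter> (\<lambda>t. eta v a t P) -` W)"
      using V(2) by (rule continuous_openin_preimage_gen)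
    moreover have "eta v a -` V \<inter> topspace ?T = {r..R} \<inter> (\<lambda>t. eta v a t P) -` W"
      using r eta_in unfolding V by auto
    ultimately show "openin ?T (eta v a -` V \<inter> topspace ?T)" by simp
  next
    have "berk_A1 v \<in> {{x \<in> berk_A1 v. x P \<in> W} | P W. open W}"
      by (rule CollectI, rule exI[of _ 0], rule exI[of _ UNIV]) auto
    moreover have "eta v a ` topspace ?T \<subseteq> berk_A1 v" using r eta_in by auto
    ultimately show "eta v a ` topspace ?T \<subseteq> \<Union>{{x \<in> berk_A1 v. x P \<in> W} | P W. open W}" by blast
  qed
  show "continuous_map ?T (berk_P1_top v) (disc_pt v a)"
    unfolding continuous_map_def
  proof (intro conjI allI impI)
    show "disc_pt v a \<in> topspace ?T \<rightarrow> topspace (berk_P1_top v)" using r disc_pt_in by auto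
    fix V assume "openin (berk_P1_top v) V"
    then have "openin (berk_A1_top v) {x \<in> berk_A1 v. Aff x \<in> V}"
      unfolding openin_berk_P1_top berk_P1_open_def by simp
    then have "openin ?T {t \<in> topspace ?T. eta v a t \<in> {x \<in> berk_A1 v. Aff x \<in> V}}"
      by (rule openin_continuous_map_preimage[OF A])
    moreover have "{t \<in> topspace ?T. eta v a t \<in> {x \<in> berk_A1 v. Aff x \<in> V}} = {t \<in> topspace ?T. disc_pt v a t \<in> V}"
      using r eta_in unfolding disc_pt_def by auto
    ultimately show "openin ?T {t \<in> topspace ?T. disc_pt v a t \<in> V}" by simp
  qed
qed

text \<open>If a linear form vanishes at \<open>z\<close>, then \<open>z\<close> is evaluation at a point of the projective line over \<open>k\<close>, the zero of that form.\<close>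
lemma rational_point_unique:
  assumes z: "z \<in> berk_P1 v" and w: "w \<in> berk_P1 v" and eq: "lin v z = lin v w" and f: "f \<noteq> 0" "lin v z f = 0"
  shows "z = w"
proof (cases z)
  case Infty
  then have "lin v w (vector [0, 1]) = 0" using eq by (metis lin_Infty vector_2(1) abs_0)
  moreover have "lin v w (vector [0, 1]) = 1" if "w = Aff y" for y
    using that w seminorm_simps(2)[of y] by (simp add: lin_Aff one_pCons)
  ultimately show ?thesis using Infty by (cases w) auto
next
  case (Aff x)
  then have x: "x \<in> berk_A1 v" using z by simp
  have "lin v z (vector [0, 1]) = 1" using Aff seminorm_simps(2)[OF x] by (simp add: lin_Aff one_pCons)
  then have wA: "lin v w (vector [0, 1]) = 1" using eq by simp
  then obtain y where y: "w = Aff y" by (cases w) (auto simp: lin_Infty)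
  then have yA: "y \<in> berk_A1 v" using w by simp
  have f1: "f $ 1 \<noteq> 0"
  proof
    assume 0: "f $ 1 = 0"
    then have "v (f $ 2) = 0" using f(2) Aff berk_A1D(4)[OF x] by (simp add: lin_Aff)
    then show False using 0 f(1) eq_0_iff by (auto simp: vec_eq_iff forall_2)
  qed
  define a where "a = - f $ 2 / f $ 1"
  have fa: "f = f $ 1 *s vector [1, - a]" using f1 unfolding a_def by (simp add: vec_eq_iff forall_2)
  have "v (f $ 1) * lin v z (vector [1, - a]) = 0" using f(2) fa lin_scale[OF z] by metis
  then have z0: "lin v z (vector [1, - a]) = 0" using abs_pos[OF f1] by simp
  have val: "u P = v (poly P a)" if u: "u \<in> berk_A1 v" "u [:- a, 1:] = 0" for u P
  proof -
    have "u ([:poly P a:] + [:- a, 1:] * synthetic_div P a) = u [:poly P a:]"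
      by (rule seminorm_add_null[OF u(1)]) (simp only: berk_A1D(3)[OF u(1)] u(2) mult_zero_left)
    then show ?thesis using synthetic_div_correct'[of a P] berk_A1D(4)[OF u(1)] by (simp add: add.commute)
  qed
  have "lin v w (vector [1, - a]) = 0" using z0 eq by simp
  then have "x [:- a, 1:] = 0" "y [:- a, 1:] = 0" using z0 Aff y by (simp_all add: lin_Aff)
  then have "x P = y P" for P using val[OF x, of P] val[OF yA, of P] by simp
  then have "x = y" by blast
  then show ?thesis using Aff y by simp
qed

text \<open>A connected set without disc points is on one side of each of them, so every disc with centre in \<open>k\<close>
  contains all of its points or none; these discs determine the values on linear forms.\<close>
lemma lin_eq_of_no_disc_pt:
  assumes U: "connectedin (berk_P1_top v) U" and none: "\<And>a r. 0 < r \<Longrightarrow> disc_pt v a r \<notin> U"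
    and z: "z \<in> U" and w: "w \<in> U"
  shows "lin v z = lin v w"
proof -
  have P: "z \<in> berk_P1 v" "w \<in> berk_P1 v" using connectedin_subset_topspace[OF U] z w by auto
  have same: "z \<in> near a r \<longleftrightarrow> w \<in> near a r" if "0 < r" for a r
    using connected_near_dichotomy[OF U that none[OF that]] z w by blast
  have nearI: "Aff x \<in> near 0 (x [:0, 1:] + 1)" "0 < x [:0, 1:] + 1" if "x \<in> berk_A1 v" for x
    using Aff_near[OF that, of 0] berk_A1D(1)[OF that, of "[:0, 1:]"] by auto
  show ?thesis
  proof (cases z)
    case Infty
    then have "w = Infty" using nearI same Infty_near P by (cases w) auto
    then show ?thesis using Infty by simp
  next
    case (Aff x)
    then have x: "x \<in> berk_A1 v" using P by simp
    then obtain y where y: "w = Aff y" using nearI[OF x] same Infty_near Aff by (cases w) auto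
    then have yA: "y \<in> berk_A1 v" using P by simp
    have key: "u [:- a, 1:] \<le> u' [:- a, 1:]"
      if "u \<in> berk_A1 v" "u' \<in> berk_A1 v" "\<And>r. 0 < r \<Longrightarrow> u' [:- a, 1:] < r \<Longrightarrow> u [:- a, 1:] < r" for u u' a
    proof (rule field_le_epsilon)
      fix e :: real assume "0 < e"
      then show "u [:- a, 1:] \<le> u' [:- a, 1:] + e"
        using that(3)[of "u' [:- a, 1:] + e"] berk_A1D(1)[OF that(2), of "[:- a, 1:]"] by auto
    qed
    have eq: "x [:- a, 1:] = y [:- a, 1:]" for a
      using key[OF x yA, of a] key[OF yA x, of a] same[of _ a] Aff_near[OF x] Aff_near[OF yA] Aff y by force
    show ?thesis
    proof
      fix f
      show "lin v z f = lin v w f"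
      proof (cases "f $ 1 = 0")
        case True then show ?thesis using Aff y berk_A1D(4)[OF x] berk_A1D(4)[OF yA] by (simp add: lin_Aff)
      next
        case False
        have "[:f $ 2, f $ 1:] = smult (f $ 1) [:- (- f $ 2 / f $ 1), 1:]" using False by simp
        then have "x [:f $ 2, f $ 1:] = y [:f $ 2, f $ 1:]"
          using seminorm_simps(3)[OF x] seminorm_simps(3)[OF yA] eq by metis
        then show ?thesis using Aff y by (simp add: lin_Aff)
      qed
    qed
  qed
qed

text \<open>Otherwise \<open>M\<close> scales the seminorm of \<open>z\<close> on linear forms by one constant \<open>k\<close>. It scales two eigenvectors by different
  factors, so the seminorm vanishes at one of them, and \<open>z\<close> is determined by its values on linear forms.\<close>
lemma connected_invariant_has_disc_pt:
  assumes U: "connectedin (berk_P1_top v) U" and z: "z \<in> U" and Mz: "moebius v M z \<in> U" "moebius v M z \<noteq> z"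
    and M: "invertible M" and eig: "f \<noteq> 0" "f v* M = c *s f" "f' \<noteq> 0" "f' v* M = c' *s f'" "v c \<noteq> v c'"
  shows "\<exists>a r. 0 < r \<and> disc_pt v a r \<in> U"
proof (rule ccontr)
  assume "\<not> ?thesis"
  then have eq: "lin v (moebius v M z) = lin v z" using lin_eq_of_no_disc_pt[OF U _ Mz(1) z] by blast
  have zP: "z \<in> berk_P1 v" using connectedin_subset_topspace[OF U] z by auto
  obtain k where k: "0 < k" "\<And>f. k * lin v (moebius v M z) f = lin v z (f v* M)"
    using lin_moebius[OF zP M] by blast
  have "(k - v c) * lin v z f = 0" "(k - v c') * lin v z f' = 0"
    using k(2)[of f] k(2)[of f'] eig lin_scale[OF zP] eq by (simp_all add: algebra_simps)
  then have "lin v z f = 0 \<or> lin v z f' = 0" using eig(5) by auto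
  then have "z = moebius v M z"
    using rational_point_unique[OF zP moebius_form_val(1)[OF zP M] eq[symmetric]] eig by blast
  then show False using Mz by simp
qed

section \<open>Eigenvectors of loxodromic matrices\<close>

lemma row_eigenvector:
  fixes M :: "'a ^ 2 ^ 2"
  assumes root: "c * c - (M $ 1 $ 1 + M $ 2 $ 2) * c + (M $ 1 $ 1 * M $ 2 $ 2 - M $ 1 $ 2 * M $ 2 $ 1) = 0"
  shows "\<exists>f. f \<noteq> 0 \<and> f v* M = c *s f"
proof -
  let ?a = "M $ 1 $ 1" and ?b = "M $ 1 $ 2" and ?c = "M $ 2 $ 1" and ?d = "M $ 2 $ 2"
  have prod: "(c - ?a) * (c - ?d) = ?b * ?c" using root by (simp add: algebra_simps)
  have eigI: "\<exists>f. f \<noteq> 0 \<and> f v* M = c *s f"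
    if "x \<noteq> 0 \<or> y \<noteq> 0" "x * ?a + y * ?c = c * x" "x * ?b + y * ?d = c * y" for x y
  proof (intro exI conjI)
    show "(vector [x, y] :: 'a ^ 2) \<noteq> 0" using that(1) by (auto simp: vec_eq_iff forall_2)
    show "vector [x, y] v* M = c *s vector [x, y]"
      using that(2,3) by (simp add: vec_eq_iff forall_2 vector_matrix_mult_def sum_2)
  qed
  consider "?c \<noteq> 0" | "?c = 0" "?b \<noteq> 0" | "?c = 0" "?b = 0" by blast
  then show ?thesis
  proof cases
    case 1
    then show ?thesis using prod by (intro eigI[of ?c "c - ?a"]) (auto simp: algebra_simps)
  next
    case 2
    then show ?thesis using prod by (intro eigI[of "c - ?d" ?b]) (auto simp: algebra_simps)
  next
    case 3
    then have "c = ?a \<or> c = ?d" using prod by auto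
    then show ?thesis using eigI[of 1 0] eigI[of 0 1] 3 by auto
  qed
qed

end

text \<open>Iterating \<open>x \<mapsto> t - d/x\<close> from \<open>t\<close> is a contraction on the points of absolute value \<open>|t|\<close> with ratio \<open>|d|/|t|\<^sup>2\<close>.\<close>
lemma (in complete_nonarch_field) dominant_root:
  assumes lt: "v d < v t ^ 2"
  shows "\<exists>x. x * x - t * x + d = 0 \<and> v x = v t"
proof -
  define T where "T = v t"
  have T: "0 < T" using lt nonneg[of d] nonneg[of t] unfolding T_def by (metis less_le power_zero_numeral not_less order_le_less)
  define q where "q = v d / T ^ 2"
  have q: "0 \<le> q" "q < 1" using lt T nonneg unfolding q_def T_def by auto
  define x where "x = rec_nat t (\<lambda>_ y. t - d / y)"
  have x0: "x 0 = t" and xS: "x (Suc n) = t - d / x n" for n unfolding x_def by simp_all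
  have xT: "v (x n) = T" for n
  proof (induction n)
    case 0 then show ?case by (simp add: x0 T_def)
  next
    case (Suc n)
    have "v (- (d / x n)) = v d / T" using Suc by (simp add: abs_divide)
    also have "\<dots> < v t" using lt T unfolding T_def by (simp add: power2_eq_square field_simps)
    finally show ?case using abs_add_eq[of "- (d / x n)" t] by (simp add: xS T_def)
  qed
  have xn0: "x n \<noteq> 0" for n using xT[of n] T by auto
  have diff: "v (x (Suc n) - x n) \<le> T * q ^ n" for n
  proof (induction n)
    case 0
    have "v (x (Suc 0) - x 0) \<le> max (v (x (Suc 0))) (v (x 0))" by (rule abs_diff)
    then show ?case using xT by simp
  next
    case (Suc n)
    have "x (Suc (Suc n)) - x (Suc n) = d * (x (Suc n) - x n) / (x n * x (Suc n))"
    proof -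
      have "x (Suc (Suc n)) - x (Suc n) = (t - d / x (Suc n)) - (t - d / x n)"
        by (rule arg_cong2[OF xS xS])
      then have "x (Suc (Suc n)) - x (Suc n) = d / x n - d / x (Suc n)" by simp
      then show ?thesis using xn0[of n] xn0[of "Suc n"] by (simp add: field_simps)
    qed
    then have "v (x (Suc (Suc n)) - x (Suc n)) = q * v (x (Suc n) - x n)"
      by (simp add: abs_divide mult xT q_def power2_eq_square)
    also have "\<dots> \<le> q * (T * q ^ n)" using Suc q by (intro mult_left_mono)
    finally show ?case by (simp add: mult_ac)
  qed
  have far: "v (x (n + k) - x n) \<le> T * q ^ n" for n k
  proof (induction k)
    case 0 then show ?case using T q by simp
  next
    case (Suc k)
    have "v (x (n + Suc k) - x n) \<le> max (v (x (Suc (n + k)) - x (n + k))) (v (x (n + k) - x n))"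
      using ultrametric[of "x (Suc (n + k)) - x (n + k)" "x (n + k) - x n"] by simp
    moreover have "T * q ^ (n + k) \<le> T * q ^ n" using q T by (simp add: power_add mult_left_le power_le_one)
    ultimately show ?case using diff[of "n + k"] Suc by simp
  qed
  interpret MS: Metric_space UNIV "\<lambda>a b. v (a - b)"
  proof
    fix a b c :: 'a
    show "0 \<le> v (a - b)" by (rule nonneg)
    show "v (a - b) = v (b - a)" by (rule abs_minus_commute)
    show "v (a - b) = 0 \<longleftrightarrow> a = b" by (simp add: eq_0_iff)
    show "v (a - c) \<le> v (a - b) + v (b - c)"
      using ultrametric[of "a - b" "b - c"] nonneg[of "a - b"] nonneg[of "b - c"] by auto
  qed
  have small: "\<exists>N. \<forall>n\<ge>N. T * q ^ n < e" if "0 < e" for e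
  proof -
    have "(\<lambda>n. T * q ^ n) \<longlonglongrightarrow> T * 0" using q by (intro tendsto_mult_left LIMSEQ_realpow_zero)
    then have "\<forall>\<^sub>F n in sequentially. T * q ^ n < e" using that by (intro order_tendstoD) auto
    then show ?thesis by (simp add: eventually_sequentially)
  qed
  have "MS.MCauchy x"
    unfolding MS.MCauchy_def
  proof (intro conjI allI impI)
    fix e :: real assume e: "0 < e"
    obtain N where N: "\<And>n. n \<ge> N \<Longrightarrow> T * q ^ n < e" using small[OF e] by blast
    have "v (x n - x n') < e" if "N \<le> n" "N \<le> n'" for n n'
    proof (cases "n \<le> n'")
      case True
      then have "v (x n' - x n) \<le> T * q ^ n" using far[of n "n' - n"] by simp
      then show ?thesis using N[OF that(1)] abs_minus_commute[of "x n"] by simp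
    next
      case False
      then have "v (x n - x n') \<le> T * q ^ n'" using far[of n' "n - n'"] by simp
      then show ?thesis using N[OF that(2)] by simp
    qed
    then show "\<exists>N. \<forall>n n'. N \<le> n \<longrightarrow> N \<le> n' \<longrightarrow> v (x n - x n') < e" by blast
  qed simp
  then obtain l where "limitin MS.mtopology x l sequentially" using complete unfolding MS.mcomplete_def by blast
  then have lim: "\<exists>N. \<forall>n\<ge>N. v (x n - l) < e" if "0 < e" for e
    using that unfolding MS.limitin_metric eventually_sequentially by auto
  obtain N where "v (x N - l) < T" using lim[OF T] by blast
  then have lT: "v l = T" using abs_add_eq[of "l - x N" "x N"] xT abs_minus_commute[of l] by simp
  have "v (l * l - t * l + d) \<le> e" if e: "0 < e" for e
  proof -
    obtain N where N: "\<And>n. n \<ge> N \<Longrightarrow> v (x n - l) < e / T" using lim[of "e / T"] e T by auto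
    have b: "v (l - x n) \<le> e / T" if "n \<ge> N" for n using N[OF that] abs_minus_commute[of l] by simp
    have "x (Suc N) * x N = t * x N - d" using xn0[of N] by (simp add: xS field_simps)
    then have "l * l - t * l + d = (l * (l - x (Suc N)) + x (Suc N) * (l - x N)) + (- t) * (l - x N)"
      by (simp add: algebra_simps)
    also have "v \<dots> \<le> e"
    proof (intro order_trans[OF ultrametric] max.boundedI)
      show "v (l * (l - x (Suc N))) \<le> e" "v (x (Suc N) * (l - x N)) \<le> e" "v (- t * (l - x N)) \<le> e"
        unfolding mult lT xT abs_minus T_def[symmetric] using b[of N] b[of "Suc N"] T by (simp_all add: field_simps)
    qed
    finally show ?thesis .
  qed
  then have "v (l * l - t * l + d) \<le> 0" by (rule field_le_epsilon[of _ 0, simplified])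
  then have "l * l - t * l + d = 0" using nonneg[of "l * l - t * l + d"] eq_0_iff by simp
  then show ?thesis using lT T_def by blast
qed

text \<open>If the eigenvalues in the algebraic closure have different absolute values, the larger value is that of
  the trace \<open>t\<close>, so that \<open>|d| < |t|\<^sup>2\<close> for the determinant \<open>d\<close>, and the characteristic polynomial splits over \<open>k\<close>.
  Row vectors appear because matrices act on linear forms from the right.\<close>
lemma (in complete_nonarch_field) loxodromic_row_eigenvectors:
  fixes M :: "'a ^ 2 ^ 2"
  assumes w: "extends_to_alg_closure v w" and lox: "loxodromic_matrix w M"
  shows "\<exists>f f' c c'. f \<noteq> 0 \<and> f v* M = c *s f \<and> f' \<noteq> 0 \<and> f' v* M = c' *s f' \<and> v c \<noteq> v c'"
proof -
  interpret W: nonarch_abs w using w unfolding extends_to_alg_closure_def by blast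
  have wv: "w (to_ac a) = v a" for a using w unfolding extends_to_alg_closure_def by blast
  define t d where "t = M $ 1 $ 1 + M $ 2 $ 2" and "d = M $ 1 $ 1 * M $ 2 $ 2 - M $ 1 $ 2 * M $ 2 $ 1"
  have root: "l * l - to_ac t * l + to_ac d = 0" if ev: "eigenvalue_ac M l" for l
  proof -
    obtain u where u: "u \<noteq> 0" "map_matrix to_ac M *v u = l *s u" using ev unfolding eigenvalue_ac_def by blast
    let ?m = "\<lambda>i j. to_ac (M $ i $ j)"
    have e: "?m 1 1 * u $ 1 + ?m 1 2 * u $ 2 = l * u $ 1" "?m 2 1 * u $ 1 + ?m 2 2 * u $ 2 = l * u $ 2"
      using u(2) by (simp_all add: vec_eq_iff forall_2 matrix_vector_mult_def sum_2 map_matrix_def)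
    define F where "F = (?m 1 1 - l) * (?m 2 2 - l) - ?m 1 2 * ?m 2 1"
    have a: "(?m 1 1 - l) * u $ 1 = - (?m 1 2 * u $ 2)" and b: "(?m 2 2 - l) * u $ 2 = - (?m 2 1 * u $ 1)"
      using e by (simp_all add: algebra_simps)
    have "F * u $ 1 = (?m 2 2 - l) * ((?m 1 1 - l) * u $ 1) - ?m 1 2 * (?m 2 1 * u $ 1)"
      unfolding F_def by (simp add: algebra_simps)
    also have "\<dots> = - (?m 1 2 * ((?m 2 2 - l) * u $ 2)) - ?m 1 2 * (?m 2 1 * u $ 1)" unfolding a by (simp add: algebra_simps)
    also have "\<dots> = 0" unfolding b by simp
    finally have 1: "F * u $ 1 = 0" .
    have "F * u $ 2 = (?m 1 1 - l) * ((?m 2 2 - l) * u $ 2) - ?m 2 1 * (?m 1 2 * u $ 2)"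
      unfolding F_def by (simp add: algebra_simps)
    also have "\<dots> = - (?m 2 1 * ((?m 1 1 - l) * u $ 1)) - ?m 2 1 * (?m 1 2 * u $ 2)" unfolding b by (simp add: algebra_simps)
    also have "\<dots> = 0" unfolding a by simp
    finally have 2: "F * u $ 2 = 0" .
    have "F = 0" using 1 2 u(1) by (auto simp: vec_eq_iff forall_2)
    then show ?thesis unfolding F_def t_def d_def by (simp add: algebra_simps)
  qed
  obtain l0 l0' where l0: "eigenvalue_ac M l0" "eigenvalue_ac M l0'" "w l0 \<noteq> w l0'"
    using lox unfolding loxodromic_matrix_def by blast
  obtain l l' where l: "eigenvalue_ac M l" "eigenvalue_ac M l'" "w l' < w l"
    using l0 by (metis linorder_neqE)
  note r = root[OF l(1)] root[OF l(2)]
  have "(l - l') * (l + l' - to_ac t) = (l * l - to_ac t * l + to_ac d) - (l' * l' - to_ac t * l' + to_ac d)"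
    by (simp add: algebra_simps)
  also have "\<dots> = 0" unfolding r by simp
  finally have "(l - l') * (l + l' - to_ac t) = 0" .
  moreover have "l \<noteq> l'" using l by auto
  ultimately have sum: "to_ac t = l + l'" by simp
  then have prod: "to_ac d = l * l'" using r(1) by (simp add: algebra_simps)
  have vt: "v t = w l" using wv[of t] W.abs_add_eq[OF l(3)] sum by simp
  have vd: "v d = w l * w l'" using wv[of d] W.mult prod by simp
  have lpos: "0 < w l" using l(3) W.nonneg[of l'] by simp
  have lt: "v d < v t ^ 2" unfolding vt vd power2_eq_square using l(3) lpos by simp
  obtain c where c: "c * c - t * c + d = 0" "v c = v t" using dominant_root[OF lt] by blast
  define c' where "c' = t - c"
  have c': "c' * c' - t * c' + d = 0" using c(1) unfolding c'_def by (simp add: algebra_simps)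
  have "c * c' = d" using c(1) unfolding c'_def by (simp add: algebra_simps)
  then have "v c * v c' = v d" using mult by metis
  then have "w l * v c' = w l * w l'" using c(2) vt vd by simp
  then have "v c' = w l'" using lpos by simp
  then have "v c \<noteq> v c'" using c(2) vt l(3) by simp
  then show ?thesis using row_eigenvector[of c M] row_eigenvector[of c' M] c(1) c' unfolding t_def d_def by blast
qed

section \<open>Ping-pong\<close>

lemma word_value_Nil [simp]: "word_value G \<gamma> [] = \<one>\<^bsub>G\<^esub>"
  by (simp add: word_value_def)

lemma word_value_Cons [simp]: "word_value G \<gamma> ((i, e) # ws) = (\<gamma> i [^]\<^bsub>G\<^esub> e) \<otimes>\<^bsub>G\<^esub> word_value G \<gamma> ws"
  by (simp add: word_value_def)

lemma reduced_words_Cons: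
  "(i, e) # ws \<in> reduced_words I \<longleftrightarrow> i \<in> I \<and> e \<in> {1, -1} \<and> ws \<in> reduced_words I \<and>
     (ws = [] \<or> hd ws \<noteq> (i, - e))"
proof -
  have "(case hd ws of (j, d) \<Rightarrow> \<not> (i = j \<and> d = - e)) \<longleftrightarrow> hd ws \<noteq> (i, - e)"
    by (cases "hd ws") auto
  then show ?thesis unfolding reduced_words_def by (auto simp: successively_Cons split: prod.splits)
qed

text \<open>A reduced word that starts with the letter \<open>(i, e)\<close> moves \<open>p\<close> into \<open>D i e\<close>, so the value of a word
  determines its first letter, and by cancellation the whole word.\<close>
lemma (in group) ping_pong_free_basis:
  fixes act :: "'a \<Rightarrow> 'x \<Rightarrow> 'x" and D :: "'i \<Rightarrow> int \<Rightarrow> 'x set"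
  assumes \<gamma>: "\<gamma> ` I \<subseteq> carrier G" and gen: "generate G (\<gamma> ` I) = carrier G"
    and act_closed: "\<And>g z. \<lbrakk>g \<in> carrier G; z \<in> P\<rbrakk> \<Longrightarrow> act g z \<in> P"
    and act_mult: "\<And>g h z. \<lbrakk>g \<in> carrier G; h \<in> carrier G; z \<in> P\<rbrakk> \<Longrightarrow> act (g \<otimes> h) z = act g (act h z)"
    and act_one: "\<And>z. z \<in> P \<Longrightarrow> act \<one> z = z"
    and disj: "disjoint_family_on (\<lambda>(i, e). D i e) (I \<times> {1, -1})"
    and p: "p \<in> P" "\<And>i e. \<lbrakk>i \<in> I; e \<in> {1, -1}\<rbrakk> \<Longrightarrow> p \<notin> D i e"
    and pong: "\<And>i e z. \<lbrakk>i \<in> I; e \<in> {1, -1}; z \<in> P; z \<notin> D i (- e)\<rbrakk> \<Longrightarrow> act (\<gamma> i [^] e) z \<in> D i e"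
  shows "free_basis G I \<gamma>"
proof -
  let ?W = "word_value G \<gamma>"
  have pow: "\<gamma> i [^] e \<in> carrier G" if "i \<in> I" for i and e :: int using \<gamma> that by auto
  have closed: "?W ws \<in> carrier G" if "ws \<in> reduced_words I" for ws
    using that
  proof (induction ws)
    case (Cons l ws) then show ?case using pow by (cases l) (auto simp: reduced_words_Cons)
  qed simp
  have disjD: "D i e \<inter> D j d = {}"
    if "i \<in> I" "e \<in> {1, -1}" "j \<in> I" "d \<in> {1, -1}" "(i, e) \<noteq> (j, d)" for i e j d
    using disjoint_family_onD[OF disj, of "(i, e)" "(j, d)"] that by simp
  have cancel: "\<gamma> i [^] e \<otimes> (\<gamma> i [^] (- e) \<otimes> x) = x" if "i \<in> I" "x \<in> carrier G" for i x and e :: int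
  proof -
    have "\<gamma> i [^] e \<otimes> \<gamma> i [^] (- e) = \<one>" using \<gamma> that by (simp add: int_pow_neg image_subset_iff)
    then show ?thesis using that pow by (simp flip: m_assoc)
  qed
  have first: "act (?W ((i, e) # ws)) p \<in> D i e" if "(i, e) # ws \<in> reduced_words I" for i e ws
    using that
  proof (induction ws arbitrary: i e)
    case Nil
    then have ie: "i \<in> I" "e \<in> {1, -1}" by (simp_all add: reduced_words_Cons)
    then have "p \<notin> D i (- e)" using p by auto
    then have "act (\<gamma> i [^] e) p \<in> D i e" by (rule pong[OF ie p(1)])
    then show ?case by (simp only: word_value_Cons word_value_Nil r_one[OF pow[OF ie(1)]])
  next
    case (Cons l ws)
    obtain j d where l: "l = (j, d)" by (cases l)
    have red: "i \<in> I" "e \<in> {1, -1}" "(j, d) # ws \<in> reduced_words I" "(j, d) \<noteq> (i, - e)"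
      using Cons.prems unfolding l by (simp_all add: reduced_words_Cons[of i e])
    have jd: "j \<in> I" "d \<in> {1, -1}" using red(3) by (simp_all add: reduced_words_Cons)
    let ?z = "act (?W ((j, d) # ws)) p"
    have z: "?z \<in> D j d" by (rule Cons.IH[OF red(3)])
    have zP: "?z \<in> P" using act_closed closed[OF red(3)] p by blast
    have "- e \<in> {1, -1}" using red(2) by auto
    then have "D j d \<inter> D i (- e) = {}" by (rule disjD[OF jd red(1) _ red(4)])
    then have "?z \<notin> D i (- e)" using z by blast
    then have "act (\<gamma> i [^] e) ?z \<in> D i e" using pong red zP by blast
    then show ?case unfolding l using act_mult[OF pow[OF red(1)] closed[OF red(3)] p(1), of e] by simp
  qed
  have inj: "us = ws" if "us \<in> reduced_words I" "ws \<in> reduced_words I" "?W us = ?W ws" for us ws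
    using that
  proof (induction us arbitrary: ws)
    case Nil
    show ?case
    proof (cases ws)
      case (Cons l ws')
      obtain i e where l: "l = (i, e)" by (cases l)
      have "act (?W ws) p \<in> D i e" using first Nil Cons l by simp
      moreover have "act (?W ws) p = p" using Nil act_one p by (metis word_value_Nil)
      moreover have "i \<in> I" "e \<in> {1, -1}" using Nil Cons l by (simp_all add: reduced_words_Cons)
      ultimately show ?thesis using p by metis
    qed simp
  next
    case (Cons l us)
    obtain i e where l: "l = (i, e)" by (cases l)
    have ie: "i \<in> I" "e \<in> {1, -1}" "us \<in> reduced_words I" using Cons.prems unfolding l by (simp_all add: reduced_words_Cons)
    have u: "act (?W (l # us)) p \<in> D i e" using first Cons.prems unfolding l by blast
    show ?case
    proof (cases ws)
      case Nil
      then have "act (?W (l # us)) p = p" using Cons.prems act_one p by simp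
      then show ?thesis using u p ie by metis
    next
      case (Cons l' ws')
      obtain j d where l': "l' = (j, d)" by (cases l')
      have jd: "j \<in> I" "d \<in> {1, -1}" "ws' \<in> reduced_words I"
        using Cons.prems Cons unfolding l' by (simp_all add: reduced_words_Cons)
      have "act (?W ws) p \<in> D j d" using first Cons.prems Cons unfolding l' by blast
      then have "D i e \<inter> D j d \<noteq> {}" using u Cons.prems(3) by auto
      then have eq: "(i, e) = (j, d)" using disjD[OF ie(1,2) jd(1,2)] by blast
      have "\<gamma> i [^] e \<otimes> ?W us = \<gamma> i [^] e \<otimes> ?W ws'" using Cons.prems(3) Cons l l' eq by simp
      then have "?W us = ?W ws'" using pow ie jd closed by (simp add: l_cancel)
      then show ?thesis using Cons.IH[OF ie(3) jd(3)] Cons l l' eq by simp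
    qed
  qed
  let ?V = "?W ` reduced_words I"
  have letter: "\<gamma> i [^] e \<otimes> x \<in> ?V" if i: "i \<in> I" "e \<in> {1, -1}" and x: "x \<in> ?V" for i x and e :: int
  proof -
    obtain ws where ws: "ws \<in> reduced_words I" "x = ?W ws" using x by blast
    show ?thesis
    proof (cases "ws = [] \<or> hd ws \<noteq> (i, - e)")
      case True
      then have "(i, e) # ws \<in> reduced_words I" using i ws by (simp add: reduced_words_Cons)
      then show ?thesis using ws by (metis imageI word_value_Cons)
    next
      case False
      then obtain us where us: "ws = (i, - e) # us" by (metis list.collapse)
      then have "us \<in> reduced_words I" using ws by (simp add: reduced_words_Cons)
      then show ?thesis using ws us cancel[OF i(1) closed] by simp
    qed
  qed
  have gen_mult: "\<forall>x\<in>?V. g \<otimes> x \<in> ?V" if "g \<in> generate G (\<gamma> ` I)" for g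
    using that
  proof (induction rule: generate.induct)
    case one
    then show ?case using closed by auto
  next
    case (incl h)
    then obtain i where i: "i \<in> I" "h = \<gamma> i" by blast
    have "\<gamma> i [^] (1::int) = h" using i \<gamma> by (simp add: image_subset_iff)
    then show ?case using letter[OF i(1), of 1] by simp
  next
    case (inv h)
    then obtain i where i: "i \<in> I" "h = \<gamma> i" by blast
    have "\<gamma> i [^] (-1::int) = inv h" using i \<gamma> by (simp add: image_subset_iff int_pow_neg)
    then show ?case using letter[OF i(1), of "-1"] by simp
  next
    case (eng h k)
    have hk: "h \<in> carrier G" "k \<in> carrier G" using eng gen by auto
    show ?case
    proof
      fix x assume x: "x \<in> ?V"
      then have "x \<in> carrier G" using closed by auto
      moreover have "h \<otimes> (k \<otimes> x) \<in> ?V" using eng.IH x by blast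
      ultimately show "h \<otimes> k \<otimes> x \<in> ?V" using hk by (simp add: m_assoc)
    qed
  qed
  have one: "\<one> \<in> ?V" by (rule image_eqI[of _ _ "[]"]) (simp_all add: reduced_words_def)
  have "carrier G \<subseteq> ?V"
  proof
    fix g assume g: "g \<in> carrier G"
    then have "g \<otimes> \<one> \<in> ?V" using gen_mult one gen by blast
    then show "g \<in> ?V" using g by simp
  qed
  then have "bij_betw ?W (reduced_words I) (carrier G)"
    unfolding bij_betw_def inj_on_def using inj closed by blast
  then show ?thesis unfolding free_basis_def using \<gamma> by blast
qed

section \<open>The group \<open>PGL\<^sub>2(k)\<close> on disc points\<close>

lemma mat_mult_entry: "(mat c ** M) $ i $ j = c * (M :: 'a::field ^ 2 ^ 2) $ i $ j"
  using exhaust_2[of i] by (auto simp: matrix_matrix_mult_def mat_def sum_2)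

lemma mult_mat_entry: "(M ** mat c) $ i $ j = c * (M :: 'a::field ^ 2 ^ 2) $ i $ j"
  using exhaust_2[of j] by (auto simp: matrix_matrix_mult_def mat_def sum_2)

lemma mat_commute: "mat c ** M = (M :: 'a::field ^ 2 ^ 2) ** mat c"
  by (simp add: vec_eq_iff mat_mult_entry mult_mat_entry)

lemma mat_mat: "mat c ** mat d = (mat (c * d) :: 'a::field ^ 2 ^ 2)"
  by (auto simp: vec_eq_iff mat_mult_entry) (auto simp: mat_def)

lemma invertible_mat: "c \<noteq> 0 \<Longrightarrow> invertible (mat c :: 'a::field ^ 2 ^ 2)"
  by (simp add: invertible_2 mat_def)

lemma GL2_group: "group (GL2 :: ('a::field ^ 2 ^ 2) monoid)"
proof (rule groupI)
  fix M assume "M \<in> carrier (GL2 :: ('a ^ 2 ^ 2) monoid)"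
  then obtain N where "M ** N = mat 1" "N ** M = mat 1" by (auto simp: GL2_def invertible_def)
  then have "invertible N" "N ** M = mat 1" unfolding invertible_def by blast+
  then show "\<exists>N\<in>carrier GL2. N \<otimes>\<^bsub>GL2\<^esub> M = \<one>\<^bsub>GL2\<^esub>" by (auto simp: GL2_def)
qed (auto simp: GL2_def invertible_mult matrix_mul_assoc invertible_mat)

lemma scalars_normal: "{mat c | c. c \<noteq> 0} \<lhd> (GL2 :: ('a::field ^ 2 ^ 2) monoid)"
proof -
  let ?N = "{mat c | c. c \<noteq> 0} :: ('a ^ 2 ^ 2) set"
  interpret group "GL2 :: ('a ^ 2 ^ 2) monoid" by (rule GL2_group)
  have N: "?N \<subseteq> carrier GL2" using invertible_mat by (auto simp: GL2_def)
  have "subgroup ?N GL2"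
  proof (rule subgroupI[OF N])
    show "?N \<noteq> {}" by (auto intro!: exI[of _ 1])
    fix M assume M: "M \<in> ?N"
    then obtain c where c: "M = mat c" "c \<noteq> 0" by blast
    have "mat (inverse c) \<otimes>\<^bsub>GL2\<^esub> M = \<one>\<^bsub>GL2\<^esub>" using c by (simp add: GL2_def mat_mat)
    then have "inv\<^bsub>GL2\<^esub> M = mat (inverse c)"
      using M N c invertible_mat by (intro inv_equality) (auto simp: GL2_def)
    then show "inv\<^bsub>GL2\<^esub> M \<in> ?N" using c by auto
    fix M' assume "M' \<in> ?N"
    then obtain d where "M' = mat d" "d \<noteq> 0" by blast
    then show "M \<otimes>\<^bsub>GL2\<^esub> M' \<in> ?N" using c by (auto simp: GL2_def mat_mat)
  qed
  moreover have "x \<otimes>\<^bsub>GL2\<^esub> h \<otimes>\<^bsub>GL2\<^esub> inv\<^bsub>GL2\<^esub> x \<in> ?N" if x: "x \<in> carrier GL2" and h: "h \<in> ?N" for x h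
  proof -
    obtain c where c: "h = mat c" using h by blast
    have "x \<otimes>\<^bsub>GL2\<^esub> h = h \<otimes>\<^bsub>GL2\<^esub> x" using c by (simp add: GL2_def mat_commute)
    then have "x \<otimes>\<^bsub>GL2\<^esub> h \<otimes>\<^bsub>GL2\<^esub> inv\<^bsub>GL2\<^esub> x = h" using x h N by (simp add: m_assoc subset_iff)
    then show ?thesis using h by simp
  qed
  ultimately show ?thesis using normal_inv_iff by blast
qed

lemma PGL2_group: "group (PGL2 :: ('a::field ^ 2 ^ 2) set monoid)"
  unfolding PGL2_def by (rule normal.factorgroup_is_group[OF scalars_normal])

definition pgl_class :: "'a::field ^ 2 ^ 2 \<Rightarrow> ('a ^ 2 ^ 2) set" where
  "pgl_class M = {mat c ** M | c. c \<noteq> 0}"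

lemma pgl_class_self: "M \<in> pgl_class M"
  unfolding pgl_class_def by (rule CollectI, rule exI[of _ 1]) simp

lemma PGL2_carrier: "carrier PGL2 = pgl_class ` {M :: 'a::field ^ 2 ^ 2. invertible M}"
proof -
  have "{mat c | c. c \<noteq> 0} #>\<^bsub>GL2\<^esub> M = pgl_class M" for M :: "'a ^ 2 ^ 2"
    by (auto simp: r_coset_def pgl_class_def GL2_def)
  then show ?thesis by (auto simp: PGL2_def FactGroup_def RCOSETS_def) (auto simp: GL2_def)
qed

lemma PGL2_mem:
  assumes "\<gamma> \<in> carrier PGL2" "M \<in> \<gamma>"
  shows "invertible M" "\<gamma> = pgl_class M"
proof -
  obtain N where N: "\<gamma> = pgl_class N" "invertible N" using assms(1) unfolding PGL2_carrier by blast
  then obtain c where c: "M = mat c ** N" "c \<noteq> 0" using assms(2) unfolding pgl_class_def by blast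
  then show "invertible M" using N invertible_mult invertible_mat by blast
  have "N = mat (inverse c) ** M" using c by (simp add: matrix_mul_assoc mat_mat)
  then have NM: "mat e ** N = mat (e * inverse c) ** M" and MN: "mat e ** M = mat (e * c) ** N" for e
    using c by (simp_all add: matrix_mul_assoc mat_mat mult.assoc)
  have "mat e ** N \<in> pgl_class M" if "e \<noteq> 0" for e
    unfolding NM pgl_class_def using that c(2) by (intro CollectI exI[of _ "e * inverse c"]) simp
  moreover have "mat e ** M \<in> pgl_class N" if "e \<noteq> 0" for e
    unfolding MN pgl_class_def using that c(2) by (intro CollectI exI[of _ "e * c"]) simp
  ultimately have "pgl_class N = pgl_class M" unfolding pgl_class_def by blast
  then show "\<gamma> = pgl_class M" using N(1) by simp
qed

lemma PGL2_mult_mem: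
  assumes "M \<in> \<gamma>" "N \<in> \<delta>" shows "M ** N \<in> \<gamma> \<otimes>\<^bsub>PGL2\<^esub> \<delta>"
  using assms by (auto simp: PGL2_def FactGroup_def set_mult_def GL2_def)

lemma PGL2_one_mem: "mat 1 \<in> \<one>\<^bsub>PGL2\<^esub>"
  by (auto simp: PGL2_def FactGroup_def intro!: exI[of _ 1])

context nonarch_abs
begin

lemma pgl_act_eq:
  assumes "\<gamma> \<in> carrier PGL2" "M \<in> \<gamma>" "z \<in> berk_P1 v"
  shows "pgl_act v \<gamma> z = moebius v M z"
proof -
  have "(SOME N. N \<in> \<gamma>) \<in> \<gamma>" using assms(2) by (rule someI)
  then obtain c where c: "c \<noteq> 0" "(SOME N. N \<in> \<gamma>) = mat c ** M"
    using PGL2_mem(2)[OF assms(1,2)] unfolding pgl_class_def by auto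
  show ?thesis
    unfolding pgl_act_def by (rule moebius_scale[OF nonarch_abs_axioms assms(3) c(1)]) (simp add: c mat_mult_entry)
qed

lemma PGL2_rep:
  assumes "\<gamma> \<in> carrier PGL2"
  obtains M where "M \<in> \<gamma>" "invertible M" "\<And>z. z \<in> berk_P1 v \<Longrightarrow> pgl_act v \<gamma> z = moebius v M z"
    "\<And>S. S \<subseteq> berk_P1 v \<Longrightarrow> pgl_act v \<gamma> ` S = moebius v M ` S"
proof -
  obtain M where M: "M \<in> \<gamma>" using assms pgl_class_self unfolding PGL2_carrier by blast
  have eq: "pgl_act v \<gamma> z = moebius v M z" if "z \<in> berk_P1 v" for z using pgl_act_eq[OF assms M that] .
  have "pgl_act v \<gamma> ` S = moebius v M ` S" if "S \<subseteq> berk_P1 v" for S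
    by (rule image_cong[OF refl]) (use eq that in auto)
  then show thesis using that[OF M PGL2_mem(1)[OF assms M] eq] by blast
qed

lemma pgl_act_mult:
  assumes "\<gamma> \<in> carrier PGL2" "\<delta> \<in> carrier PGL2" "z \<in> berk_P1 v"
  shows "pgl_act v (\<gamma> \<otimes>\<^bsub>PGL2\<^esub> \<delta>) z = pgl_act v \<gamma> (pgl_act v \<delta> z)"
proof -
  interpret PGL2: group "PGL2 :: ('a ^ 2 ^ 2) set monoid" by (rule PGL2_group)
  obtain M where M: "M \<in> \<gamma>" "invertible M" "\<And>z. z \<in> berk_P1 v \<Longrightarrow> pgl_act v \<gamma> z = moebius v M z"
    by (rule PGL2_rep[OF assms(1)]) (rule that; assumption)
  obtain N where N: "N \<in> \<delta>" "invertible N" "\<And>z. z \<in> berk_P1 v \<Longrightarrow> pgl_act v \<delta> z = moebius v N z"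
    by (rule PGL2_rep[OF assms(2)]) (rule that; assumption)
  have "pgl_act v (\<gamma> \<otimes>\<^bsub>PGL2\<^esub> \<delta>) z = moebius v (M ** N) z"
    using pgl_act_eq[OF PGL2.m_closed[OF assms(1,2)] PGL2_mult_mem[OF M(1) N(1)] assms(3)] .
  also have "\<dots> = moebius v M (moebius v N z)" using moebius_comp[OF assms(3) M(2) N(2)] by simp
  also have "\<dots> = pgl_act v \<gamma> (pgl_act v \<delta> z)"
    using M(3) N(3) moebius_form_val(1)[OF assms(3) N(2)] assms(3) by simp
  finally show ?thesis .
qed

lemma pgl_act_one: "z \<in> berk_P1 v \<Longrightarrow> pgl_act v \<one>\<^bsub>PGL2\<^esub> z = z"
proof -
  assume z: "z \<in> berk_P1 v"
  interpret PGL2: group "PGL2 :: ('a ^ 2 ^ 2) set monoid" by (rule PGL2_group)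
  show ?thesis using pgl_act_eq[OF PGL2.one_closed PGL2_one_mem z] moebius_one[OF z] by simp
qed

lemma pgl_act_closed: "\<gamma> \<in> carrier PGL2 \<Longrightarrow> z \<in> berk_P1 v \<Longrightarrow> pgl_act v \<gamma> z \<in> berk_P1 v"
  by (metis PGL2_rep moebius_form_val(1))

lemma pgl_act_disc_pts: "\<gamma> \<in> carrier PGL2 \<Longrightarrow> z \<in> disc_pts v \<Longrightarrow> pgl_act v \<gamma> z \<in> disc_pts v"
  by (metis PGL2_rep moebius_disc_pts disc_pts_in_P1 subsetD)

lemma pgl_act_hdist:
  assumes "\<gamma> \<in> carrier PGL2" "p \<in> disc_pts v" "q \<in> disc_pts v"
  shows "hdist v (pgl_act v \<gamma> p) (pgl_act v \<gamma> q) = hdist v p q"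
proof -
  obtain M where M: "M \<in> \<gamma>" "invertible M" "\<And>z. z \<in> berk_P1 v \<Longrightarrow> pgl_act v \<gamma> z = moebius v M z"
    by (rule PGL2_rep[OF assms(1)]) (rule that; assumption)
  have "p \<in> berk_P1 v" "q \<in> berk_P1 v" using assms disc_pts_in_P1 by auto
  then show ?thesis using M(3) hdist_moebius[OF assms(2,3) M(2)] by simp
qed

lemma pgl_act_branch:
  assumes "\<gamma> \<in> carrier PGL2" "q \<in> disc_pts v" "p \<in> disc_pts v" "p \<noteq> q"
  shows "pgl_act v \<gamma> ` branch v q p = branch v (pgl_act v \<gamma> q) (pgl_act v \<gamma> p)"
proof -
  obtain M where M: "M \<in> \<gamma>" "invertible M" "\<And>z. z \<in> berk_P1 v \<Longrightarrow> pgl_act v \<gamma> z = moebius v M z"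
    "\<And>S. S \<subseteq> berk_P1 v \<Longrightarrow> pgl_act v \<gamma> ` S = moebius v M ` S"
    by (rule PGL2_rep[OF assms(1)]) (rule that; assumption)
  have P: "p \<in> berk_P1 v" "q \<in> berk_P1 v" using assms disc_pts_in_P1 by auto
  have "branch v q p \<subseteq> berk_P1 v" unfolding branch_def by auto
  then show ?thesis using M(3)[OF P(1)] M(3)[OF P(2)] M(4) moebius_branch[OF assms(2,3) M(2) assms(4)] by simp
qed

lemma PGL2_of_matrix:
  assumes "invertible M"
  obtains \<gamma> where "\<gamma> \<in> carrier PGL2" "\<And>S. S \<subseteq> berk_P1 v \<Longrightarrow> pgl_act v \<gamma> ` S = moebius v M ` S"
proof
  show c: "pgl_class M \<in> carrier PGL2" using assms unfolding PGL2_carrier by blast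
  show "pgl_act v (pgl_class M) ` S = moebius v M ` S" if "S \<subseteq> berk_P1 v" for S
    by (rule image_cong[OF refl]) (use pgl_act_eq[OF c pgl_class_self] that in auto)
qed

lemma discs_A1_in_P1: "open_disc_A1 v a r \<subseteq> berk_P1 v" "closed_disc_A1 v a r \<subseteq> berk_P1 v"
  unfolding open_disc_A1_def closed_disc_A1_def by auto

lemma branch_discs:
  assumes q: "q \<in> disc_pts v" and p: "p \<in> disc_pts v" and "p \<noteq> q"
  shows "open_disc v (branch v q p)" "closed_disc v (berk_P1 v - branch v q p)"
proof -
  have P: "p \<in> berk_P1 v" "q \<in> berk_P1 v" using p q disc_pts_in_P1 by auto
  obtain f where f: "in_dir v q f p" using direction_exists[OF p q \<open>p \<noteq> q\<close>] .
  have f0: "f \<noteq> 0" using in_dir_nonzero[OF P(2,1) f] .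
  note eq = branch_eq_dir_disc[OF q P(1) f]
  obtain M a r where M: "invertible M" "0 < r" "dir_disc v q f = moebius v M ` open_disc_A1 v a r"
    using dir_disc_is_disc(1)[OF q f0] by blast
  obtain \<gamma> where g: "\<gamma> \<in> carrier PGL2" "\<And>S. S \<subseteq> berk_P1 v \<Longrightarrow> pgl_act v \<gamma> ` S = moebius v M ` S"
    by (rule PGL2_of_matrix[OF M(1)]) (rule that; assumption)
  show "open_disc v (branch v q p)"
    unfolding open_disc_def eq using M g(1) g(2)[OF discs_A1_in_P1(1)] by metis
  obtain M' a' r' where M': "invertible M'" "0 < r'" "berk_P1 v - dir_disc v q f = moebius v M' ` closed_disc_A1 v a' r'"
    using dir_disc_is_disc(2)[OF q f0] by blast
  obtain \<gamma>' where g': "\<gamma>' \<in> carrier PGL2" "\<And>S. S \<subseteq> berk_P1 v \<Longrightarrow> pgl_act v \<gamma>' ` S = moebius v M' ` S"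
    by (rule PGL2_of_matrix[OF M'(1)]) (rule that; assumption)
  show "closed_disc v (berk_P1 v - branch v q p)"
    unfolding closed_disc_def eq using M' g'(1) g'(2)[OF discs_A1_in_P1(2)] by metis
qed

lemma open_disc_is_dir_disc:
  assumes "open_disc v D"
  obtains q f where "q \<in> disc_pts v" "D = dir_disc v q f"
proof -
  obtain \<gamma> a r where g: "\<gamma> \<in> carrier PGL2" "0 < r" "D = pgl_act v \<gamma> ` open_disc_A1 v a r"
    using assms unfolding open_disc_def by blast
  obtain M where M: "M \<in> \<gamma>" "invertible M" "\<And>z. z \<in> berk_P1 v \<Longrightarrow> pgl_act v \<gamma> z = moebius v M z"
    "\<And>S. S \<subseteq> berk_P1 v \<Longrightarrow> pgl_act v \<gamma> ` S = moebius v M ` S"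
    by (rule PGL2_rep[OF g(1)]) (rule that; assumption)
  obtain q f where "q \<in> disc_pts v" "moebius v M ` open_disc_A1 v a r = dir_disc v q f"
    by (rule moebius_open_disc[OF M(2) g(2)])
  then show thesis using that g(3) M(4)[OF discs_A1_in_P1(1)] by metis
qed

text \<open>Crossing \<open>q\<close> on the way from \<open>p\<close> to \<open>p'\<close>, the open disc ahead is maximal in the complement of the one behind.\<close>
lemma branch_maximal_open_disc:
  assumes p: "p \<in> disc_pts v" and q: "q \<in> disc_pts v" and p': "p' \<in> disc_pts v" and "p \<noteq> q" "p' \<noteq> q"
    and between: "hdist v p q + hdist v q p' = hdist v p p'"
  shows "maximal_open_disc_in v (branch v q p') (berk_P1 v - branch v q p)"
  unfolding maximal_open_disc_in_def
proof (intro conjI allI impI)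
  show "open_disc v (branch v q p')" by (rule branch_discs(1)[OF q p' \<open>p' \<noteq> q\<close>])
  have "branch v q p' \<subseteq> berk_P1 v" unfolding branch_def by auto
  then show "branch v q p' \<subseteq> berk_P1 v - branch v q p"
    using branch_disjoint[OF p q p' \<open>p \<noteq> q\<close> \<open>p' \<noteq> q\<close> between] by blast
  fix D assume D: "open_disc v D \<and> D \<subseteq> berk_P1 v - branch v q p \<and> branch v q p' \<subseteq> D"
  then obtain q2 f2 where q2: "q2 \<in> disc_pts v" "D = dir_disc v q2 f2" using open_disc_is_dir_disc by blast
  show "D = branch v q p'"
    unfolding q2(2) by (rule maximal_dir_disc[OF p q p' \<open>p \<noteq> q\<close> \<open>p' \<noteq> q\<close> between q2(1)]) (use D q2(2) in auto)
qed

text \<open>The set is the projection to the discrete group of the preimage of \<open>K \<times> K\<close> under a proper map, hence compact.\<close>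
lemma proper_action_finite:
  assumes proper: "proper_action_on v \<Gamma> U" and K: "compactin (berk_P1_top v) K" "K \<subseteq> U" and U: "U \<subseteq> berk_P1 v"
  shows "finite {\<gamma> \<in> \<Gamma>. \<exists>z\<in>K. pgl_act v \<gamma> z \<in> K}"
proof -
  let ?E = "subtopology (berk_P1_top v) U" and ?f = "\<lambda>(\<gamma>, z). (z, pgl_act v \<gamma> z)"
  let ?X = "prod_topology (discrete_topology \<Gamma>) ?E"
  have "compactin ?E K" using K by (simp add: compactin_subtopology)
  then have "compactin (prod_topology ?E ?E) (K \<times> K)" by (simp add: compactin_Times)
  then have C: "compactin ?X {x \<in> topspace ?X. ?f x \<in> K \<times> K}"
    using proper unfolding proper_action_on_def Let_def by (intro compactin_proper_map_preimage)
  have "compactin (discrete_topology \<Gamma>) (fst ` {x \<in> topspace ?X. ?f x \<in> K \<times> K})"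
    by (rule image_compactin[OF C continuous_map_fst])
  then have "finite (fst ` {x \<in> topspace ?X. ?f x \<in> K \<times> K})" by (simp add: compactin_discrete_topology)
  moreover have "{\<gamma> \<in> \<Gamma>. \<exists>z\<in>K. pgl_act v \<gamma> z \<in> K} \<subseteq> fst ` {x \<in> topspace ?X. ?f x \<in> K \<times> K}"
  proof
    fix \<gamma> assume "\<gamma> \<in> {\<gamma> \<in> \<Gamma>. \<exists>z\<in>K. pgl_act v \<gamma> z \<in> K}"
    then obtain z where "\<gamma> \<in> \<Gamma>" "z \<in> K" "pgl_act v \<gamma> z \<in> K" by blast
    then have "(\<gamma>, z) \<in> {x \<in> topspace ?X. ?f x \<in> K \<times> K}" using K(2) U by auto
    then show "\<gamma> \<in> fst ` {x \<in> topspace ?X. ?f x \<in> K \<times> K}" by (rule image_eqI[rotated]) simp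
  qed
  ultimately show ?thesis using finite_subset by blast
qed

lemma compact_segment:
  assumes U: "connectedin (berk_P1_top v) U" and p: "p \<in> disc_pts v \<inter> U" and q: "q \<in> disc_pts v \<inter> U"
  obtains K where "compactin (berk_P1_top v) K" "K \<subseteq> U"
    "{z \<in> disc_pts v \<inter> U. hdist v p z + hdist v z q = hdist v p q} \<subseteq> K"
proof -
  obtain a r where pa: "p = disc_pt v a r" "0 < r" using p unfolding disc_pts_def by auto
  obtain b s where qb: "q = disc_pt v b s" "0 < s" using q unfolding disc_pts_def by auto
  let ?K = "disc_pt v a ` {r..join_radius v a r b s} \<union> disc_pt v b ` {s..join_radius v b s a r}"
  show thesis
  proof
    show "compactin (berk_P1_top v) ?K" using compactin_path pa qb by (intro compactin_Un) auto
    show "?K \<subseteq> U"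
      using connected_disc_convex[OF U, of a r b s] connected_disc_convex[OF U, of b s a r] p q pa qb by auto
    show "{z \<in> disc_pts v \<inter> U. hdist v p z + hdist v z q = hdist v p q} \<subseteq> ?K"
    proof
      fix z assume z: "z \<in> {z \<in> disc_pts v \<inter> U. hdist v p z + hdist v z q = hdist v p q}"
      then obtain c t where "z = disc_pt v c t" "0 < t" unfolding disc_pts_def by auto
      then show "z \<in> ?K" using hdist_between[OF pa(2) qb(2), of t a c b] z pa qb by auto
    qed
  qed
qed

end

section \<open>The tree of a Schottky group and its figure\<close>

text \<open>The disc points in the invariant open set form the tree. Properness is applied to the union of the compact sets
  that contain the two segments.\<close>
lemma schottky_tree_action:
  fixes v :: "'a::field \<Rightarrow> real" and w :: "'a alg_closure \<Rightarrow> real"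
  assumes v: "complete_nonarch_field v" and w: "extends_to_alg_closure v w"
    and \<Gamma>: "schottky_group v w \<Gamma>" and nontrivial: "\<Gamma> \<noteq> {\<one>\<^bsub>PGL2\<^esub>}"
  obtains U S p where "tree_action (PGL2\<lparr>carrier := \<Gamma>\<rparr>) (disc_pts v \<inter> U) (hdist v) (pgl_act v) S p"
proof -
  interpret complete_nonarch_field v by (rule v)
  interpret PGL2: group "PGL2 :: ('a ^ 2 ^ 2) set monoid" by (rule PGL2_group)
  let ?G = "PGL2\<lparr>carrier := \<Gamma>\<rparr>"
  have sub: "subgroup \<Gamma> PGL2" and lox: "\<And>\<gamma>. \<gamma> \<in> \<Gamma> \<Longrightarrow> \<gamma> \<noteq> \<one>\<^bsub>PGL2\<^esub> \<Longrightarrow> loxodromic w \<gamma>"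
    and fg: "finitely_generated_group ?G"
    using \<Gamma> unfolding schottky_group_def by auto
  have carr: "\<gamma> \<in> carrier PGL2" if "\<gamma> \<in> \<Gamma>" for \<gamma> using that subgroup.subset[OF sub] by auto
  have "\<exists>U. U \<noteq> {} \<and> (\<forall>\<gamma>\<in>\<Gamma>. pgl_act v \<gamma> ` U = U) \<and> connectedin (berk_P1_top v) U \<and>
      openin (berk_P1_top v) U \<and> free_action_on v \<Gamma> U \<and> proper_action_on v \<Gamma> U"
    using \<Gamma> unfolding schottky_group_def by (elim conjE)
  then obtain U where "U \<noteq> {} \<and> (\<forall>\<gamma>\<in>\<Gamma>. pgl_act v \<gamma> ` U = U) \<and> connectedin (berk_P1_top v) U \<and>
      openin (berk_P1_top v) U \<and> free_action_on v \<Gamma> U \<and> proper_action_on v \<Gamma> U" ..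
  then have U: "U \<noteq> {}" "\<And>\<gamma>. \<gamma> \<in> \<Gamma> \<Longrightarrow> pgl_act v \<gamma> ` U = U" "connectedin (berk_P1_top v) U"
      "free_action_on v \<Gamma> U" "proper_action_on v \<Gamma> U" by simp_all
  have UP: "U \<subseteq> berk_P1 v" using connectedin_subset_topspace[OF U(3)] by simp
  have inv: "pgl_act v \<gamma> z \<in> U" if "\<gamma> \<in> \<Gamma>" "z \<in> U" for \<gamma> z using U(2)[OF that(1)] that(2) by blast
  obtain S where S: "finite S" "S \<subseteq> \<Gamma>" "generate ?G S = \<Gamma>"
    using fg unfolding finitely_generated_group_def by auto
  obtain \<gamma> where \<gamma>: "\<gamma> \<in> \<Gamma>" "\<gamma> \<noteq> \<one>\<^bsub>PGL2\<^esub>" using nontrivial subgroup.one_closed[OF sub] by blast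
  obtain M where M: "M \<in> \<gamma>" "loxodromic_matrix w M" using lox[OF \<gamma>] unfolding loxodromic_def by blast
  obtain f f' c c' where eig: "f \<noteq> 0" "f v* M = c *s f" "f' \<noteq> 0" "f' v* M = c' *s f'" "v c \<noteq> v c'"
    using loxodromic_row_eigenvectors[OF w M(2)] by blast
  obtain z where z: "z \<in> U" using U(1) by blast
  have Mz: "moebius v M z = pgl_act v \<gamma> z" using pgl_act_eq[OF carr[OF \<gamma>(1)] M(1)] z UP by auto
  have "pgl_act v \<gamma> z \<noteq> z" using U(4) \<gamma> z unfolding free_action_on_def by blast
  then obtain a r where ar: "0 < r" "disc_pt v a r \<in> U"
    using connected_invariant_has_disc_pt[OF U(3) z _ _ PGL2_mem(1)[OF carr[OF \<gamma>(1)] M(1)] eig]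
      Mz inv[OF \<gamma>(1) z] by auto
  let ?D = "disc_pts v \<inter> U"
  interpret tree_metric ?D "hdist v"
  proof (rule disc_tree_metric)
    fix a b r s t assume "disc_pt v a r \<in> ?D" "disc_pt v b s \<in> ?D" "0 < r" "0 < s" "r \<le> t" "t \<le> join_radius v a r b s"
    then show "disc_pt v a t \<in> ?D" using connected_disc_convex[OF U(3), of a r b s t] disc_pt_mem[of t a] by auto
  qed simp
  have G: "group ?G" by (rule subgroup.subgroup_is_group[OF sub PGL2_group])
  have "tree_action ?G ?D (hdist v) (pgl_act v) S (disc_pt v a r)"
  proof (intro tree_action.intro tree_action_axioms.intro G tree_metric_axioms)
    show "pgl_act v g x \<in> ?D" if "g \<in> carrier ?G" "x \<in> ?D" for g x
      using that pgl_act_disc_pts carr inv by auto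
    show "pgl_act v (g \<otimes>\<^bsub>?G\<^esub> h) x = pgl_act v g (pgl_act v h x)"
      if "g \<in> carrier ?G" "h \<in> carrier ?G" "x \<in> ?D" for g h x
      using that pgl_act_mult carr UP by auto
    show "pgl_act v \<one>\<^bsub>?G\<^esub> x = x" if "x \<in> ?D" for x using that pgl_act_one UP by auto
    show "hdist v (pgl_act v g x) (pgl_act v g y) = hdist v x y"
      if "g \<in> carrier ?G" "x \<in> ?D" "y \<in> ?D" for g x y
      using that pgl_act_hdist carr by auto
    show "g = \<one>\<^bsub>?G\<^esub>" if "g \<in> carrier ?G" "x \<in> ?D" "pgl_act v g x = x" for g x
      using that U(4) unfolding free_action_on_def by auto
    show "finite S" "S \<subseteq> carrier ?G" "generate ?G S = carrier ?G" using S by auto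
    show "disc_pt v a r \<in> ?D" using ar disc_pt_mem by auto
    fix x y x' y' assume D: "x \<in> ?D" "y \<in> ?D" "x' \<in> ?D" "y' \<in> ?D"
    obtain K where K: "compactin (berk_P1_top v) K" "K \<subseteq> U" "seg x y \<subseteq> K"
      using compact_segment[OF U(3) D(1,2)] unfolding seg_def by blast
    obtain K' where K': "compactin (berk_P1_top v) K'" "K' \<subseteq> U" "seg x' y' \<subseteq> K'"
      using compact_segment[OF U(3) D(3,4)] unfolding seg_def by blast
    have "finite {\<gamma> \<in> \<Gamma>. \<exists>z\<in>K \<union> K'. pgl_act v \<gamma> z \<in> K \<union> K'}"
      using proper_action_finite[OF U(5) compactin_Un[OF K(1) K'(1)] _ UP] K(2) K'(2) by blast
    then show "finite {g \<in> carrier ?G. pgl_act v g ` seg x y \<inter> seg x' y' \<noteq> {}}"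
      by (rule rev_finite_subset) (use K(3) K'(3) in auto)
  qed
  then show thesis by (rule that)
qed

theorem theorem3p26:
  fixes v :: "'a::field \<Rightarrow> real"
    and w :: "'a alg_closure \<Rightarrow> real"
    and \<Gamma> :: "('a ^ 2 ^ 2) set set"
  assumes "complete_nonarch_field v"
    and "extends_to_alg_closure v w"
    and "schottky_group v w \<Gamma>"
  shows "\<exists>g \<gamma> D. free_basis (PGL2\<lparr>carrier := \<Gamma>\<rparr>) {1..g} \<gamma> \<and> schottky_figure_adapted v g \<gamma> D"
proof (cases "\<Gamma> = {\<one>\<^bsub>PGL2\<^esub>}")
  case True
  have "reduced_words ({1..0} :: nat set) = {[]}" by (auto simp: reduced_words_def)
  then have "free_basis (PGL2\<lparr>carrier := \<Gamma>\<rparr>) {1..0 :: nat} (\<lambda>_. {})"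
    unfolding free_basis_def using True by (simp add: bij_betw_def)
  moreover have "schottky_figure_adapted v 0 (\<lambda>_. {}) (\<lambda>_ _. {})"
    unfolding schottky_figure_adapted_def by (simp add: disjoint_family_on_def)
  ultimately show ?thesis by blast
next
  case False
  let ?G = "PGL2\<lparr>carrier := \<Gamma>\<rparr>"
  interpret complete_nonarch_field v by (rule assms(1))
  interpret PGL2: group "PGL2 :: ('a ^ 2 ^ 2) set monoid" by (rule PGL2_group)
  have sub: "subgroup \<Gamma> PGL2" using assms(3) unfolding schottky_group_def by auto
  have carr: "\<gamma> \<in> carrier PGL2" if "\<gamma> \<in> \<Gamma>" for \<gamma> using that subgroup.subset[OF sub] by auto
  obtain U S p where "tree_action ?G (disc_pts v \<inter> U) (hdist v) (pgl_act v) S p"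
    by (rule schottky_tree_action[OF assms False])
  then interpret tree_action ?G "disc_pts v \<inter> U" "hdist v" "pgl_act v" S p .
  obtain B m where B: "finite B" "B \<subseteq> carrier ?G" "generate ?G B = carrier ?G"
    and Binv: "\<And>g. g \<in> B \<Longrightarrow> inv\<^bsub>?G\<^esub> g \<notin> B"
    and between: "\<And>g. g \<in> B \<union> m_inv ?G ` B \<Longrightarrow> m g \<in> seg p (pgl_act v g p)"
    and cut_inv: "\<And>g. g \<in> B \<union> m_inv ?G ` B \<Longrightarrow> m (inv\<^bsub>?G\<^esub> g) = pgl_act v (inv\<^bsub>?G\<^esub> g) (m g)"
    and unnested: "\<And>g h. \<lbrakk>g \<in> B \<union> m_inv ?G ` B; h \<in> B \<union> m_inv ?G ` B; g \<noteq> h\<rbrakk> \<Longrightarrow> m g \<notin> seg p (m h)"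
    by (rule separating_generators) (rule that; assumption)
  define g where "g = card B"
  obtain \<beta> where \<beta>: "bij_betw \<beta> {1..g} B"
    using ex_bij_betw_nat_finite_1[OF B(1)] unfolding g_def by blast
  let ?L = "B \<union> m_inv ?G ` B"
  \<comment> \<open>the closed disc beyond the cutting point, seen from \<open>p\<close>\<close>
  define D where "D i e = berk_P1 v - branch v (m (\<beta> i [^]\<^bsub>?G\<^esub> (e :: int))) p" for i e
  have pD: "p \<in> disc_pts v" using base_in by simp
  have BG: "b \<in> \<Gamma>" if "b \<in> B" for b using B(2) that by auto
  have LG: "s \<in> \<Gamma>" if "s \<in> ?L" for s using that BG inv_closed by auto
  have Linv: "inv\<^bsub>?G\<^esub> s \<in> ?L" if "s \<in> ?L" for s using that BG inv_inv by auto
  have inv_neq: "inv\<^bsub>?G\<^esub> s \<noteq> s" if s: "s \<in> ?L" for s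
  proof
    assume eq: "inv\<^bsub>?G\<^esub> s = s"
    from s consider "s \<in> B" | b where "b \<in> B" "s = inv\<^bsub>?G\<^esub> b" by blast
    then show False
    proof cases
      case 1 then show False using Binv[OF 1] eq by simp
    next
      case 2 then show False using Binv[OF 2(1)] eq inv_inv[of b] BG[OF 2(1)] by simp
    qed
  qed
  have mD: "m s \<in> disc_pts v \<inter> U" if "s \<in> ?L" for s using seg_in[OF between[OF that]] .
  have m_neq: "p \<noteq> m s" if s: "s \<in> ?L" for s
  proof
    assume "p = m s"
    then have "m s \<in> seg p (m (inv\<^bsub>?G\<^esub> s))" using seg_ends(1)[OF base_in mD[OF Linv[OF s]]] by simp
    then show False using unnested[OF s Linv[OF s]] inv_neq[OF s] by auto
  qed
  have cut_act: "pgl_act v s (m (inv\<^bsub>?G\<^esub> s)) = m s" if s: "s \<in> ?L" for s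
    using cut_inv[OF s] act_inv(2)[of s "m s"] LG[OF s] mD[OF s] by simp
  have sp_neq: "pgl_act v s p \<noteq> m s" if s: "s \<in> ?L" for s
  proof
    assume "pgl_act v s p = m s"
    then have "pgl_act v s p = pgl_act v s (m (inv\<^bsub>?G\<^esub> s))" using cut_act[OF s] by simp
    then have "p = m (inv\<^bsub>?G\<^esub> s)" using act_cancel[of s p] LG[OF s] base_in mD[OF Linv[OF s]] by simp
    then show False using m_neq[OF Linv[OF s]] by simp
  qed
  have sp: "pgl_act v s p \<in> disc_pts v" if "s \<in> ?L" for s using act_closed[of s p] LG[OF that] base_in by simp
  have moved: "pgl_act v s ` branch v (m (inv\<^bsub>?G\<^esub> s)) p = branch v (m s) (pgl_act v s p)" if s: "s \<in> ?L" for s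
    using pgl_act_branch[OF carr[OF LG[OF s]] _ pD m_neq[OF Linv[OF s]]] mD[OF Linv[OF s]] cut_act[OF s] by simp
  have maxi: "maximal_open_disc_in v (branch v (m s) (pgl_act v s p)) (berk_P1 v - branch v (m s) p)" if s: "s \<in> ?L" for s
    using branch_maximal_open_disc[OF pD _ sp[OF s] m_neq[OF s] sp_neq[OF s]] mD[OF s] between[OF s]
    unfolding seg_def by simp
  have letter: "\<beta> i [^]\<^bsub>?G\<^esub> (1 :: int) = \<beta> i" "\<beta> i [^]\<^bsub>?G\<^esub> (-1 :: int) = inv\<^bsub>?G\<^esub> (\<beta> i)" "\<beta> i \<in> B"
    if "i \<in> {1..g}" for i
  proof -
    show b: "\<beta> i \<in> B" using \<beta> that bij_betwE by blast
    then show "\<beta> i [^]\<^bsub>?G\<^esub> (1 :: int) = \<beta> i" "\<beta> i [^]\<^bsub>?G\<^esub> (-1 :: int) = inv\<^bsub>?G\<^esub> (\<beta> i)"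
      using B(2) int_pow_neg[of "\<beta> i" 1] by auto
  qed
  have L: "\<beta> i [^]\<^bsub>?G\<^esub> e \<in> ?L" "\<beta> i [^]\<^bsub>?G\<^esub> (- e) = inv\<^bsub>?G\<^esub> (\<beta> i [^]\<^bsub>?G\<^esub> e)"
    if "i \<in> {1..g}" "e \<in> {1, -1}" for i and e :: int
    using letter[OF that(1)] that(2) BG inv_inv by auto
  have L_inj: "i = j \<and> e = d" if hyp: "i \<in> {1..g}" "j \<in> {1..g}" "e \<in> {1, -1}" "d \<in> {1, -1}"
     "\<beta> i [^]\<^bsub>?G\<^esub> e = \<beta> j [^]\<^bsub>?G\<^esub> d" for i j and e d :: int
  proof -
    note li = letter[OF hyp(1)] and lj = letter[OF hyp(2)]
    have inj: "\<beta> i = \<beta> j \<Longrightarrow> i = j" using \<beta> hyp(1,2) unfolding bij_betw_def inj_on_def by blast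
    consider "e = 1" "d = 1" | "e = -1" "d = -1" | "e = 1" "d = -1" | "e = -1" "d = 1" using hyp(3,4) by auto
    then have "e = d \<and> \<beta> i = \<beta> j"
    proof cases
      case 1 then show ?thesis using hyp(5) li lj by simp
    next
      case 2
      then have "inv\<^bsub>?G\<^esub> (\<beta> i) = inv\<^bsub>?G\<^esub> (\<beta> j)" using hyp(5) li lj by simp
      then have "\<beta> i = \<beta> j" using B(2) li(3) lj(3) inv_inj by (metis inj_onD subsetD)
      then show ?thesis using 2 by simp
    next
      case 3
      then have "\<beta> i = inv\<^bsub>?G\<^esub> (\<beta> j)" using hyp(5) li lj by simp
      then show ?thesis using Binv[OF lj(3)] li(3) by simp
    next
      case 4
      then have "inv\<^bsub>?G\<^esub> (\<beta> i) = \<beta> j" using hyp(5) li lj by simp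
      then show ?thesis using Binv[OF li(3)] lj(3) by simp
    qed
    then show ?thesis using inj by blast
  qed
  have pow: "\<beta> i [^]\<^bsub>PGL2\<^esub> e = \<beta> i [^]\<^bsub>?G\<^esub> e" if i: "i \<in> {1..g}" "e \<in> {1, -1}" for i and e :: int
  proof -
    have b: "\<beta> i \<in> \<Gamma>" using letter(3)[OF i(1)] BG by blast
    have "\<beta> i [^]\<^bsub>PGL2\<^esub> (1 :: int) = \<beta> i" "\<beta> i [^]\<^bsub>PGL2\<^esub> (-1 :: int) = inv\<^bsub>PGL2\<^esub> (\<beta> i)"
      using carr[OF b] PGL2.int_pow_neg[of "\<beta> i" 1] by auto
    moreover have "inv\<^bsub>?G\<^esub> (\<beta> i) = inv\<^bsub>PGL2\<^esub> (\<beta> i)" by (rule PGL2.m_inv_consistent[OF sub b])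
    ultimately show ?thesis using letter[OF i(1)] i(2) by auto
  qed
  have branch_sub: "branch v q x \<subseteq> berk_P1 v" for q x unfolding branch_def by auto
  have compl: "berk_P1 v - D i e = branch v (m (\<beta> i [^]\<^bsub>?G\<^esub> e)) p" for i e
    unfolding D_def using branch_sub by blast
  have disj: "disjoint_family_on (\<lambda>(i, e). D i e) ({1..g} \<times> {1, -1})"
    unfolding disjoint_family_on_def
  proof (intro ballI impI)
    fix x y :: "nat \<times> int" assume xy: "x \<in> {1..g} \<times> {1, -1}" "y \<in> {1..g} \<times> {1, -1}" "x \<noteq> y"
    obtain i e j d where x: "x = (i, e)" and y: "y = (j, d)" by (cases x, cases y)
    have i: "i \<in> {1..g}" "j \<in> {1..g}" "e \<in> {1, -1}" "d \<in> {1, -1}" "(i, e) \<noteq> (j, d)"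
      using xy unfolding x y by auto
    let ?s = "\<beta> i [^]\<^bsub>?G\<^esub> e" and ?t = "\<beta> j [^]\<^bsub>?G\<^esub> d"
    have s: "?s \<in> ?L" and t: "?t \<in> ?L" using L(1) i by blast+
    have neq: "?s \<noteq> ?t" using L_inj[OF i(1-4)] i(5) by blast
    have "branch v (m ?s) p \<union> branch v (m ?t) p = berk_P1 v"
      using branches_cover[OF pD _ _ m_neq[OF s] m_neq[OF t]] mD[OF s] mD[OF t]
        unnested[OF s t neq] unnested[OF t s neq[symmetric]] unfolding seg_def by auto
    then show "(case x of (i, e) \<Rightarrow> D i e) \<inter> (case y of (i, e) \<Rightarrow> D i e) = {}"
      unfolding x y D_def by auto
  qed
  have "schottky_figure_adapted v g \<beta> D"
    unfolding schottky_figure_adapted_def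
  proof (intro conjI ballI disj)
    show "\<beta> i \<in> carrier PGL2" if "i \<in> {1..g}" for i using letter(3)[OF that] BG carr by blast
    fix i and e :: int assume i: "i \<in> {1..g}" and e: "e \<in> {1, -1}"
    let ?s = "\<beta> i [^]\<^bsub>?G\<^esub> e"
    have s: "?s \<in> ?L" using L(1)[OF i e] .
    show "closed_disc v (D i e)"
      unfolding D_def using branch_discs(2)[OF _ pD m_neq[OF s]] mD[OF s] by simp
    show "maximal_open_disc_in v (pgl_act v (\<beta> i [^]\<^bsub>PGL2\<^esub> e) ` (berk_P1 v - D i (- e))) (D i e)"
      unfolding compl pow[OF i e] L(2)[OF i e] moved[OF s] unfolding D_def by (rule maxi[OF s])
  qed
  moreover have "free_basis ?G {1..g} \<beta>"
  proof (rule ping_pong_free_basis[where act = "pgl_act v" and P = "berk_P1 v" and D = D and p = p])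
    have im: "\<beta> ` {1..g} = B" using \<beta> by (simp add: bij_betw_def)
    show "\<beta> ` {1..g} \<subseteq> carrier ?G" "generate ?G (\<beta> ` {1..g}) = carrier ?G" unfolding im using B by auto
    show "pgl_act v h z \<in> berk_P1 v" if "h \<in> carrier ?G" "z \<in> berk_P1 v" for h z
      using that pgl_act_closed carr by simp
    show "pgl_act v (h \<otimes>\<^bsub>?G\<^esub> k) z = pgl_act v h (pgl_act v k z)"
      if "h \<in> carrier ?G" "k \<in> carrier ?G" "z \<in> berk_P1 v" for h k z
      using that pgl_act_mult carr by simp
    show "pgl_act v \<one>\<^bsub>?G\<^esub> z = z" if "z \<in> berk_P1 v" for z using that pgl_act_one by simp
    show "disjoint_family_on (\<lambda>(i, e). D i e) ({1..g} \<times> {1, -1})" by (rule disj)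
    show "p \<in> berk_P1 v" using pD disc_pts_in_P1 by auto
    fix i and e :: int assume i: "i \<in> {1..g}" and e: "e \<in> {1, -1}"
    let ?s = "\<beta> i [^]\<^bsub>?G\<^esub> e"
    have s: "?s \<in> ?L" using L(1)[OF i e] .
    have msD: "m ?s \<in> disc_pts v" using mD[OF s] by simp
    have "p \<in> branch v (m ?s) p"
      using branch_mem_iff[OF pD msD pD m_neq[OF s]] m_neq[OF s] seg_self[OF base_in] mD[OF s]
      unfolding seg_def by auto
    then show "p \<notin> D i e" unfolding D_def by simp
    fix z assume "z \<in> berk_P1 v" "z \<notin> D i (- e)"
    then have "z \<in> branch v (m (inv\<^bsub>?G\<^esub> ?s)) p" using compl[of i "- e"] L(2)[OF i e] by auto
    then have "pgl_act v ?s z \<in> branch v (m ?s) (pgl_act v ?s p)" using moved[OF s] by blast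
    then show "pgl_act v ?s z \<in> D i e" using maxi[OF s] unfolding maximal_open_disc_in_def D_def by blast
  qed
  ultimately show ?thesis by blast
qed

end
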